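(* Let $p(y_1,y_2|x_1,x_2)$ be a two-user discrete memoryless interference channel with finite alphabets $\mathcal{X}_1,\mathcal{X}_2,\mathcal{Y}_1,\mathcal{Y}_2$. Let $Q,U_1,U_2$ be auxiliary random variables with finite alphabets, and let $(Q,U_1,X_1,U_2,X_2,Y_1,Y_2)$ have joint pmf $p(q)\,p(u_1,x_1|q)\,p(u_2,x_2|q)\,p(y_1,y_2|x_1,x_2)$. Let $R_1,R_2\ge 0$ satisfy $$\begin{aligned} R_1 & < I(X_1;Y_1|U_2,Q),\\ R_2 & < I(X_2;Y_2|U_1,Q),\\ R_1 + R_2 & < I(X_1;Y_1|U_1,U_2,Q) +I(X_2,U_1;Y_2|Q) ,\\ R_1 + R_2 & < I(X_1,U_2;Y_1|U_1,Q) + I(X_2,U_1;Y_2|U_2,Q),\\ R_1 + R_2 & < I(X_1,U_2;Y_1|Q) + I(X_2;Y_2|U_1,U_2,Q),\\ 2R_1 + R_2 & < I(X_1;Y_1|U_1,U_2,Q) + I(X_2,U_1;Y_2|U_2,Q) + I(X_1,U_2;Y_1|Q),\\ R_1 + 2R_2 & < I(X_2;Y_2|U_1,U_2,Q) + I(X_1,U_2;Y_1|U_1,Q) + I(X_2,U_1;Y_2|Q). \end{aligned}$$ Then there exist $R_{1c},R_{1p},R_{2c},R_{2p}\ge 0$ and $0<\epsilon'<\epsilon$ such that the multicoding scheme (defined in the context) with these parameters has average probability of error, averaged over the uniformly distributed messages, the random codebooks and the channel, tending to $0$ as $n\to\infty$. In particular, the (Han-Kobayashi) rate pair $(R_1,R_2)$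 is achievable by the multicoding scheme.
   Context: Notation: $[1:2^{nR}]$ denotes the message/index set $\{1,\dots,\lceil 2^{nR}\rceil\}$; $\mathcal{T}^{(n)}_\epsilon$ denotes the set of $\epsilon$-strongly jointly typical length-$n$ sequences, i.e. tuples whose empirical joint frequencies $\pi$ satisfy $|\pi(a)-p(a)|\le\epsilon\, p(a)$ for every symbol tuple $a$, where $p$ is the relevant marginal of the fixed joint pmf. The channel is used $n$ times without memory; sender $j\in\{1,2\}$ wants to communicate $M_j$, uniform on $[1:2^{nR_j}]$ and independent of the other message, to receiver $j$, which observes $Y_j^n$. Multicoding scheme (with time-sharing variable $Q$). A sequence $q^n$ is generated i.i.d. according to $p(q)$ and revealed to all nodes. Codebook generation: for each $j\in\{1,2\}$, encoder $j$ generates a coordination codebook of sequences $u_j^n(l_{jc})$, $l_{jc}\in[1:2^{nR_{jc}}]$, each according to $\prod_{i=1}^n p_{U_j|Q}(\cdot|q_i)$, and, independently, a transmission multicodebook of sequences $x_j^n(m_j,l_{jp})$, $m_j\in[1:2^{nR_j}]$, $l_{jp}\in[1:2^{nR_{jp}}]$, each according to $\prod_{i=1}^n p_{X_j|Q}(\cdot|q_i)$; all sequences are mutually conditionally independent given $q^n$. (So the $u_j^n$ codewords carry no message, and no message is split.) The codebooks are revealed to all nodes. Encoding: to send $m_j$, encoder $j$ finds a pair $(l_{jc},l_{jp})$ (say the first in lexicographic order) with $(q^n,u_j^n(l_{jc}),x_j^n(m_j,l_{jp}))\in\mathcal{T}^{(n)}_{\epsilon'}$ and transmits $x_j^n(m_j,l_{jp})$;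 if there is none, it transmits $x_j^n(m_j,1)$. Decoding: decoder 1 declares the unique $\hat m_1$ such that $(q^n,u_1^n(l_{1c}),x_1^n(\hat m_1,l_{1p}),u_2^n(l_{2c}),y_1^n)\in\mathcal{T}^{(n)}_{\epsilon}$ for some $(l_{1c},l_{1p},l_{2c})$, and declares an error if there is no such $\hat m_1$ or more than one. Decoder 2 declares the unique $\hat m_2$ such that $(q^n,u_2^n(l_{2c}),x_2^n(\hat m_2,l_{2p}),u_1^n(l_{1c}),y_2^n)\in\mathcal{T}^{(n)}_{\epsilon}$ for some $(l_{2c},l_{2p},l_{1c})$, and declares an error otherwise. The probability of error is $\Pr\{\hat M_1\ne M_1\text{ or }\hat M_2\neq M_2\}$. *)

theory Defs
  imports "HOL-Probability.Probability"
begin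

section \<open>Joint law and information quantities\<close>

text \<open>
  A value of \<open>(Q, U\<^sub>1, X\<^sub>1, U\<^sub>2, X\<^sub>2, Y\<^sub>1, Y\<^sub>2)\<close>.  The random variables are the coordinate
  projections on this space, under the law \<open>joint_pmf\<close> below.
\<close>

type_synonym ('q, 'u1, 'x1, 'u2, 'x2, 'y1, 'y2) vals =
  "'q \<times> 'u1 \<times> 'x1 \<times> 'u2 \<times> 'x2 \<times> 'y1 \<times> 'y2"

fun rvQ :: "('q, 'u1, 'x1, 'u2, 'x2, 'y1, 'y2) vals \<Rightarrow> 'q"
  where "rvQ (q, u1, x1, u2, x2, y1, y2) = q"
fun rvU1 :: "('q, 'u1, 'x1, 'u2, 'x2, 'y1, 'y2) vals \<Rightarrow> 'u1"
  where "rvU1 (q, u1, x1, u2, x2, y1, y2) = u1"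
fun rvX1 :: "('q, 'u1, 'x1, 'u2, 'x2, 'y1, 'y2) vals \<Rightarrow> 'x1"
  where "rvX1 (q, u1, x1, u2, x2, y1, y2) = x1"
fun rvU2 :: "('q, 'u1, 'x1, 'u2, 'x2, 'y1, 'y2) vals \<Rightarrow> 'u2"
  where "rvU2 (q, u1, x1, u2, x2, y1, y2) = u2"
fun rvX2 :: "('q, 'u1, 'x1, 'u2, 'x2, 'y1, 'y2) vals \<Rightarrow> 'x2"
  where "rvX2 (q, u1, x1, u2, x2, y1, y2) = x2"
fun rvY1 :: "('q, 'u1, 'x1, 'u2, 'x2, 'y1, 'y2) vals \<Rightarrow> 'y1"
  where "rvY1 (q, u1, x1, u2, x2, y1, y2) = y1"
fun rvY2 :: "('q, 'u1, 'x1, 'u2, 'x2, 'y1, 'y2) vals \<Rightarrow> 'y2"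
  where "rvY2 (q, u1, x1, u2, x2, y1, y2) = y2"

definition joint_pmf ::
  "'q pmf \<Rightarrow> ('q \<Rightarrow> ('u1 \<times> 'x1) pmf) \<Rightarrow> ('q \<Rightarrow> ('u2 \<times> 'x2) pmf) \<Rightarrow>
   ('x1 \<Rightarrow> 'x2 \<Rightarrow> ('y1 \<times> 'y2) pmf) \<Rightarrow> ('q, 'u1, 'x1, 'u2, 'x2, 'y1, 'y2) vals pmf" where
  "joint_pmf pQ K1 K2 W =
     do { q \<leftarrow> pQ;
          (u1, x1) \<leftarrow> K1 q;
          (u2, x2) \<leftarrow> K2 q;
          (y1, y2) \<leftarrow> W x1 x2;
          return_pmf (q, u1, x1, u2, x2, y1, y2) }"

text \<open>
  \<open>I(X; Y | Z)\<close> in bits.  Outside the locale \<^locale>\<open>information_space\<close> its notation for simple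
  functions is not available; this is what it expands to.
\<close>

abbreviation cond_mutual_info ::
  "'w pmf \<Rightarrow> ('w \<Rightarrow> 'a) \<Rightarrow> ('w \<Rightarrow> 'b) \<Rightarrow> ('w \<Rightarrow> 'c) \<Rightarrow> real" where
  "cond_mutual_info P X Y Z \<equiv>
     prob_space.conditional_mutual_information (measure_pmf P) 2
       (count_space (range X)) (count_space (range Y)) (count_space (range Z)) X Y Z"

section \<open>Sequences, typicality and random codebooks\<close>

text \<open>
  A length-\<open>n\<close> sequence over \<open>'a\<close> is a function \<open>nat \<Rightarrow> 'a\<close> of which only the values on \<open>{..<n}\<close>
  matter.
\<close>

definition index_set :: "nat \<Rightarrow> real \<Rightarrow> nat set" where
  "index_set n R = {1..nat \<lceil>2 powr (real n * R)\<rceil>}"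

definition typical :: "real \<Rightarrow> nat \<Rightarrow> 'a pmf \<Rightarrow> (nat \<Rightarrow> 'a) set" where
  "typical \<epsilon> n p =
     {s. \<forall>a. \<bar>real (card {i. i < n \<and> s i = a}) / real n - pmf p a\<bar> \<le> \<epsilon> * pmf p a}"

definition seq_pmf :: "nat \<Rightarrow> (nat \<Rightarrow> 'a pmf) \<Rightarrow> (nat \<Rightarrow> 'a) pmf" where
  "seq_pmf n p = Pi_pmf {..<n} undefined p"

definition codebook_pmf ::
  "'l set \<Rightarrow> nat \<Rightarrow> (nat \<Rightarrow> 'a pmf) \<Rightarrow> ('l \<Rightarrow> nat \<Rightarrow> 'a) pmf" where
  "codebook_pmf L n p = Pi_pmf L undefined (\<lambda>_. seq_pmf n p)"

section \<open>Encoding and decoding\<close>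

definition lex_first :: "(nat \<times> nat) set \<Rightarrow> nat \<times> nat" where
  "lex_first S = (let a = (LEAST a. \<exists>b. (a, b) \<in> S) in (a, LEAST b. (a, b) \<in> S))"

definition encode ::
  "nat \<Rightarrow> real \<Rightarrow> ('q \<times> 'u \<times> 'x) pmf \<Rightarrow> real \<Rightarrow> real \<Rightarrow> (nat \<Rightarrow> 'q) \<Rightarrow>
   (nat \<Rightarrow> nat \<Rightarrow> 'u) \<Rightarrow> (nat \<times> nat \<Rightarrow> nat \<Rightarrow> 'x) \<Rightarrow> nat \<Rightarrow> (nat \<Rightarrow> 'x)" where
  "encode n \<epsilon>' p Rc Rp q u x m =
     (let S = {(lc, lp). lc \<in> index_set n Rc \<and> lp \<in> index_set n Rp \<and>
                 (\<lambda>i. (q i, u lc i, x (m, lp) i)) \<in> typical \<epsilon>' n p}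
      in if S = {} then x (m, 1) else x (m, snd (lex_first S)))"

text \<open>
  Decoder of a receiver whose own sender uses the codebooks \<open>u\<close>, \<open>x\<close> (with rates \<open>Rc\<close>, \<open>Rp\<close>) and
  whose interferer uses the coordination codebook \<open>v\<close> (with rate \<open>Rc'\<close>).  \<open>None\<close> is a declared error.
\<close>

definition decode ::
  "nat \<Rightarrow> real \<Rightarrow> ('q \<times> 'u \<times> 'x \<times> 'v \<times> 'y) pmf \<Rightarrow> real \<Rightarrow> real \<Rightarrow> real \<Rightarrow> real \<Rightarrow> (nat \<Rightarrow> 'q) \<Rightarrow>
   (nat \<Rightarrow> nat \<Rightarrow> 'u) \<Rightarrow> (nat \<times> nat \<Rightarrow> nat \<Rightarrow> 'x) \<Rightarrow> (nat \<Rightarrow> nat \<Rightarrow> 'v) \<Rightarrow> (nat \<Rightarrow> 'y) \<Rightarrow>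
   nat option" where
  "decode n \<epsilon> p R Rc Rp Rc' q u x v y =
     (let C = {m \<in> index_set n R.
                 \<exists>lc\<in>index_set n Rc. \<exists>lp\<in>index_set n Rp. \<exists>lc'\<in>index_set n Rc'.
                   (\<lambda>i. (q i, u lc i, x (m, lp) i, v lc' i, y i)) \<in> typical \<epsilon> n p}
      in if \<exists>!m. m \<in> C then Some (THE m. m \<in> C) else None)"

section \<open>The multicoding scheme\<close>

text \<open>
  Joint law of \<open>(M\<^sub>1, M\<^sub>2)\<close> and the decoder outputs, over the random \<open>q\<^sup>n\<close>, codebooks, messages
  and channel noise.
\<close>

definition multicoding_pmf ::
  "'q pmf \<Rightarrow> ('q \<Rightarrow> ('u1 \<times> 'x1) pmf) \<Rightarrow> ('q \<Rightarrow> ('u2 \<times> 'x2) pmf) \<Rightarrow>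
   ('x1 \<Rightarrow> 'x2 \<Rightarrow> ('y1 \<times> 'y2) pmf) \<Rightarrow> real \<Rightarrow> real \<Rightarrow> real \<Rightarrow> real \<Rightarrow> real \<Rightarrow> real \<Rightarrow>
   real \<Rightarrow> real \<Rightarrow> nat \<Rightarrow> (nat \<times> nat \<times> nat option \<times> nat option) pmf" where
  "multicoding_pmf pQ K1 K2 W R1 R2 R1c R1p R2c R2p \<epsilon>' \<epsilon> n =
     (let J = joint_pmf pQ K1 K2 W in
      do { q \<leftarrow> seq_pmf n (\<lambda>_. pQ);
           u1 \<leftarrow> codebook_pmf (index_set n R1c) n (\<lambda>i. map_pmf fst (K1 (q i)));
           x1 \<leftarrow> codebook_pmf (index_set n R1 \<times> index_set n R1p) n (\<lambda>i. map_pmf snd (K1 (q i)));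
           u2 \<leftarrow> codebook_pmf (index_set n R2c) n (\<lambda>i. map_pmf fst (K2 (q i)));
           x2 \<leftarrow> codebook_pmf (index_set n R2 \<times> index_set n R2p) n (\<lambda>i. map_pmf snd (K2 (q i)));
           m1 \<leftarrow> pmf_of_set (index_set n R1);
           m2 \<leftarrow> pmf_of_set (index_set n R2);
           let s1 = encode n \<epsilon>' (map_pmf (\<lambda>w. (rvQ w, rvU1 w, rvX1 w)) J) R1c R1p q u1 x1 m1;
           let s2 = encode n \<epsilon>' (map_pmf (\<lambda>w. (rvQ w, rvU2 w, rvX2 w)) J) R2c R2p q u2 x2 m2;
           y \<leftarrow> seq_pmf n (\<lambda>i. W (s1 i) (s2 i));
           let d1 = decode n \<epsilon> (map_pmf (\<lambda>w. (rvQ w, rvU1 w, rvX1 w, rvU2 w, rvY1 w)) J)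
                      R1 R1c R1p R2c q u1 x1 u2 (\<lambda>i. fst (y i));
           let d2 = decode n \<epsilon> (map_pmf (\<lambda>w. (rvQ w, rvU2 w, rvX2 w, rvU1 w, rvY2 w)) J)
                      R2 R2c R2p R1c q u2 x2 u1 (\<lambda>i. snd (y i));
           return_pmf (m1, m2, d1, d2) })"

definition multicoding_error ::
  "'q pmf \<Rightarrow> ('q \<Rightarrow> ('u1 \<times> 'x1) pmf) \<Rightarrow> ('q \<Rightarrow> ('u2 \<times> 'x2) pmf) \<Rightarrow>
   ('x1 \<Rightarrow> 'x2 \<Rightarrow> ('y1 \<times> 'y2) pmf) \<Rightarrow> real \<Rightarrow> real \<Rightarrow> real \<Rightarrow> real \<Rightarrow> real \<Rightarrow> real \<Rightarrow>
   real \<Rightarrow> real \<Rightarrow> nat \<Rightarrow> real" where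
  "multicoding_error pQ K1 K2 W R1 R2 R1c R1p R2c R2p \<epsilon>' \<epsilon> n =
     measure_pmf.prob (multicoding_pmf pQ K1 K2 W R1 R2 R1c R1p R2c R2p \<epsilon>' \<epsilon> n)
       {(m1, m2, d1, d2). d1 \<noteq> Some m1 \<or> d2 \<noteq> Some m2}"

end

(*
  Everything rests on one change of measure.  On a strongly typical set the likelihood ratio of two
  memoryless laws is 2^(nD) up to 2^(n eps C), where D is the relative entropy rate, so no counting of
  types is needed.

  Covering: a second moment argument on the number of typical pairs succeeds as soon as
  Rc + Rp > I(U;X|Q) and Rc, Rp > 0.

  Joint typicality: the law of the selected pair has density at most
  2^(n(Rc + Rp - I(U;X|Q) + eps' C)) with respect to the memoryless law p(u,x|q).  Taking the covering
  slack small after eps is fixed, this density loses against the exponentially small probability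
  that a memoryless sequence is not typical, and this replaces a Markov lemma.

  Packing: removing an unselected u-codeword from the codebook does not change what the encoder
  selects, so that codeword is exactly independent of everything transmitted and received.  This gives
  a union bound with four exponents, according to which of the two coordination indices are wrong.

  With R_jc = r_j + g and R_jp = I_j - r_j + g the conditions on (r_1, r_2) are linear, and
  eliminating first r_1 and then r_2 leaves exactly the given inequalities together with
  consequences of the data processing inequality.
*)
theory Submission
  imports Defs
begin

text \<open>The two codebooks of a sender are drawn independently although \<open>U\<close> and
  \<open>X\<close> are dependent. The encoder creates the dependence by its choice, and the choice
  looks at the codebook as a whole, so neither the chosen words nor the others keep their law; every
  estimate has to get around this. The dependence is paid for once and earned back once. Covering
  forces Rc + Rp above I = I(U;X|Q), but a wrong transmission word, being fresh, must imitate the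
  dependence as well, and this raises each packing exponent by the same I. With Rp = I - r + g the
  two cancel, and r acts like the common rate of a rate splitting scheme, R - r like its private
  rate, although no message is split. The decoders need not find the indices, so only wrong messages
  are counted; a wrong own index next to a right foreign one bounds R alone, free of r. All
  codebooks are independent only given q, so the estimates are conditional on q. Packing holds for
  every q, covering only for those q that make a memoryless pair typical with probability at least
  1/2.\<close>

section \<open>Conditional mutual information as expected log-likelihoods\<close>

text \<open>The negative entropy \<open>- H(V)\<close> in bits.\<close>

definition plogp :: "'w::finite pmf \<Rightarrow> ('w \<Rightarrow> 'a) \<Rightarrow> real" where
  "plogp P V = (\<Sum>w\<in>UNIV. pmf P w * log 2 (pmf (map_pmf V P) (V w)))"

lemma sum_pmf_map_finite:
  fixes P :: "'w::finite pmf" and g :: "'a \<Rightarrow> real"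
  shows "(\<Sum>t\<in>range V. pmf (map_pmf V P) t * g t) = (\<Sum>w\<in>UNIV. pmf P w * g (V w))"
proof -
  have "(\<Sum>t\<in>range V. pmf (map_pmf V P) t * g t) = measure_pmf.expectation (map_pmf V P) g"
    by (subst integral_measure_pmf_real[of "range V"]) (auto simp: mult.commute)
  also have "\<dots> = measure_pmf.expectation P (\<lambda>w. g (V w))" by simp
  also have "\<dots> = (\<Sum>w\<in>UNIV. pmf P w * g (V w))"
    by (subst integral_measure_pmf_real[of "UNIV"]) (auto simp: mult.commute)
  finally show ?thesis .
qed

lemma pmf_map_pos:
  assumes "w \<in> set_pmf P" shows "pmf (map_pmf V P) (V w) > 0"
  using assms by (simp add: pmf_positive)

text \<open>In this form every relation between mutual informations becomes linear arithmetic in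
  finitely many entropies. Off the support the logarithms do not split, but there the factor
  \<open>pmf P w\<close> is zero.\<close>

lemma cond_mutual_info_plogp:
  fixes P :: "'w::finite pmf"
  shows "cond_mutual_info P X Y Z =
    plogp P (\<lambda>w. (X w, Y w, Z w)) + plogp P Z - plogp P (\<lambda>w. (X w, Z w)) - plogp P (\<lambda>w. (Y w, Z w))"
proof -
  interpret information_space "measure_pmf P" 2
    by unfold_locales auto
  have sd: "simple_distributed (measure_pmf P) V (\<lambda>x. pmf (map_pmf V P) x)" for V :: "'w \<Rightarrow> 'z"
    by (rule measure_pmf.simple_distributedI) (auto simp: pmf_map simple_function_def)
  let ?T = "\<lambda>w. (X w, Y w, Z w)"
  let ?XZ = "\<lambda>w. (X w, Z w)" and ?YZ = "\<lambda>w. (Y w, Z w)"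
  have "cond_mutual_info P X Y Z = (\<Sum>t\<in>range ?T. pmf (map_pmf ?T P) t *
      (case t of (x,y,z) \<Rightarrow> log 2 (pmf (map_pmf ?T P) (x,y,z) / (pmf (map_pmf ?XZ P) (x,z) *
         (pmf (map_pmf ?YZ P) (y,z) / pmf (map_pmf Z P) z)))))"
    using conditional_mutual_information_eq[OF sd[of Z] sd[of ?YZ] sd[of ?XZ] sd[of ?T]]
    by (simp add: case_prod_unfold)
  also have "\<dots> = (\<Sum>w\<in>UNIV. pmf P w * log 2 (pmf (map_pmf ?T P) (?T w) /
      (pmf (map_pmf ?XZ P) (?XZ w) * (pmf (map_pmf ?YZ P) (?YZ w) / pmf (map_pmf Z P) (Z w)))))"
    by (subst sum_pmf_map_finite) simp
  also have "\<dots> = (\<Sum>w\<in>UNIV. pmf P w * log 2 (pmf (map_pmf ?T P) (?T w))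
      + pmf P w * log 2 (pmf (map_pmf Z P) (Z w)) - pmf P w * log 2 (pmf (map_pmf ?XZ P) (?XZ w))
      - pmf P w * log 2 (pmf (map_pmf ?YZ P) (?YZ w)))"
  proof (rule sum.cong[OF refl])
    fix w
    show "pmf P w * log 2 (pmf (map_pmf ?T P) (?T w) /
      (pmf (map_pmf ?XZ P) (?XZ w) * (pmf (map_pmf ?YZ P) (?YZ w) / pmf (map_pmf Z P) (Z w))))
      = pmf P w * log 2 (pmf (map_pmf ?T P) (?T w))
      + pmf P w * log 2 (pmf (map_pmf Z P) (Z w)) - pmf P w * log 2 (pmf (map_pmf ?XZ P) (?XZ w))
      - pmf P w * log 2 (pmf (map_pmf ?YZ P) (?YZ w))"
    proof (cases "w \<in> set_pmf P")
      case True
      note pos = pmf_map_pos[OF True]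
      show ?thesis
        using pos[of ?T] pos[of ?XZ] pos[of ?YZ] pos[of Z]
        by (simp add: log_divide log_mult algebra_simps)
    qed (simp add: set_pmf_iff)
  qed
  also have "\<dots> = plogp P ?T + plogp P Z - plogp P ?XZ - plogp P ?YZ"
    by (simp add: plogp_def sum.distrib sum_subtractf)
  finally show ?thesis .
qed

lemma cond_mutual_info_nonneg:
  fixes P :: "'w::finite pmf"
  shows "0 \<le> cond_mutual_info P X Y Z"
proof -
  interpret information_space "measure_pmf P" 2
    by unfold_locales auto
  show ?thesis
    using conditional_mutual_information_nonneg[of X Y Z] by (simp add: simple_function_def)
qed

lemma plogp_map:
  fixes P :: "'w::finite pmf" and g :: "'w \<Rightarrow> 'v::finite"
  shows "plogp (map_pmf g P) V = plogp P (\<lambda>w. V (g w))"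
proof -
  have "plogp (map_pmf g P) V =
      (\<Sum>w\<in>range g. pmf (map_pmf g P) w * log 2 (pmf (map_pmf V (map_pmf g P)) (V w)))"
    unfolding plogp_def by (rule sum.mono_neutral_right) (auto simp: pmf_eq_0_set_pmf)
  then show ?thesis
    by (subst (asm) sum_pmf_map_finite) (simp add: plogp_def pmf.map_comp o_def)
qed

text \<open>A product identity between marginal densities, needed only on the support, becomes an
  additive identity of entropies. Conditional independence enters the exponents through this
  lemma.\<close>

lemma plogp_add_eq:
  assumes "\<And>w. w \<in> set_pmf P \<Longrightarrow>
    pmf (map_pmf V1 P) (V1 w) * pmf (map_pmf V2 P) (V2 w) =
    pmf (map_pmf V3 P) (V3 w) * pmf (map_pmf V4 P) (V4 w)"
  shows "plogp P V1 + plogp P V2 = plogp P V3 + plogp P V4"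
  unfolding plogp_def sum.distrib[symmetric]
proof (rule sum.cong[OF refl])
  fix w
  show "pmf P w * log 2 (pmf (map_pmf V1 P) (V1 w)) + pmf P w * log 2 (pmf (map_pmf V2 P) (V2 w)) =
        pmf P w * log 2 (pmf (map_pmf V3 P) (V3 w)) + pmf P w * log 2 (pmf (map_pmf V4 P) (V4 w))"
  proof (cases "w \<in> set_pmf P")
    case True
    note pos = pmf_map_pos[OF True]
    have "log 2 (pmf (map_pmf V1 P) (V1 w)) + log 2 (pmf (map_pmf V2 P) (V2 w)) =
        log 2 (pmf (map_pmf V3 P) (V3 w)) + log 2 (pmf (map_pmf V4 P) (V4 w))"
      using assms[OF True] pos[of V1] pos[of V2] pos[of V3] pos[of V4]
      by (metis less_irrefl log_mult)
    then show ?thesis by (metis distrib_left)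
  qed (simp add: set_pmf_iff)
qed

section \<open>Relative entropy rates and the Markov structure seen by one receiver\<close>

section \<open>Error exponents at a receiver\<close>

text \<open>An entropy depends only on the partition that the variable induces, so tuples may be
  reordered, regrouped and padded with unit values.\<close>

lemma plogp_cong:
  assumes "\<And>w w'. V w = V w' \<longleftrightarrow> V' w = V' w'"
  shows "plogp P V = plogp P V'"
proof -
  have "V -` {V w} = V' -` {V' w}" for w using assms by auto
  then show ?thesis by (simp add: plogp_def pmf_map)
qed

text \<open>The relative entropy of \<open>p\<close> with respect to the law that keeps the first
  marginal of \<open>p\<close> and draws the second coordinate by \<open>k\<close>: the exponent at
  which words drawn by \<open>k\<close> look jointly distributed by \<open>p\<close>.\<close>

definition divergence_rate :: "('t::finite \<times> 'a::finite) pmf \<Rightarrow> ('t \<Rightarrow> 'a pmf) \<Rightarrow> real" where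
  "divergence_rate p k = (\<Sum>w\<in>UNIV. pmf p w *
     log 2 (pmf p w / (pmf (map_pmf fst p) (fst w) * pmf (k (fst w)) (snd w))))"

lemma divergence_rate_map:
  fixes P :: "'w::finite pmf"
  assumes "\<And>w. w \<in> set_pmf P \<Longrightarrow> A w \<in> set_pmf (k (T w))"
  shows "divergence_rate (map_pmf (\<lambda>w. (T w, A w)) P) k =
    plogp P (\<lambda>w. (T w, A w)) - plogp P T - (\<Sum>w\<in>UNIV. pmf P w * log 2 (pmf (k (T w)) (A w)))"
proof -
  let ?p = "map_pmf (\<lambda>w. (T w, A w)) P"
  have T: "map_pmf fst ?p = map_pmf T P" by (simp add: pmf.map_comp o_def)
  have "divergence_rate ?p k = (\<Sum>w\<in>range (\<lambda>w. (T w, A w)). pmf ?p w *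
     log 2 (pmf ?p w / (pmf (map_pmf T P) (fst w) * pmf (k (fst w)) (snd w))))"
    unfolding divergence_rate_def T by (rule sum.mono_neutral_right) (auto simp: pmf_eq_0_set_pmf)
  also have "\<dots> = (\<Sum>w\<in>UNIV. pmf P w * log 2 (pmf ?p (T w, A w) / (pmf (map_pmf T P) (T w) * pmf (k (T w)) (A w))))"
    by (subst sum_pmf_map_finite) simp
  also have "\<dots> = (\<Sum>w\<in>UNIV. pmf P w * log 2 (pmf ?p (T w, A w)) - pmf P w * log 2 (pmf (map_pmf T P) (T w)) - pmf P w * log 2 (pmf (k (T w)) (A w)))"
  proof (rule sum.cong[OF refl])
    fix w
    show "pmf P w * log 2 (pmf ?p (T w, A w) / (pmf (map_pmf T P) (T w) * pmf (k (T w)) (A w))) =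
      pmf P w * log 2 (pmf ?p (T w, A w)) - pmf P w * log 2 (pmf (map_pmf T P) (T w)) - pmf P w * log 2 (pmf (k (T w)) (A w))"
    proof (cases "w \<in> set_pmf P")
      case True
      have "pmf (k (T w)) (A w) > 0" using assms[OF True] by (simp add: pmf_positive)
      then show ?thesis
        using pmf_map_pos[OF True, of "\<lambda>w. (T w, A w)"] pmf_map_pos[OF True, of T]
        by (simp add: log_divide log_mult algebra_simps)
    qed (simp add: set_pmf_iff)
  qed
  finally show ?thesis by (simp add: plogp_def sum_subtractf)
qed

lemma pmf_bind_Pair:
  "pmf (bind_pmf M (\<lambda>a. map_pmf (Pair a) (k a))) (a, b) = pmf M a * pmf (k a) b"
proof -
  have "pmf (map_pmf (Pair a') (k a')) (a, b) = indicator {a} a' * pmf (k a) b" for a'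
    by (cases "a' = a") (auto simp: pmf_map_inj' inj_on_def pmf_eq_0_set_pmf)
  then show ?thesis
    by (simp add: pmf_bind measure_pmf_single)
qed

text \<open>
  The view of one receiver: \<open>(u, x)\<close> belongs to its own sender, and \<open>V q x\<close> is the joint law of the
  interferer's coordination symbol \<open>v\<close> and the output \<open>y\<close>, the interferer's input being averaged out.
\<close>

locale receiver =
  fixes pQ :: "'q::finite pmf" and K :: "'q \<Rightarrow> ('u::finite \<times> 'x::finite) pmf"
    and G :: "'q \<Rightarrow> 'v::finite pmf" and V :: "'q \<Rightarrow> 'x \<Rightarrow> ('v \<times> 'y::finite) pmf"
  assumes fst_V: "map_pmf fst (V q x) = G q"
begin

definition law :: "('q \<times> 'u \<times> 'x \<times> 'v \<times> 'y) pmf" where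
  "law = do { q \<leftarrow> pQ; (u, x) \<leftarrow> K q; (v, y) \<leftarrow> V q x; return_pmf (q, u, x, v, y) }"

abbreviation (input) "ku q \<equiv> map_pmf fst (K q)"
abbreviation (input) "kx q \<equiv> map_pmf snd (K q)"

text \<open>With \<open>f\<close> and \<open>g\<close> among the identity, the projections and the
  constant unit function, this covers all marginals that contain \<open>q\<close>, so one Markov
  lemma serves them all.\<close>

definition view :: "('u \<times> 'x \<Rightarrow> 'c) \<Rightarrow> ('v \<times> 'y \<Rightarrow> 'd) \<Rightarrow> 'q \<times> 'u \<times> 'x \<times> 'v \<times> 'y \<Rightarrow> 'q \<times> 'c \<times> 'd"
  where "view f g = (\<lambda>(q, u, x, v, y). (q, f (u, x), g (v, y)))"

text \<open>The hypothesis says that \<open>g (v, y)\<close> depends on \<open>(u, x)\<close> only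
  through \<open>f (u, x)\<close>; then the density of the marginal factorises.\<close>

lemma pmf_view:
  assumes "\<And>q u x. map_pmf g (V q x) = B q (f (u, x))"
  shows "pmf (map_pmf (view f g) law) (q, a, b) =
    pmf pQ q * pmf (map_pmf f (K q)) a * pmf (B q a) b"
proof -
  have *: "map_pmf (\<lambda>(v,y). (q, f (u,x), g (v,y))) (V q x) = map_pmf (\<lambda>b. (q, f (u,x), b)) (B q (f (u,x)))" for q u x
    unfolding assms[symmetric, of q u x] by (simp add: pmf.map_comp o_def case_prod_unfold)
  have "map_pmf (view f g) law =
    bind_pmf pQ (\<lambda>q. bind_pmf (K q) (\<lambda>(u,x). map_pmf (\<lambda>(v,y). (q, f (u,x), g (v,y))) (V q x)))"
    by (simp add: law_def view_def map_bind_pmf case_prod_unfold map_pmf_def bind_assoc_pmf bind_return_pmf)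
  also have "\<dots> = bind_pmf pQ (\<lambda>q. bind_pmf (K q) (\<lambda>(u,x). map_pmf (\<lambda>b. (q, f (u,x), b)) (B q (f (u,x)))))"
    unfolding * ..
  also have "\<dots> = bind_pmf pQ (\<lambda>q. map_pmf (Pair q) (bind_pmf (map_pmf f (K q)) (\<lambda>a. map_pmf (Pair a) (B q a))))"
    by (simp add: map_bind_pmf bind_map_pmf case_prod_unfold pmf.map_comp o_def)
  finally have e: "map_pmf (view f g) law = \<dots>" .
  show ?thesis unfolding e by (simp add: pmf_bind_Pair)
qed

lemma law_in:
  assumes "(q, u, x, v, y) \<in> set_pmf law"
  shows "q \<in> set_pmf pQ" "(u, x) \<in> set_pmf (K q)" "u \<in> set_pmf (ku q)" "x \<in> set_pmf (kx q)"
    "(v, y) \<in> set_pmf (V q x)" "v \<in> set_pmf (G q)"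
proof -
  show 1: "q \<in> set_pmf pQ" "(u, x) \<in> set_pmf (K q)" "(v, y) \<in> set_pmf (V q x)"
    using assms by (auto simp: law_def)
  show "u \<in> set_pmf (ku q)" "x \<in> set_pmf (kx q)" using 1 by force+
  show "v \<in> set_pmf (G q)" unfolding fst_V[symmetric, of _ x] using 1 by force
qed

abbreviation H where "H f g \<equiv> plogp law (view f g)"
abbreviation (input) "none \<equiv> \<lambda>_. ()"

text \<open>This is I(U,X; g(V,Y) | f(U,X), Q) = 0, written with negative entropies.\<close>

lemma plogp_markov:
  assumes "\<And>q u x. map_pmf g (V q x) = B q (f (u, x))"
  shows "H id g + H f none = H id none + H f g"
proof (rule plogp_add_eq)
  fix w assume "w \<in> set_pmf law"
  obtain q u x v y where w: "w = (q, u, x, v, y)" by (metis prod_cases5)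
  have v: "view f g w = (q, f (u,x), g (v,y))" for f :: "'u \<times> 'x \<Rightarrow> 'ff" and g :: "'v \<times> 'y \<Rightarrow> 'g"
    by (simp add: view_def w)
  have n: "map_pmf none (V q x) = return_pmf ()" for q x by simp
  show "pmf (map_pmf (view id g) law) (view id g w) * pmf (map_pmf (view f none) law) (view f none w) =
        pmf (map_pmf (view id none) law) (view id none w) * pmf (map_pmf (view f g) law) (view f g w)"
    unfolding v
    by (subst pmf_view[of g "\<lambda>q a. B q (f a)"], simp add: assms, subst pmf_view[of none "\<lambda>_ _. return_pmf ()"], simp,
        subst pmf_view[of none "\<lambda>_ _. return_pmf ()"], simp, subst pmf_view[of g B], simp add: assms) simp
qed

lemma expected_log_ku: "(\<Sum>w\<in>UNIV. pmf law w * (case w of (q,u,x,v,y) \<Rightarrow> log 2 (pmf (ku q) u))) = H fst none - H none none"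
  and expected_log_kx: "(\<Sum>w\<in>UNIV. pmf law w * (case w of (q,u,x,v,y) \<Rightarrow> log 2 (pmf (kx q) x))) = H snd none - H none none"
  and expected_log_G: "(\<Sum>w\<in>UNIV. pmf law w * (case w of (q,u,x,v,y) \<Rightarrow> log 2 (pmf (G q) v))) = H none fst - H none none"
proof -
  \<comment> \<open>The three sums are instances of one: \<open>F\<close> is the density of a view
    conditional on \<open>q\<close>, and the logarithm of a conditional density averages to a
    difference of two negative entropies.\<close>
  have aux: "(\<Sum>w\<in>UNIV. pmf law w * (case w of (q,u,x,v,y) \<Rightarrow> log 2 (F q u x v))) = H f g - H none none"
    if B: "\<And>q u x. map_pmf g (V q x) = B q (f (u, x))"
      and F: "\<And>q u x v y. (q,u,x,v,y) \<in> set_pmf law \<Longrightarrow>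
        F q u x v > 0 \<and> F q u x v = pmf (map_pmf f (K q)) (f (u,x)) * pmf (B q (f (u,x))) (g (v,y))"
    for F and f :: "'u \<times> 'x \<Rightarrow> 'ff" and g :: "'v \<times> 'y \<Rightarrow> 'g" and B
  proof -
    have "(\<Sum>w\<in>UNIV. pmf law w * (case w of (q,u,x,v,y) \<Rightarrow> log 2 (F q u x v))) =
      (\<Sum>w\<in>UNIV. pmf law w * log 2 (pmf (map_pmf (view f g) law) (view f g w)) -
         pmf law w * log 2 (pmf (map_pmf (view none none) law) (view none none w)))"
    proof (rule sum.cong[OF refl])
      fix w :: "'q \<times> 'u \<times> 'x \<times> 'v \<times> 'y"
      obtain q u x v y where w: "w = (q, u, x, v, y)" by (metis prod_cases5)
      show "pmf law w * (case w of (q,u,x,v,y) \<Rightarrow> log 2 (F q u x v)) =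
        pmf law w * log 2 (pmf (map_pmf (view f g) law) (view f g w)) -
         pmf law w * log 2 (pmf (map_pmf (view none none) law) (view none none w))"
      proof (cases "w \<in> set_pmf law")
        case True
        then have q: "pmf pQ q > 0" using law_in(1) w by (simp add: pmf_positive)
        have v: "view f g w = (q, f (u, x), g (v, y))" "view none none w = (q, (), ())"
          by (simp_all add: view_def w)
        have 1: "pmf (map_pmf (view f g) law) (view f g w) = pmf pQ q * F q u x v"
          unfolding v using F[of q u x v y] True w
          by (subst pmf_view[of g B], simp add: B) simp
        have 2: "pmf (map_pmf (view none none) law) (view none none w) = pmf pQ q"
          unfolding v by (subst pmf_view[of _ "\<lambda>_ _. return_pmf ()"]) simp_all
        have "F q u x v > 0" using F True w by blast
        then show ?thesis unfolding 1 2 using q by (simp add: w log_mult algebra_simps)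
      qed (simp add: set_pmf_iff)
    qed
    then show ?thesis by (simp add: plogp_def sum_subtractf)
  qed
  show "(\<Sum>w\<in>UNIV. pmf law w * (case w of (q,u,x,v,y) \<Rightarrow> log 2 (pmf (ku q) u))) = H fst none - H none none"
    by (rule aux[of _ "\<lambda>_ _. return_pmf ()"]) (auto simp: pmf_positive dest: law_in(3) intro!: pmf_positive)
  show "(\<Sum>w\<in>UNIV. pmf law w * (case w of (q,u,x,v,y) \<Rightarrow> log 2 (pmf (kx q) x))) = H snd none - H none none"
    by (rule aux[of _ "\<lambda>_ _. return_pmf ()"]) (auto simp: pmf_positive dest: law_in(4) intro!: pmf_positive)
  show "(\<Sum>w\<in>UNIV. pmf law w * (case w of (q,u,x,v,y) \<Rightarrow> log 2 (pmf (G q) v))) = H none fst - H none none"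
    by (rule aux[of _ "\<lambda>q _. G q"]) (auto simp: fst_V pmf_positive dest: law_in(6) intro!: pmf_positive)
qed

text \<open>The first four are the packing exponents, grouped by which words are fresh. The last
  three belong to covering: the pair of words, and each word of the pair given the other.\<close>

lemma divergence_rates:
  shows "divergence_rate (map_pmf (\<lambda>(q,u,x,v,y). ((q,u,v,y),x)) law) (\<lambda>(q,u,v,y). kx q) =
      H id id - H fst id - (H snd none - H none none)" (is "?A")
    and "divergence_rate (map_pmf (\<lambda>(q,u,x,v,y). ((q,v,y),(u,x))) law) (\<lambda>(q,v,y). pair_pmf (ku q) (kx q)) =
      H id id - H none id - (H fst none - H none none) - (H snd none - H none none)" (is "?B")
    and "divergence_rate (map_pmf (\<lambda>(q,u,x,v,y). ((q,u,y),(x,v))) law) (\<lambda>(q,u,y). pair_pmf (kx q) (G q)) =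
      H id id - H fst snd - (H snd none - H none none) - (H none fst - H none none)" (is "?C")
    and "divergence_rate (map_pmf (\<lambda>(q,u,x,v,y). ((q,y),(u,x,v))) law) (\<lambda>(q,y). pair_pmf (ku q) (pair_pmf (kx q) (G q))) =
      H id id - H none snd - (H fst none - H none none) - (H snd none - H none none) - (H none fst - H none none)" (is "?D")
    and "divergence_rate (map_pmf (\<lambda>(q,u,x,v,y). (q,(u,x))) law) (\<lambda>q. pair_pmf (ku q) (kx q)) =
      H id none - H none none - (H fst none - H none none) - (H snd none - H none none)" (is "?I")
    and "divergence_rate (map_pmf (\<lambda>(q,u,x,v,y). ((q,u),x)) law) (\<lambda>(q,u). kx q) =
      H id none - H fst none - (H snd none - H none none)" (is "?Ix")
    and "divergence_rate (map_pmf (\<lambda>(q,u,x,v,y). ((q,x),u)) law) (\<lambda>(q,x). ku q) =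
      H id none - H snd none - (H fst none - H none none)" (is "?Iu")
proof -
  let ?Lu = "\<lambda>w. case w of (q,u,x,v,y) \<Rightarrow> log 2 (pmf (ku q) u)"
  let ?Lx = "\<lambda>w. case w of (q,u,x,v,y) \<Rightarrow> log 2 (pmf (kx q) x)"
  let ?Lv = "\<lambda>w. case w of (q,u,x,v,y) \<Rightarrow> log 2 (pmf (G q) v)"
  have pos: "pmf (ku q) u \<noteq> 0 \<and> pmf (kx q) x \<noteq> 0 \<and> pmf (G q) v \<noteq> 0 \<and>
      u \<in> fst ` set_pmf (K q) \<and> x \<in> snd ` set_pmf (K q) \<and> v \<in> set_pmf (G q)"
    if "(q,u,x,v,y) \<in> set_pmf law" for q u x v y
    using law_in(3,4,6)[OF that] by (simp only: pmf_eq_0_set_pmf set_map_pmf simp_thms)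
  have split: "(\<Sum>w\<in>UNIV. pmf law w * F w) = (\<Sum>w\<in>UNIV. pmf law w * F' w)"
    if "\<And>q u x v y. (q,u,x,v,y) \<in> set_pmf law \<Longrightarrow> F (q,u,x,v,y) = F' (q,u,x,v,y)" for F F' :: "_ \<Rightarrow> real"
  proof (rule sum.cong[OF refl])
    fix w :: "'q \<times> 'u \<times> 'x \<times> 'v \<times> 'y"
    show "pmf law w * F w = pmf law w * F' w"
      using that by (cases "w \<in> set_pmf law"; cases w) (auto simp: set_pmf_iff)
  qed
  have "divergence_rate (map_pmf (\<lambda>w. ((\<lambda>(q,u,x,v,y). (q,u,v,y)) w, (\<lambda>(q,u,x,v,y). x) w)) law) (\<lambda>(q,u,v,y). kx q) =
      H id id - H fst id - (\<Sum>w\<in>UNIV. pmf law w * ?Lx w)"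
    by (subst divergence_rate_map)
      (auto dest!: pos intro: rev_image_eqI simp: view_def case_prod_unfold intro!: arg_cong2[of _ _ _ _ minus] plogp_cong split)
  then show ?A unfolding expected_log_kx by (simp add: case_prod_unfold)
  have "divergence_rate (map_pmf (\<lambda>w. ((\<lambda>(q,u,x,v,y). (q,v,y)) w, (\<lambda>(q,u,x,v,y). (u,x)) w)) law) (\<lambda>(q,v,y). pair_pmf (ku q) (kx q)) =
      H id id - H none id - (\<Sum>w\<in>UNIV. pmf law w * (?Lu w + ?Lx w))"
    by (subst divergence_rate_map)
      (auto dest!: pos intro: rev_image_eqI simp: view_def case_prod_unfold pmf_pair log_mult intro!: arg_cong2[of _ _ _ _ minus] plogp_cong split)
  then show ?B unfolding distrib_left sum.distrib expected_log_kx expected_log_ku by (simp add: case_prod_unfold)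
  have "divergence_rate (map_pmf (\<lambda>w. ((\<lambda>(q,u,x,v,y). (q,u,y)) w, (\<lambda>(q,u,x,v,y). (x,v)) w)) law) (\<lambda>(q,u,y). pair_pmf (kx q) (G q)) =
      H id id - H fst snd - (\<Sum>w\<in>UNIV. pmf law w * (?Lx w + ?Lv w))"
    by (subst divergence_rate_map)
      (auto dest!: pos intro: rev_image_eqI simp: view_def case_prod_unfold pmf_pair log_mult intro!: arg_cong2[of _ _ _ _ minus] plogp_cong split)
  then show ?C unfolding distrib_left sum.distrib expected_log_kx expected_log_G by (simp add: case_prod_unfold)
  have "divergence_rate (map_pmf (\<lambda>w. ((\<lambda>(q,u,x,v,y). (q,y)) w, (\<lambda>(q,u,x,v,y). (u,x,v)) w)) law) (\<lambda>(q,y). pair_pmf (ku q) (pair_pmf (kx q) (G q))) =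
      H id id - H none snd - (\<Sum>w\<in>UNIV. pmf law w * (?Lu w + ?Lx w + ?Lv w))"
    by (subst divergence_rate_map)
      (auto dest!: pos intro: rev_image_eqI simp: view_def case_prod_unfold pmf_pair log_mult intro!: arg_cong2[of _ _ _ _ minus] plogp_cong split)
  then show ?D unfolding distrib_left sum.distrib expected_log_kx expected_log_ku expected_log_G by (simp add: case_prod_unfold)
  have "divergence_rate (map_pmf (\<lambda>w. ((\<lambda>(q,u,x,v,y). q) w, (\<lambda>(q,u,x,v,y). (u,x)) w)) law) (\<lambda>q. pair_pmf (ku q) (kx q)) =
      H id none - H none none - (\<Sum>w\<in>UNIV. pmf law w * (?Lu w + ?Lx w))"
    by (subst divergence_rate_map)
      (auto dest!: pos intro: rev_image_eqI simp: view_def case_prod_unfold pmf_pair log_mult intro!: arg_cong2[of _ _ _ _ minus] plogp_cong split)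
  then show ?I unfolding distrib_left sum.distrib expected_log_kx expected_log_ku by (simp add: case_prod_unfold)
  have "divergence_rate (map_pmf (\<lambda>w. ((\<lambda>(q,u,x,v,y). (q,u)) w, (\<lambda>(q,u,x,v,y). x) w)) law) (\<lambda>(q,u). kx q) =
      H id none - H fst none - (\<Sum>w\<in>UNIV. pmf law w * ?Lx w)"
    by (subst divergence_rate_map)
      (auto dest!: pos intro: rev_image_eqI simp: view_def case_prod_unfold intro!: arg_cong2[of _ _ _ _ minus] plogp_cong split)
  then show ?Ix unfolding expected_log_kx by (simp add: case_prod_unfold)
  have "divergence_rate (map_pmf (\<lambda>w. ((\<lambda>(q,u,x,v,y). (q,x)) w, (\<lambda>(q,u,x,v,y). u) w)) law) (\<lambda>(q,x). ku q) =
      H id none - H snd none - (\<Sum>w\<in>UNIV. pmf law w * ?Lu w)"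
    by (subst divergence_rate_map)
      (auto dest!: pos intro: rev_image_eqI simp: view_def case_prod_unfold intro!: arg_cong2[of _ _ _ _ minus] plogp_cong split)
  then show ?Iu unfolding expected_log_ku by (simp add: case_prod_unfold)
qed

text \<open>
  \<open>rate_I\<close> is the covering exponent \<open>I(U; X | Q)\<close>.  The others are the exponents for a wrong message
  when the pair (own, interferer's) of coordination indices is (right, right), (wrong, right),
  (right, wrong) and (wrong, wrong) respectively.
\<close>

definition "rate_I = divergence_rate (map_pmf (\<lambda>(q,u,x,v,y). (q,(u,x))) law) (\<lambda>q. pair_pmf (ku q) (kx q))"
definition "rate_A = divergence_rate (map_pmf (\<lambda>(q,u,x,v,y). ((q,u,v,y),x)) law) (\<lambda>(q,u,v,y). kx q)"
definition "rate_B = divergence_rate (map_pmf (\<lambda>(q,u,x,v,y). ((q,v,y),(u,x))) law) (\<lambda>(q,v,y). pair_pmf (ku q) (kx q))"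
definition "rate_C = divergence_rate (map_pmf (\<lambda>(q,u,x,v,y). ((q,u,y),(x,v))) law) (\<lambda>(q,u,y). pair_pmf (kx q) (G q))"
definition "rate_D = divergence_rate (map_pmf (\<lambda>(q,u,x,v,y). ((q,y),(u,x,v))) law) (\<lambda>(q,y). pair_pmf (ku q) (pair_pmf (kx q) (G q)))"

text \<open>The codebook laws are the true marginals of the pair, so fitting one word to a given
  other one costs the same exponent as fitting both. Hence one constant bounds both conditional
  probabilities in the covering argument.\<close>

lemma divergence_rate_source:
  "divergence_rate (map_pmf (\<lambda>(q,u,x,v,y). ((q,u),x)) law) (\<lambda>(q,u). kx q) = rate_I"
  "divergence_rate (map_pmf (\<lambda>(q,u,x,v,y). ((q,x),u)) law) (\<lambda>(q,x). ku q) = rate_I"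
  unfolding rate_I_def divergence_rates by simp_all

text \<open>Given Q, the interferer's V is independent of (U,X), and the output sees U only through
  X.\<close>

lemma markov_identities:
  "H id fst + H none none = H id none + H none fst"
  "H id fst + H fst none = H id none + H fst fst"
  "H id fst + H snd none = H id none + H snd fst"
  "H id id + H snd none = H id none + H snd id"
  "H id snd + H snd none = H id none + H snd snd"
  by (intro plogp_markov[of _ "\<lambda>q _. G q"] plogp_markov[of id "\<lambda>q x. V q x"] plogp_markov[of snd "\<lambda>q x. map_pmf snd (V q x)"]; simp add: fst_V)+

text \<open>The differences are conditional mutual informations: C - A = I(V;U,Y|Q), D - B =
  I(V;Y|Q), A + I - B = I(U;X|V,Y,Q) and C + I - D = I(U;X|Y,Q). They supply what the elimination of
  the split needs beyond the given inequalities.\<close>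

lemma rate_relations:
  "0 \<le> rate_I" "rate_A \<le> rate_C" "rate_B \<le> rate_D" "rate_B \<le> rate_A + rate_I" "rate_D \<le> rate_C + rate_I"
proof -
  define q u x v y where "q = (\<lambda>(q::'q,u::'u,x::'x,v::'v,y::'y). q)" and "u = (\<lambda>(q::'q,u::'u,x::'x,v::'v,y::'y). u)"
    and "x = (\<lambda>(q::'q,u::'u,x::'x,v::'v,y::'y). x)" and "v = (\<lambda>(q::'q,u::'u,x::'x,v::'v,y::'y). v)"
    and "y = (\<lambda>(q::'q,u::'u,x::'x,v::'v,y::'y). y)"
  note defs = q_def u_def x_def v_def y_def
  note rates = rate_I_def rate_A_def rate_B_def rate_C_def rate_D_def
  note pos = cond_mutual_info_nonneg[of law, unfolded cond_mutual_info_plogp]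
  have "0 \<le> H id none + H none none - H fst none - H snd none"
    by (rule order.trans[OF pos[of u x q]], rule eq_refl)
      (auto simp: defs view_def intro!: arg_cong2[of _ _ _ _ minus] arg_cong2[of _ _ _ _ plus] plogp_cong)
  then show "0 \<le> rate_I" unfolding rates divergence_rates by simp
  have "0 \<le> H fst id + H none none - H none fst - H fst snd"
    by (rule order.trans[OF pos[of v "\<lambda>w. (u w, y w)" q]], rule eq_refl)
      (auto simp: defs view_def intro!: arg_cong2[of _ _ _ _ minus] arg_cong2[of _ _ _ _ plus] plogp_cong)
  then show "rate_A \<le> rate_C" unfolding rates divergence_rates by simp
  have "0 \<le> H none id + H none none - H none fst - H none snd"
    by (rule order.trans[OF pos[of v y q]], rule eq_refl)
      (auto simp: defs view_def intro!: arg_cong2[of _ _ _ _ minus] arg_cong2[of _ _ _ _ plus] plogp_cong)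
  then show "rate_B \<le> rate_D" unfolding rates divergence_rates by simp
  have "0 \<le> H id id + H none id - H fst id - H snd id"
    by (rule order.trans[OF pos[of u x "\<lambda>w. (v w, y w, q w)"]], rule eq_refl)
      (auto simp: defs view_def intro!: arg_cong2[of _ _ _ _ minus] arg_cong2[of _ _ _ _ plus] plogp_cong)
  then show "rate_B \<le> rate_A + rate_I" unfolding rates divergence_rates using markov_identities(4) by simp
  have "0 \<le> H id snd + H none snd - H fst snd - H snd snd"
    by (rule order.trans[OF pos[of u x "\<lambda>w. (y w, q w)"]], rule eq_refl)
      (auto simp: defs view_def intro!: arg_cong2[of _ _ _ _ minus] arg_cong2[of _ _ _ _ plus] plogp_cong)
  then show "rate_D \<le> rate_C + rate_I" unfolding rates divergence_rates using markov_identities(5) by simp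
qed

text \<open>Chain rule plus the Markov identities; for instance A = I(X;U,V,Y|Q) = I(X;U|Q) +
  I(X;Y|U,V,Q), because X and V are independent given U and Q. The common summand
  \<open>rate_I\<close> is what later cancels against Rc + Rp.\<close>

lemma rates_eq_cond_mutual_info:
  fixes P :: "'w::finite pmf"
  assumes law: "law = map_pmf (\<lambda>w. (q w, u w, x w, v w, y w)) P"
  shows "rate_A = rate_I + cond_mutual_info P x y (\<lambda>w. (u w, v w, q w))"
    and "rate_B = rate_I + cond_mutual_info P x y (\<lambda>w. (v w, q w))"
    and "rate_C = rate_I + cond_mutual_info P (\<lambda>w. (x w, v w)) y (\<lambda>w. (u w, q w))"
    and "rate_D = rate_I + cond_mutual_info P (\<lambda>w. (x w, v w)) y q"
proof -
  note rates = rate_I_def rate_A_def rate_B_def rate_C_def rate_D_def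
  have H: "H f g = plogp P (\<lambda>w. (q w, f (u w, x w), g (v w, y w)))"
    for f :: "'u \<times> 'x \<Rightarrow> 'ff" and g :: "'v \<times> 'y \<Rightarrow> 'g"
    unfolding law plogp_map by (simp add: view_def)
  have "cond_mutual_info P x y (\<lambda>w. (u w, v w, q w)) = H id id + H fst fst - H id fst - H fst id"
    unfolding cond_mutual_info_plogp H
    by (auto intro!: arg_cong2[of _ _ _ _ minus] arg_cong2[of _ _ _ _ plus] plogp_cong)
  then show "rate_A = rate_I + cond_mutual_info P x y (\<lambda>w. (u w, v w, q w))"
    unfolding rates divergence_rates using markov_identities by simp
  have "cond_mutual_info P x y (\<lambda>w. (v w, q w)) = H snd id + H none fst - H snd fst - H none id"
    unfolding cond_mutual_info_plogp H
    by (auto intro!: arg_cong2[of _ _ _ _ minus] arg_cong2[of _ _ _ _ plus] plogp_cong)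
  then show "rate_B = rate_I + cond_mutual_info P x y (\<lambda>w. (v w, q w))"
    unfolding rates divergence_rates using markov_identities by simp
  have "cond_mutual_info P (\<lambda>w. (x w, v w)) y (\<lambda>w. (u w, q w)) = H id id + H fst none - H id fst - H fst snd"
    unfolding cond_mutual_info_plogp H
    by (auto intro!: arg_cong2[of _ _ _ _ minus] arg_cong2[of _ _ _ _ plus] plogp_cong)
  then show "rate_C = rate_I + cond_mutual_info P (\<lambda>w. (x w, v w)) y (\<lambda>w. (u w, q w))"
    unfolding rates divergence_rates using markov_identities by simp
  have "cond_mutual_info P (\<lambda>w. (x w, v w)) y q = H snd id + H none none - H snd fst - H none snd"
    unfolding cond_mutual_info_plogp H
    by (auto intro!: arg_cong2[of _ _ _ _ minus] arg_cong2[of _ _ _ _ plus] plogp_cong)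
  then show "rate_D = rate_I + cond_mutual_info P (\<lambda>w. (x w, v w)) y q"
    unfolding rates divergence_rates using markov_identities by simp
qed

end

section \<open>Likelihood ratios on strongly typical sets, and concentration\<close>

section \<open>Typical sequences and change of measure\<close>

lemma typical_cong:
  assumes "\<And>i. i < n \<Longrightarrow> s i = s' i"
  shows "s \<in> typical \<epsilon> n p \<longleftrightarrow> s' \<in> typical \<epsilon> n p"
proof -
  have "{i. i < n \<and> s i = a} = {i. i < n \<and> s' i = a}" for a using assms by auto
  then show ?thesis by (simp add: typical_def)
qed

text \<open>The tolerance is proportional to the probability, so over a fibre of \<open>f\<close>
  the tolerances add up exactly to the one allowed for the image symbol, and \<epsilon> does not
  grow.\<close>

lemma typical_map:
  fixes p :: "'a::finite pmf"
  assumes "s \<in> typical \<epsilon> n p"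
  shows "(\<lambda>i. f (s i)) \<in> typical \<epsilon> n (map_pmf f p)"
  unfolding typical_def
proof (rule CollectI, rule allI)
  fix b
  let ?N = "\<lambda>a. real (card {i. i < n \<and> s i = a}) / real n"
  have pm: "pmf (map_pmf f p) b = (\<Sum>a\<in>f -` {b}. pmf p a)"
    by (simp add: pmf_map measure_measure_pmf_finite)
  have "{i. i < n \<and> f (s i) = b} = (\<Union>a\<in>f -` {b}. {i. i < n \<and> s i = a})" by auto
  then have "card {i. i < n \<and> f (s i) = b} = (\<Sum>a\<in>f -` {b}. card {i. i < n \<and> s i = a})"
    by (simp only:) (rule card_UN_disjoint, auto)
  then have "real (card {i. i < n \<and> f (s i) = b}) / real n - pmf (map_pmf f p) b
      = (\<Sum>a\<in>f -` {b}. ?N a - pmf p a)"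
    by (simp add: pm sum_subtractf sum_divide_distrib)
  also have "\<bar>\<dots>\<bar> \<le> (\<Sum>a\<in>f -` {b}. \<epsilon> * pmf p a)"
    using assms by (intro order.trans[OF sum_abs] sum_mono) (simp add: typical_def)
  finally show "\<bar>real (card {i. i < n \<and> f (s i) = b}) / real n - pmf (map_pmf f p) b\<bar> \<le> \<epsilon> * pmf (map_pmf f p) b"
    by (simp add: pm sum_distrib_left)
qed

text \<open>The typical average lemma in a two-sided form: grouping the positions by symbol replaces
  the sum over time by a sum over the alphabet.\<close>

lemma sum_typical:
  fixes p :: "'a::finite pmf" and g :: "'a \<Rightarrow> real"
  assumes "s \<in> typical \<epsilon> n p"
  shows "\<bar>(\<Sum>i<n. g (s i)) - n * (\<Sum>a\<in>UNIV. pmf p a * g a)\<bar> \<le> n * (\<epsilon> * (\<Sum>a\<in>UNIV. pmf p a * \<bar>g a\<bar>))"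
proof (cases "n = 0")
  case False
  let ?N = "\<lambda>a. real (card {i. i < n \<and> s i = a})"
  have "(\<Sum>i<n. g (s i)) = (\<Sum>a\<in>UNIV. \<Sum>i\<in>{i. i \<in> {..<n} \<and> s i = a}. g (s i))"
    by (rule sum.group[symmetric]) auto
  also have "\<dots> = (\<Sum>a\<in>UNIV. ?N a * g a)" by (intro sum.cong) auto
  finally have "(\<Sum>i<n. g (s i)) - n * (\<Sum>a\<in>UNIV. pmf p a * g a)
      = (\<Sum>a\<in>UNIV. n * ((?N a / n - pmf p a) * g a))"
    using False by (simp add: sum_distrib_left sum_subtractf algebra_simps)
  also have "\<bar>\<dots>\<bar> \<le> (\<Sum>a\<in>UNIV. n * (\<epsilon> * pmf p a * \<bar>g a\<bar>))"
    using assms by (intro order.trans[OF sum_abs] sum_mono) (auto simp: abs_mult typical_def intro!: mult_left_mono mult_right_mono)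
  finally show ?thesis by (simp add: sum_distrib_left mult_ac)
qed simp

definition log_ratio :: "('t \<times> 'a) pmf \<Rightarrow> ('t \<Rightarrow> 'a pmf) \<Rightarrow> 't \<times> 'a \<Rightarrow> real" where
  "log_ratio p k w = log 2 (pmf p w / (pmf (map_pmf fst p) (fst w) * pmf (k (fst w)) (snd w)))"

text \<open>The constant that multiplies \<epsilon> in the exponents, as \<open>sum_typical\<close>
  produces it for \<open>log_ratio\<close>.\<close>

definition log_spread :: "('t::finite \<times> 'a::finite) pmf \<Rightarrow> ('t \<Rightarrow> 'a pmf) \<Rightarrow> real" where
  "log_spread p k = (\<Sum>w\<in>UNIV. pmf p w * \<bar>log_ratio p k w\<bar>)"

definition disintegrates :: "('t \<times> 'a) pmf \<Rightarrow> ('t \<Rightarrow> 'a pmf) \<Rightarrow> bool" where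
  "disintegrates p k \<longleftrightarrow> (\<forall>t a. pmf p (t, a) = pmf (map_pmf fst p) t * pmf (k t) a)"

lemma ex_disintegrates: "\<exists>k. disintegrates p k"
proof
  let ?k = "\<lambda>t. map_pmf snd (cond_pmf p (fst -` {t}))"
  show "disintegrates p ?k"
    unfolding disintegrates_def
  proof (intro allI)
    fix t a
    show "pmf p (t, a) = pmf (map_pmf fst p) t * pmf (?k t) a"
    proof (cases "t \<in> set_pmf (map_pmf fst p)")
      case True
      then have ne: "set_pmf p \<inter> fst -` {t} \<noteq> {}" by auto
      have "pmf (?k t) a = measure (cond_pmf p (fst -` {t})) (snd -` {a})" by (simp add: pmf_map)
      also have "\<dots> = measure (cond_pmf p (fst -` {t})) {(t, a)}"
        using ne by (intro measure_eq_AE AE_pmfI) (auto simp: )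
      also have "\<dots> = pmf p (t, a) / measure p (fst -` {t})"
        by (simp add: measure_pmf_single pmf_cond[OF ne])
      finally have "pmf (?k t) a = pmf p (t, a) / pmf (map_pmf fst p) t" by (simp add: pmf_map)
      moreover have "pmf (map_pmf fst p) t \<noteq> 0" using True by (simp only: set_pmf_iff not_False_eq_True)
      ultimately show ?thesis by simp
    next
      \<comment> \<open>Here \<open>cond_pmf\<close> conditions on a null set and is unspecified,
        but both sides vanish.\<close>
      case False
      then have "(t, a) \<notin> set_pmf p" by force
      then show ?thesis using False by (simp only: set_pmf_iff not_not)
    qed
  qed
qed

lemma log2_prod:
  assumes "finite A" "\<And>i. i \<in> A \<Longrightarrow> f i > 0"
  shows "log 2 (\<Prod>i\<in>A. f i) = (\<Sum>i\<in>A. log 2 (f i))"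
  using assms by (induction A rule: finite_induct) (auto simp: log_mult prod_pos less_imp_neq[symmetric])

text \<open>The first marginal cancels from \<open>log_ratio\<close>, which leaves the
  log-likelihood ratio of the true conditional law \<open>k'\<close> against \<open>k\<close>. Along
  a typical sequence its sum is n times its mean up to the spread, and this bounds the ratio of the
  two product densities from both sides.\<close>

lemma seq_pmf_change_of_measure:
  fixes p :: "('t::finite \<times> 'a::finite) pmf"
  assumes dis: "disintegrates p k'"
    and ac: "\<And>t a. (t, a) \<in> set_pmf p \<Longrightarrow> a \<in> set_pmf (k t)"
    and typl: "(\<lambda>i. (t i, s i)) \<in> typical \<epsilon> n p"
  shows "pmf (seq_pmf n (\<lambda>i. k (t i))) s \<le>
      2 powr (- (real n * (divergence_rate p k - \<epsilon> * log_spread p k))) * pmf (seq_pmf n (\<lambda>i. k' (t i))) s" (is ?le)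
    and "pmf (seq_pmf n (\<lambda>i. k' (t i))) s \<le>
      2 powr (real n * (divergence_rate p k + \<epsilon> * log_spread p k)) * pmf (seq_pmf n (\<lambda>i. k (t i))) s" (is ?ge)
proof -
  have D: "divergence_rate p k = (\<Sum>w\<in>UNIV. pmf p w * log_ratio p k w)"
    by (simp add: divergence_rate_def log_ratio_def)
  let ?S = "\<Sum>i<n. log_ratio p k (t i, s i)"
  have S: "\<bar>?S - n * divergence_rate p k\<bar> \<le> n * (\<epsilon> * log_spread p k)"
    using sum_typical[OF typl, of "log_ratio p k"] by (simp add: D log_spread_def)
  \<comment> \<open>The relative tolerance is zero at symbols of probability zero, so these cannot
    occur in a typical sequence, and all logarithms below are finite.\<close>
  have supp: "(t i, s i) \<in> set_pmf p" if "i < n" for i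
  proof (rule ccontr)
    assume "(t i, s i) \<notin> set_pmf p"
    then have "pmf p (t i, s i) = 0" by (simp add: set_pmf_iff)
    then have "\<bar>real (card {j. j < n \<and> (t j, s j) = (t i, s i)}) / real n\<bar> \<le> 0"
      using typl[unfolded typical_def, THEN CollectD, THEN spec, of "(t i, s i)"] by simp
    then have "card {j. j < n \<and> (t j, s j) = (t i, s i)} = 0"
      using that by (simp add: divide_le_0_iff del: card_eq_0_iff)
    then show False using that by auto
  qed
  have pos: "pmf (k (t i)) (s i) > 0" "pmf (k' (t i)) (s i) > 0" "pmf (map_pmf fst p) (t i) > 0" if "i < n" for i
  proof -
    show "pmf (k (t i)) (s i) > 0" using ac[OF supp[OF that]] by (rule pmf_positive)
    have "pmf p (t i, s i) > 0" using supp[OF that] by (rule pmf_positive)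
    then have "pmf (map_pmf fst p) (t i) * pmf (k' (t i)) (s i) > 0"
      using dis by (metis disintegrates_def)
    then show "pmf (k' (t i)) (s i) > 0" "pmf (map_pmf fst p) (t i) > 0"
      by (metis pmf_nonneg zero_less_mult_iff not_less)+
  qed
  have lr: "log_ratio p k (t i, s i) = log 2 (pmf (k' (t i)) (s i)) - log 2 (pmf (k (t i)) (s i))" if "i < n" for i
  proof -
    have "pmf p (t i, s i) = pmf (map_pmf fst p) (t i) * pmf (k' (t i)) (s i)"
      using dis by (metis disintegrates_def)
    then show ?thesis using pos[OF that] by (simp add: log_ratio_def log_divide log_mult)
  qed
  show ?le ?ge
  proof -
    define a where "a = (\<Prod>i<n. pmf (k (t i)) (s i))"
    define b where "b = (\<Prod>i<n. pmf (k' (t i)) (s i))"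
    have ab: "a > 0" "b > 0" unfolding a_def b_def using pos by (auto intro!: prod_pos)
    have "?S = log 2 b - log 2 a"
      unfolding a_def b_def using pos
      by (subst (1 2) log2_prod) (auto simp: lr sum_subtractf)
    then have le: "log 2 a \<le> - (n * (divergence_rate p k - \<epsilon> * log_spread p k)) + log 2 b"
      and ge: "log 2 b \<le> n * (divergence_rate p k + \<epsilon> * log_spread p k) + log 2 a"
      using S by (auto simp: algebra_simps abs_le_iff)
    have "2 powr (log 2 a) \<le> 2 powr (- (real n * (divergence_rate p k - \<epsilon> * log_spread p k)) + log 2 b)"
      using le by (intro powr_mono) auto
    then have 1: "a \<le> 2 powr (- (real n * (divergence_rate p k - \<epsilon> * log_spread p k))) * b"
      unfolding powr_add using ab by simp
    have "2 powr (log 2 b) \<le> 2 powr (real n * (divergence_rate p k + \<epsilon> * log_spread p k) + log 2 a)"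
      using ge by (intro powr_mono) auto
    then have 2: "b \<le> 2 powr (real n * (divergence_rate p k + \<epsilon> * log_spread p k)) * a"
      using ab by (simp add: powr_add)
    show ?le ?ge using 1 2 by (auto simp: seq_pmf_def pmf_Pi a_def b_def)
  qed
qed

text \<open>The weight \<open>F\<close> later carries the failure probability of the channel. The
  first inequality bounds a probability from above and may drop the typical set; the second keeps it
  and gives the lower bound that covering needs.\<close>

lemma nn_integral_typical_le:
  fixes p :: "('t::finite \<times> 'a::finite) pmf" and F :: "(nat \<Rightarrow> 'a) \<Rightarrow> ennreal"
  assumes dis: "disintegrates p k'"
    and ac: "\<And>t a. (t, a) \<in> set_pmf p \<Longrightarrow> a \<in> set_pmf (k t)"
  shows "(\<integral>\<^sup>+s. indicator (typical \<epsilon> n p) (\<lambda>i. (t i, s i)) * F s \<partial>measure_pmf (seq_pmf n (\<lambda>i. k (t i)))) \<le>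
      ennreal (2 powr (- (real n * (divergence_rate p k - \<epsilon> * log_spread p k)))) * (\<integral>\<^sup>+s. F s \<partial>measure_pmf (seq_pmf n (\<lambda>i. k' (t i))))" (is ?le)
    and "(\<integral>\<^sup>+s. indicator (typical \<epsilon> n p) (\<lambda>i. (t i, s i)) * F s \<partial>measure_pmf (seq_pmf n (\<lambda>i. k' (t i)))) \<le>
      ennreal (2 powr (real n * (divergence_rate p k + \<epsilon> * log_spread p k))) *
      (\<integral>\<^sup>+s. indicator (typical \<epsilon> n p) (\<lambda>i. (t i, s i)) * F s \<partial>measure_pmf (seq_pmf n (\<lambda>i. k (t i))))" (is ?ge)
proof -
  note cm = seq_pmf_change_of_measure[OF dis ac]
  show ?le
    unfolding nn_integral_measure_pmf
    apply (subst nn_integral_cmult[symmetric], simp)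
    apply (rule nn_integral_mono)
    apply (auto simp: indicator_def mult.assoc[symmetric] ennreal_mult[symmetric] intro!: mult_right_mono ennreal_leI cm(1))
    done
  show ?ge
    unfolding nn_integral_measure_pmf
    apply (subst nn_integral_cmult[symmetric], simp)
    apply (rule nn_integral_mono)
    apply (auto simp: indicator_def mult.assoc[symmetric] ennreal_mult[symmetric] intro!: mult_right_mono ennreal_leI cm(2))
    done
qed

text \<open>Samples of \<^const>\<open>seq_pmf\<close> are \<open>undefined\<close> from position \<open>n\<close> on.\<close>

definition trim :: "nat \<Rightarrow> (nat \<Rightarrow> 'a) \<Rightarrow> nat \<Rightarrow> 'a" where
  "trim n s = (\<lambda>i. if i < n then s i else undefined)"

lemma seq_pmf_bind:
  "seq_pmf n (\<lambda>i. bind_pmf (k i) (h i)) = bind_pmf (seq_pmf n k) (\<lambda>f. seq_pmf n (\<lambda>i. h i (f i)))"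
  unfolding seq_pmf_def by (rule Pi_pmf_bind) simp

lemma seq_pmf_return: "seq_pmf n (\<lambda>i. return_pmf (f i)) = return_pmf (trim n f)"
  by (simp add: seq_pmf_def trim_def)

lemma seq_pmf_cong:
  assumes "\<And>i. i < n \<Longrightarrow> k i = k' i" shows "seq_pmf n k = seq_pmf n k'"
  unfolding seq_pmf_def by (rule Pi_pmf_cong) (auto simp: assms)

lemma seq_pmf_map: "seq_pmf n (\<lambda>i. map_pmf (f i) (k i)) = map_pmf (\<lambda>s. trim n (\<lambda>i. f i (s i))) (seq_pmf n k)"
  unfolding map_pmf_def by (simp add: seq_pmf_bind seq_pmf_return)

lemma seq_pmf_pair:
  "seq_pmf n (\<lambda>i. pair_pmf (k i) (k' i)) =
   bind_pmf (seq_pmf n k) (\<lambda>s. map_pmf (\<lambda>s'. trim n (\<lambda>i. (s i, s' i))) (seq_pmf n k'))"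
  unfolding pair_pmf_def map_pmf_def seq_pmf_bind seq_pmf_return by simp

text \<open>An exponential rate is required, not just convergence, because this probability is later
  multiplied by an exponentially large density.\<close>

lemma prob_not_typical_exponential:
  fixes p :: "'a::finite pmf"
  assumes "0 < \<epsilon>"
  shows "\<exists>c>0. \<forall>n. measure_pmf.prob (seq_pmf n (\<lambda>_. p)) {s. s \<notin> typical \<epsilon> n p} \<le>
    2 * CARD('a) * 2 powr (- (c * real n))"
proof -
  \<comment> \<open>Hoeffding's exponent for the worst symbol. Only symbols of the support are
    taken, since a null symbol would make the minimum zero.\<close>
  define c where "c = Min ((\<lambda>a. 2 * (\<epsilon> * pmf p a)\<^sup>2) ` set_pmf p)"
  have fin: "finite (set_pmf p)" by simp
  have c: "0 < c" "\<And>a. a \<in> set_pmf p \<Longrightarrow> c \<le> 2 * (\<epsilon> * pmf p a)\<^sup>2"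
    unfolding c_def using assms fin
    by (auto simp: Min_gr_iff set_pmf_not_empty set_pmf_iff)
  have e2: "exp (- (c * real n)) = 2 powr (- ((c / ln 2) * real n))" for n
    by (simp add: powr_def)
  have bound: "measure_pmf.prob (seq_pmf n (\<lambda>_. p))
      {s. \<bar>real (card {i. i < n \<and> s i = a}) / real n - pmf p a\<bar> > \<epsilon> * pmf p a} \<le> 2 * exp (- (c * real n))"
    if n: "n > 0" for n a
  proof (cases "a \<in> set_pmf p")
    case True
    have bern: "map_pmf (\<lambda>x. x = a) p = bernoulli_pmf (pmf p a)"
    proof (rule pmf_eqI)
      fix b
      show "pmf (map_pmf (\<lambda>x. x = a) p) b = pmf (bernoulli_pmf (pmf p a)) b"
      proof (cases b)
        case True
        have "(\<lambda>x. x = a) -` {True} = {a}" by auto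
        then show ?thesis using True by (simp add: pmf_map measure_pmf_single pmf_le_1)
      next
        case False
        have "(\<lambda>x. x = a) -` {False} = space (measure_pmf p) - {a}" by auto
        then have "measure_pmf.prob p ((\<lambda>x. x = a) -` {False}) = 1 - pmf p a"
          by (simp only:) (subst measure_pmf.prob_compl, auto simp: measure_pmf_single)
        then show ?thesis using False by (simp add: pmf_map pmf_le_1)
      qed
    qed
    have "binomial_pmf n (pmf p a) =
        map_pmf (\<lambda>f. card {x\<in>{..<n}. f x}) (Pi_pmf {..<n} (undefined = a) (\<lambda>_. map_pmf (\<lambda>x. x = a) p))"
      unfolding bern by (rule binomial_pmf_altdef') (auto simp: pmf_le_1)
    also have "\<dots> = map_pmf (\<lambda>s. card {i. i < n \<and> s i = a}) (seq_pmf n (\<lambda>_. p))"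
      by (subst Pi_pmf_map) (auto simp: pmf.map_comp o_def seq_pmf_def)
    finally have bin: "binomial_pmf n (pmf p a) = \<dots>" .
    have "measure_pmf.prob (seq_pmf n (\<lambda>_. p))
      {s. \<bar>real (card {i. i < n \<and> s i = a}) / real n - pmf p a\<bar> > \<epsilon> * pmf p a}
      \<le> measure_pmf.prob (binomial_pmf n (pmf p a)) {x. \<bar>real x / real n - pmf p a\<bar> \<ge> \<epsilon> * pmf p a}"
      unfolding bin measure_map_pmf by (rule measure_pmf.finite_measure_mono) auto
    also have "\<dots> \<le> 2 * exp (-2 * real n * (\<epsilon> * pmf p a)\<^sup>2)"
      using binomial_distribution.prob_abs_ge'[of "pmf p a" n "\<epsilon> * pmf p a"] n assms
      by (simp add: binomial_distribution_def pmf_le_1)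
    also have "\<dots> \<le> 2 * exp (- (c * real n))"
      using c(2)[OF True] n by (simp add: mult.commute mult.left_commute)
    finally show ?thesis .
  next
    \<comment> \<open>A null symbol almost surely never occurs, so its frequency is exact.\<close>
    case False
    then have z: "pmf p a = 0" by (simp add: set_pmf_iff)
    have "s i \<noteq> a" if "s \<in> set_pmf (seq_pmf n (\<lambda>_. p))" "i < n" for s i
    proof -
      have "s i \<in> set_pmf p"
        using that set_Pi_pmf_subset'[of "{..<n}" undefined "\<lambda>_. p"] by (auto simp: seq_pmf_def PiE_dflt_def)
      then show ?thesis using False by auto
    qed
    then have "card {i. i < n \<and> s i = a} = 0" if "s \<in> set_pmf (seq_pmf n (\<lambda>_. p))" for s
      using that by auto
    then have "measure_pmf.prob (seq_pmf n (\<lambda>_. p))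
      {s. \<bar>real (card {i. i < n \<and> s i = a}) / real n - pmf p a\<bar> > \<epsilon> * pmf p a} = 0"
      by (auto simp: measure_pmf_zero_iff z simp del: card_eq_0_iff card_0_eq)
    then show ?thesis by (simp only:) simp
  qed
  show ?thesis
  proof (intro exI[of _ "c / ln 2"] conjI allI)
    show "c / ln 2 > 0" using c by simp
    fix n
    show "measure_pmf.prob (seq_pmf n (\<lambda>_. p)) {s. s \<notin> typical \<epsilon> n p} \<le> 2 * CARD('a) * 2 powr (- (c / ln 2 * real n))"
    proof (cases "n = 0")
      case True
      have "1 \<le> CARD('a)" by (simp add: Suc_leI)
      then have "1 \<le> 2 * real CARD('a)" by linarith
      also have "\<dots> = 2 * CARD('a) * 2 powr (- (c / ln 2 * real n))" using True by simp
      finally show ?thesis by (rule order.trans[OF measure_pmf.prob_le_1])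
    next
      case False
      have "measure_pmf.prob (seq_pmf n (\<lambda>_. p)) {s. s \<notin> typical \<epsilon> n p} \<le>
        measure_pmf.prob (seq_pmf n (\<lambda>_. p)) (\<Union>a. {s. \<bar>real (card {i. i < n \<and> s i = a}) / real n - pmf p a\<bar> > \<epsilon> * pmf p a})"
        by (rule measure_pmf.finite_measure_mono) (auto simp: typical_def not_le)
      also have "\<dots> \<le> (\<Sum>a\<in>UNIV. measure_pmf.prob (seq_pmf n (\<lambda>_. p)) {s. \<bar>real (card {i. i < n \<and> s i = a}) / real n - pmf p a\<bar> > \<epsilon> * pmf p a})"
        by (rule measure_pmf.finite_measure_subadditive_finite) auto
      also have "\<dots> \<le> (\<Sum>a\<in>(UNIV::'a set). 2 * exp (- (c * real n)))"
        using False by (intro sum_mono bound) simp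
      finally show ?thesis by (simp add: e2)
    qed
  qed
qed

section \<open>The second moment method for two independent codebooks\<close>

section \<open>Mutual covering\<close>

lemma nn_integral_pmf_swap:
  fixes f :: "'a \<Rightarrow> 'b \<Rightarrow> ennreal"
  shows "(\<integral>\<^sup>+a. \<integral>\<^sup>+b. f a b \<partial>measure_pmf N \<partial>measure_pmf M) = (\<integral>\<^sup>+b. \<integral>\<^sup>+a. f a b \<partial>measure_pmf M \<partial>measure_pmf N)"
proof -
  have "bind_pmf M (\<lambda>a. bind_pmf N (\<lambda>b. return_pmf (a, b))) = bind_pmf N (\<lambda>b. bind_pmf M (\<lambda>a. return_pmf (a, b)))"
    by (rule bind_commute_pmf)
  then have "(\<integral>\<^sup>+w. f (fst w) (snd w) \<partial>measure_pmf (bind_pmf M (\<lambda>a. bind_pmf N (\<lambda>b. return_pmf (a, b))))) =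
    (\<integral>\<^sup>+w. f (fst w) (snd w) \<partial>measure_pmf (bind_pmf N (\<lambda>b. bind_pmf M (\<lambda>a. return_pmf (a, b)))))" by simp
  then show ?thesis by simp
qed

lemma Pi_pmf_two_components:
  assumes "finite D" "i \<in> D" "j \<in> D" "i \<noteq> j"
  shows "map_pmf (\<lambda>f. (f i, f j)) (Pi_pmf D d p) = pair_pmf (p i) (p j)"
proof -
  have "D = insert i (D - {i})" using assms by auto
  then have "Pi_pmf D d p = map_pmf (\<lambda>(y, f). f(i := y)) (pair_pmf (p i) (Pi_pmf (D - {i}) d p))"
    using Pi_pmf_insert[of "D - {i}" i d p] assms by simp
  then have "map_pmf (\<lambda>f. (f i, f j)) (Pi_pmf D d p) = map_pmf (\<lambda>(y, f). (y, f j)) (pair_pmf (p i) (Pi_pmf (D - {i}) d p))"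
    using assms by (simp add: pmf.map_comp o_def case_prod_unfold)
  also have "\<dots> = pair_pmf (map_pmf id (p i)) (map_pmf (\<lambda>f. f j) (Pi_pmf (D - {i}) d p))"
    by (simp add: pair_map_pmf2 apsnd_def map_prod_def id_def)
  finally show ?thesis using assms by (simp add: Pi_pmf_component)
qed

text \<open>Chebyshev's argument for the number A of events that occur, with mean
  \<open>\<mu>\<close>: where none occurs, the square of A - \<open>\<mu>\<close> equals that of
  \<open>\<mu>\<close>. Leaving \<open>\<mu>\<close> on the left avoids a division.\<close>

lemma second_moment_bound:
  fixes M :: "'w pmf" and p S :: real
  assumes "finite Z" "\<And>z. z \<in> Z \<Longrightarrow> measure_pmf.prob M (B z) = p"
    and S: "(\<Sum>z\<in>Z. \<Sum>z'\<in>Z. measure_pmf.prob M (B z \<inter> B z')) \<le> S"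
  shows "(card Z * p)\<^sup>2 * measure_pmf.prob M {w. \<forall>z\<in>Z. w \<notin> B z} \<le> S - (card Z * p)\<^sup>2"
proof -
  define \<mu> :: real where "\<mu> = card Z * p"
  define A where "A w = (\<Sum>z\<in>Z. indicator (B z) w :: real)" for w
  have int: "integrable (measure_pmf M) (indicator B :: _ \<Rightarrow> real)" for B
    by (rule integrable_real_indicator) (auto simp: measure_pmf.emeasure_eq_measure)
  have eA: "measure_pmf.expectation M A = \<mu>"
    unfolding A_def by (subst Bochner_Integration.integral_sum) (auto simp: int assms \<mu>_def)
  have iA: "integrable (measure_pmf M) A" unfolding A_def by (intro Bochner_Integration.integrable_sum int)
  have A2: "(A w)\<^sup>2 = (\<Sum>z\<in>Z. \<Sum>z'\<in>Z. indicator (B z \<inter> B z') w)" for w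
    by (simp add: A_def power2_eq_square sum_product indicator_inter_arith)
  have iA2: "integrable (measure_pmf M) (\<lambda>w. (A w)\<^sup>2)"
    unfolding A2 by (intro Bochner_Integration.integrable_sum int)
  have eA2: "measure_pmf.expectation M (\<lambda>w. (A w)\<^sup>2) \<le> S"
    unfolding A2 using S by (simp add: Bochner_Integration.integral_sum int)
  have "\<mu>\<^sup>2 * measure_pmf.prob M {w. \<forall>z\<in>Z. w \<notin> B z} =
    measure_pmf.expectation M (\<lambda>w. \<mu>\<^sup>2 * (indicator {w. \<forall>z\<in>Z. w \<notin> B z} w :: real))"
    by simp
  also have "\<dots> \<le> measure_pmf.expectation M (\<lambda>w. (A w)\<^sup>2 - 2 * \<mu> * A w + \<mu>\<^sup>2)"
  proof (rule integral_mono)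
    show "integrable (measure_pmf M) (\<lambda>w. \<mu>\<^sup>2 * (indicator {w. \<forall>z\<in>Z. w \<notin> B z} w :: real))"
      by (intro integrable_mult_right int)
    show "integrable (measure_pmf M) (\<lambda>w. (A w)\<^sup>2 - 2 * \<mu> * A w + \<mu>\<^sup>2)"
      using iA iA2 by auto
    fix w
    have sq: "(A w)\<^sup>2 - 2 * \<mu> * A w + \<mu>\<^sup>2 = (A w - \<mu>)\<^sup>2"
      by (simp add: power2_eq_square algebra_simps)
    show "\<mu>\<^sup>2 * indicator {w. \<forall>z\<in>Z. w \<notin> B z} w \<le> (A w)\<^sup>2 - 2 * \<mu> * A w + \<mu>\<^sup>2"
    proof (cases "\<forall>z\<in>Z. w \<notin> B z")
      case True
      then have "A w = 0" by (simp add: A_def)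
      then show ?thesis by (simp add: indicator_def)
    next
      case False
      then show ?thesis unfolding sq by (auto simp: indicator_def)
    qed
  qed
  also have "\<dots> = measure_pmf.expectation M (\<lambda>w. (A w)\<^sup>2) - 2 * \<mu> * \<mu> + \<mu>\<^sup>2"
    using iA iA2 by (simp add: eA)
  also have "\<dots> \<le> S - \<mu>\<^sup>2" using eA2 by (simp add: power2_eq_square)
  finally show ?thesis by (simp add: \<mu>_def)
qed

text \<open>Two candidate pairs without a common index are independent and contribute only the
  squared mean, so the variance comes from pairs that share one index, at most \<open>c * p\<close>
  each, or both, \<open>p\<close> each. \<open>I\<close> and \<open>J\<close> may be proper subsets
  of the codebook domains because an encoder searches only the row of its message.\<close>

lemma mutual_covering:
  fixes P :: "'a pmf" and P' :: "'b pmf" and T :: "'a \<Rightarrow> 'b \<Rightarrow> bool"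
    and I :: "'i set" and J :: "'j set"
  assumes fin: "finite D" "finite D'" and sub: "I \<subseteq> D" "J \<subseteq> D'" and ne: "I \<noteq> {}" "J \<noteq> {}"
    and p: "p = measure_pmf.prob (pair_pmf P P') {(a, b). T a b}" "0 < p"
    and c: "\<And>a. measure_pmf.prob P' {b. T a b} \<le> c" "\<And>b. measure_pmf.prob P {a. T a b} \<le> c"
  shows "measure_pmf.prob (pair_pmf (Pi_pmf D d (\<lambda>_. P)) (Pi_pmf D' d' (\<lambda>_. P')))
      {(U, X). \<forall>i\<in>I. \<forall>j\<in>J. \<not> T (U i) (X j)}
    \<le> 1 / (real (card I) * real (card J) * p) + c / (real (card I) * p) + c / (real (card J) * p)"
proof -
  let ?M = "pair_pmf (Pi_pmf D d (\<lambda>_. P)) (Pi_pmf D' d' (\<lambda>_. P'))"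
  define B where "B z = {(U, X). T (U (fst z)) (X (snd z))}" for z :: "'i \<times> 'j"
  define \<tau> :: "'a \<Rightarrow> 'b \<Rightarrow> ennreal" where "\<tau> a b = (if T a b then 1 else 0)" for a b
  have \<tau>\<tau>: "\<tau> a b * \<tau> a b = \<tau> a b" for a b by (simp add: \<tau>_def)
  define g where "g a = (\<integral>\<^sup>+b. \<tau> a b \<partial>measure_pmf P')" for a
  define h where "h b = (\<integral>\<^sup>+a. \<tau> a b \<partial>measure_pmf P)" for b
  have c0: "c \<ge> 0" using c(1) order.trans[OF measure_nonneg] by blast
  have ind: "(\<lambda>b. \<tau> a b) = indicator {b. T a b}" "(\<lambda>a. \<tau> a b) = indicator {a. T a b}" for a b
    by (auto simp: \<tau>_def indicator_def)
  have g: "g a \<le> ennreal c" for a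
    unfolding g_def ind using c(1)[of a] by (simp add: measure_pmf.emeasure_eq_measure ennreal_leI)
  have h: "h b \<le> ennreal c" for b
    unfolding h_def ind(2) using c(2)[of b] by (simp add: measure_pmf.emeasure_eq_measure ennreal_leI)
  have gp: "(\<integral>\<^sup>+a. g a \<partial>measure_pmf P) = ennreal p"
  proof -
    have "ennreal p = emeasure (pair_pmf P P') {(a, b). T a b}"
      by (simp add: p(1) measure_pmf.emeasure_eq_measure)
    also have "\<dots> = (\<integral>\<^sup>+w. \<tau> (fst w) (snd w) \<partial>measure_pmf (pair_pmf P P'))"
    proof -
      have "(\<lambda>w. \<tau> (fst w) (snd w)) = indicator {(a, b). T a b}"
        by (auto simp: fun_eq_iff \<tau>_def indicator_def)
      then show ?thesis by simp
    qed
    finally show ?thesis by (simp add: nn_integral_pair_pmf' g_def)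
  qed
  have hp: "(\<integral>\<^sup>+b. h b \<partial>measure_pmf P') = ennreal p"
    unfolding gp[symmetric] g_def h_def by (rule nn_integral_pmf_swap)
  have comp: "(\<integral>\<^sup>+U. F (U i) \<partial>measure_pmf (Pi_pmf D d (\<lambda>_. P))) = (\<integral>\<^sup>+a. F a \<partial>measure_pmf P)" if "i \<in> I" for F i
    using nn_integral_map_pmf[of "\<lambda>U. U i" "Pi_pmf D d (\<lambda>_. P)" F] that sub fin by (auto simp: Pi_pmf_component)
  have comp': "(\<integral>\<^sup>+U. F (U i) \<partial>measure_pmf (Pi_pmf D' d' (\<lambda>_. P'))) = (\<integral>\<^sup>+a. F a \<partial>measure_pmf P')" if "i \<in> J" for F i
    using nn_integral_map_pmf[of "\<lambda>U. U i" "Pi_pmf D' d' (\<lambda>_. P')" F] that sub fin by (auto simp: Pi_pmf_component)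
  have two: "(\<integral>\<^sup>+U. F (U i) (U i') \<partial>measure_pmf (Pi_pmf D d (\<lambda>_. P))) = (\<integral>\<^sup>+a. \<integral>\<^sup>+a'. F a a' \<partial>measure_pmf P \<partial>measure_pmf P)"
    if "i \<in> I" "i' \<in> I" "i \<noteq> i'" for F i i'
  proof -
    have "map_pmf (\<lambda>f. (f i, f i')) (Pi_pmf D d (\<lambda>_. P)) = pair_pmf P P"
      using that sub fin by (subst Pi_pmf_two_components) auto
    then show ?thesis using nn_integral_map_pmf[of "\<lambda>U. (U i, U i')" "Pi_pmf D d (\<lambda>_. P)" "\<lambda>(a,a'). F a a'"]
      by (simp add: nn_integral_pair_pmf')
  qed
  have two': "(\<integral>\<^sup>+U. F (U i) (U i') \<partial>measure_pmf (Pi_pmf D' d' (\<lambda>_. P'))) = (\<integral>\<^sup>+a. \<integral>\<^sup>+a'. F a a' \<partial>measure_pmf P' \<partial>measure_pmf P')"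
    if "i \<in> J" "i' \<in> J" "i \<noteq> i'" for F i i'
  proof -
    have "map_pmf (\<lambda>f. (f i, f i')) (Pi_pmf D' d' (\<lambda>_. P')) = pair_pmf P' P'"
      using that sub fin by (subst Pi_pmf_two_components) auto
    then show ?thesis using nn_integral_map_pmf[of "\<lambda>U. (U i, U i')" "Pi_pmf D' d' (\<lambda>_. P')" "\<lambda>(a,a'). F a a'"]
      by (simp add: nn_integral_pair_pmf')
  qed
  have em: "emeasure ?M (B (i, j) \<inter> B (i', j')) =
      (\<integral>\<^sup>+U. \<integral>\<^sup>+X. \<tau> (U i) (X j) * \<tau> (U i') (X j') \<partial>measure_pmf (Pi_pmf D' d' (\<lambda>_. P')) \<partial>measure_pmf (Pi_pmf D d (\<lambda>_. P)))"
    for i j i' j'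
  proof -
    have "(\<lambda>w. \<tau> (fst w i) (snd w j) * \<tau> (fst w i') (snd w j')) = indicator (B (i, j) \<inter> B (i', j'))"
      by (auto simp: fun_eq_iff \<tau>_def indicator_def B_def)
    then have "emeasure ?M (B (i, j) \<inter> B (i', j')) =
        (\<integral>\<^sup>+w. \<tau> (fst w i) (snd w j) * \<tau> (fst w i') (snd w j') \<partial>measure_pmf ?M)" by simp
    then show ?thesis by (simp add: nn_integral_pair_pmf')
  qed
  \<comment> \<open>The cases are added up rather than nested, so that the fourfold sum over indices
    can be evaluated term by term.\<close>
  have bound: "measure_pmf.prob ?M (B (i,j) \<inter> B (i',j')) \<le>
      p * p + (if i = i' then c * p else 0) + (if j = j' then c * p else 0) + (if i = i' then if j = j' then p else 0 else 0)" (is "_ \<le> ?R")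
    and eq: "i = i' \<Longrightarrow> j = j' \<Longrightarrow> measure_pmf.prob ?M (B (i,j) \<inter> B (i',j')) = p"
    if ij: "i \<in> I" "j \<in> J" "i' \<in> I" "j' \<in> J" for i j i' j'
  proof -
    consider (1) "i \<noteq> i'" "j \<noteq> j'" | (2) "i = i'" "j \<noteq> j'" | (3) "i \<noteq> i'" "j = j'" | (4) "i = i'" "j = j'" by blast
    note cs = this
    show e: "measure_pmf.prob ?M (B (i,j) \<inter> B (i',j')) = p" if "i = i'" "j = j'"
    proof -
      have "emeasure ?M (B (i, j) \<inter> B (i', j')) = ennreal p"
        unfolding em that \<tau>\<tau> using ij by (simp add: comp' comp[of i' "\<lambda>a. \<integral>\<^sup>+ x. \<tau> a x \<partial>measure_pmf P'"] that) (simp add: g_def[symmetric] gp)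
      then show ?thesis using p(2) by (simp add: measure_pmf.emeasure_eq_measure)
    qed
    have "emeasure ?M (B (i, j) \<inter> B (i', j')) \<le> ennreal ?R" 
    using cs proof cases
      case 1
      have "(\<integral>\<^sup>+X. \<tau> a (X j) * \<tau> a' (X j') \<partial>measure_pmf (Pi_pmf D' d' (\<lambda>_. P'))) = g a * g a'" for a a'
        using ij 1 by (simp add: two'[of j j' "\<lambda>b b'. \<tau> a b * \<tau> a' b'"] nn_integral_cmult nn_integral_multc g_def)
      then have "emeasure ?M (B (i, j) \<inter> B (i', j')) = ennreal p * ennreal p"
        unfolding em using ij 1 by (simp add: two[of i i' "\<lambda>a a'. g a * g a'"] nn_integral_cmult nn_integral_multc gp)
      then show ?thesis using p(2) 1 by (simp add: ennreal_mult)
    next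
      case 2
      have "(\<integral>\<^sup>+X. \<tau> a (X j) * \<tau> a (X j') \<partial>measure_pmf (Pi_pmf D' d' (\<lambda>_. P'))) = g a * g a" for a
        using ij 2 by (simp add: two'[of j j' "\<lambda>b b'. \<tau> a b * \<tau> a b'"] nn_integral_cmult nn_integral_multc g_def)
      then have "emeasure ?M (B (i, j) \<inter> B (i', j')) = (\<integral>\<^sup>+a. g a * g a \<partial>measure_pmf P)"
        unfolding em using ij 2 by (simp add: comp[of i' "\<lambda>a. g a * g a"])
      also have "\<dots> \<le> (\<integral>\<^sup>+a. ennreal c * g a \<partial>measure_pmf P)"
        by (intro nn_integral_mono mult_right_mono g) simp
      also have "\<dots> = ennreal (c * p)" using c0 p(2) by (simp add: nn_integral_cmult gp ennreal_mult)
      also have "\<dots> \<le> ennreal ?R" using 2 c0 p(2) by (intro ennreal_leI) simp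
      finally show ?thesis .
    next
      \<comment> \<open>The two events are independent given the shared second word, so its integral
        is moved outermost; \<open>h\<close> then plays the part that \<open>g\<close> has for a
        shared first word.\<close>
      case 3
      have "(\<integral>\<^sup>+X. \<tau> a (X j) * \<tau> a' (X j') \<partial>measure_pmf (Pi_pmf D' d' (\<lambda>_. P'))) = (\<integral>\<^sup>+b. \<tau> a b * \<tau> a' b \<partial>measure_pmf P')" for a a'
        using ij 3 by (simp add: comp'[of j' "\<lambda>b. \<tau> a b * \<tau> a' b"])
      then have "emeasure ?M (B (i, j) \<inter> B (i', j')) = (\<integral>\<^sup>+a. \<integral>\<^sup>+a'. \<integral>\<^sup>+b. \<tau> a b * \<tau> a' b \<partial>measure_pmf P' \<partial>measure_pmf P \<partial>measure_pmf P)"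
        unfolding em using ij 3 by (simp add: two[of i i' "\<lambda>a a'. \<integral>\<^sup>+b. \<tau> a b * \<tau> a' b \<partial>measure_pmf P'"])
      also have "\<dots> = (\<integral>\<^sup>+a. \<integral>\<^sup>+b. \<integral>\<^sup>+a'. \<tau> a b * \<tau> a' b \<partial>measure_pmf P \<partial>measure_pmf P' \<partial>measure_pmf P)"
        by (intro nn_integral_cong nn_integral_pmf_swap)
      also have "\<dots> = (\<integral>\<^sup>+b. \<integral>\<^sup>+a. \<integral>\<^sup>+a'. \<tau> a b * \<tau> a' b \<partial>measure_pmf P \<partial>measure_pmf P \<partial>measure_pmf P')"
        by (rule nn_integral_pmf_swap)
      also have "\<dots> = (\<integral>\<^sup>+b. h b * h b \<partial>measure_pmf P')"
        by (simp add: nn_integral_cmult nn_integral_multc h_def)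
      also have "\<dots> \<le> (\<integral>\<^sup>+b. ennreal c * h b \<partial>measure_pmf P')"
        by (intro nn_integral_mono mult_right_mono h) simp
      also have "\<dots> = ennreal (c * p)" using c0 p(2) by (simp add: nn_integral_cmult hp ennreal_mult)
      also have "\<dots> \<le> ennreal ?R" using 3 c0 p(2) by (intro ennreal_leI) simp
      finally show ?thesis .
    next
      case 4
      then show ?thesis using e c0 p(2) by (simp add: measure_pmf.emeasure_eq_measure)
    qed
    moreover have "0 \<le> ?R" using c0 p(2) by auto
    ultimately show "measure_pmf.prob ?M (B (i,j) \<inter> B (i',j')) \<le> ?R"
      by (simp add: measure_pmf.emeasure_eq_measure)
  qed
  have fI: "finite I" "finite J" using fin sub finite_subset by auto
  define N where "N = real (card I)"
  define N' where "N' = real (card J)"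
  have Npos: "N > 0" "N' > 0" using fI ne by (auto simp: N_def N'_def card_gt_0_iff)
  have cart: "(\<Sum>z\<in>I \<times> J. F z) = (\<Sum>i\<in>I. \<Sum>j\<in>J. F (i, j))" for F :: "_ \<Rightarrow> real"
    by (simp add: sum.cartesian_product)
  have "(\<Sum>z\<in>I \<times> J. \<Sum>z'\<in>I \<times> J. measure_pmf.prob ?M (B z \<inter> B z')) =
      (\<Sum>i\<in>I. \<Sum>j\<in>J. \<Sum>i'\<in>I. \<Sum>j'\<in>J. measure_pmf.prob ?M (B (i,j) \<inter> B (i',j')))"
    by (simp only: cart)
  also have "\<dots> \<le> (\<Sum>i\<in>I. \<Sum>j\<in>J. \<Sum>i'\<in>I. \<Sum>j'\<in>J. p * p + (if i = i' then c * p else 0) + (if j = j' then c * p else 0) + (if i = i' then if j = j' then p else 0 else 0))"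
    by (intro sum_mono bound)
  also have "\<dots> = (\<Sum>i\<in>I. \<Sum>j\<in>J. N * (N' * (p * p)) + N' * (c * p) + N * (c * p) + p)"
  proof (intro sum.cong refl)
    fix i j assume ij: "i \<in> I" "j \<in> J"
    have s1: "(\<Sum>j'\<in>J. p * p + (if i = i' then c * p else 0) + (if j = j' then c * p else 0) + (if i = i' then if j = j' then p else 0 else 0))
      = N' * (p * p) + (if i = i' then N' * (c * p) else 0) + c * p + (if i = i' then p else 0)" for i'
      using ij fI by (cases "i = i'") (simp_all add: sum.distrib N'_def distrib_left)
    show "(\<Sum>i'\<in>I. \<Sum>j'\<in>J. p * p + (if i = i' then c * p else 0) + (if j = j' then c * p else 0) + (if i = i' then if j = j' then p else 0 else 0))
       = N * (N' * (p * p)) + N' * (c * p) + N * (c * p) + p"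
      unfolding s1 using ij fI by (simp add: sum.distrib N_def)
  qed
  also have "\<dots> = (N * N' * p)\<^sup>2 + N * N' * (N' * (c * p) + N * (c * p) + p)"
    by (simp add: N_def N'_def power2_eq_square algebra_simps)
  finally have S: "(\<Sum>z\<in>I \<times> J. \<Sum>z'\<in>I \<times> J. measure_pmf.prob ?M (B z \<inter> B z')) \<le> \<dots>" .
  have pr: "measure_pmf.prob ?M (B z) = p" if "z \<in> I \<times> J" for z
    using eq[of "fst z" "snd z" "fst z" "snd z"] that by auto
  have "(card (I \<times> J) * p)\<^sup>2 * measure_pmf.prob ?M {w. \<forall>z\<in>I \<times> J. w \<notin> B z} \<le>
     ((N * N' * p)\<^sup>2 + N * N' * (N' * (c * p) + N * (c * p) + p)) - (card (I \<times> J) * p)\<^sup>2"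
    by (rule second_moment_bound[OF _ pr S]) (use fI in auto)
  then have "(N * N' * p)\<^sup>2 * measure_pmf.prob ?M {w. \<forall>z\<in>I \<times> J. w \<notin> B z} \<le> N * N' * (N' * (c * p) + N * (c * p) + p)"
    by (simp add: card_cartesian_product N_def N'_def)
  then have "measure_pmf.prob ?M {w. \<forall>z\<in>I \<times> J. w \<notin> B z} \<le> N * N' * (N' * (c * p) + N * (c * p) + p) / (N * N' * p)\<^sup>2"
    using Npos p(2) by (simp add: field_simps)
  also have "\<dots> = 1 / (N * N' * p) + c / (N * p) + c / (N' * p)"
    using Npos p(2) by (simp add: field_simps power2_eq_square)
  finally have fin: "measure_pmf.prob ?M {w. \<forall>z\<in>I \<times> J. w \<notin> B z} \<le> \<dots>" .
  have "{w. \<forall>z\<in>I \<times> J. w \<notin> B z} = {(U, X). \<forall>i\<in>I. \<forall>j\<in>J. \<not> T (U i) (X j)}"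
    by (auto simp: B_def)
  with fin show ?thesis by (simp add: N_def N'_def)
qed

section \<open>What a choice of codewords leaves independent\<close>

section \<open>Codeword selection\<close>

text \<open>
  The default \<open>(0, 1)\<close> makes a failing encoder transmit the codeword with index 1, while its coordination
  index 0 lies in no index set, so that every coordination codeword then counts as unselected.
\<close>

definition select :: "nat set \<Rightarrow> nat set \<Rightarrow> ('a \<Rightarrow> 'b \<Rightarrow> bool) \<Rightarrow> (nat \<Rightarrow> 'a) \<Rightarrow> (nat \<Rightarrow> 'b) \<Rightarrow> nat \<times> nat" where
  "select Lc Lp T u x =
     (let S = {(a, b). a \<in> Lc \<and> b \<in> Lp \<and> T (u a) (x b)} in if S = {} then (0, 1) else lex_first S)"

definition covered :: "nat set \<Rightarrow> nat set \<Rightarrow> ('a \<Rightarrow> 'b \<Rightarrow> bool) \<Rightarrow> (nat \<Rightarrow> 'a) \<Rightarrow> (nat \<Rightarrow> 'b) \<Rightarrow> bool" where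
  "covered Lc Lp T u x \<longleftrightarrow> (\<exists>a\<in>Lc. \<exists>b\<in>Lp. T (u a) (x b))"

lemma lex_first_mem:
  assumes "S \<noteq> {}" shows "lex_first S \<in> S"
proof -
  have "\<exists>a b. (a, b) \<in> S" using assms by auto
  then have "\<exists>b. (LEAST a. \<exists>b. (a, b) \<in> S, b) \<in> S" by (rule LeastI_ex)
  then have "(LEAST a. \<exists>b. (a, b) \<in> S, LEAST b. (LEAST a. \<exists>b. (a, b) \<in> S, b) \<in> S) \<in> S" by (rule LeastI_ex)
  then show ?thesis by (simp add: lex_first_def Let_def)
qed

text \<open>The first element of a set is also first in every subset that still contains it.\<close>

lemma lex_first_subset:
  assumes "S' \<subseteq> S" "lex_first S \<in> S'"
  shows "lex_first S' = lex_first S"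
proof -
  define a where "a = (LEAST a. \<exists>b. (a, b) \<in> S)"
  define b where "b = (LEAST b. (a, b) \<in> S)"
  have e: "lex_first S = (a, b)" by (simp add: lex_first_def Let_def a_def b_def)
  then have ab: "(a, b) \<in> S'" using assms by simp
  have a: "(LEAST a. \<exists>b. (a, b) \<in> S') = a"
  proof (rule Least_equality)
    show "\<exists>b. (a, b) \<in> S'" using ab by blast
    fix y assume "\<exists>b. (y, b) \<in> S'"
    then have "\<exists>b. (y, b) \<in> S" using assms by blast
    then show "a \<le> y" unfolding a_def by (rule Least_le)
  qed
  have b: "(LEAST b. (a, b) \<in> S') = b"
  proof (rule Least_equality)
    show "(a, b) \<in> S'" by (rule ab)
    fix y assume "(a, y) \<in> S'"
    then have "(a, y) \<in> S" using assms by blast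
    then show "b \<le> y" unfolding b_def by (rule Least_le)
  qed
  show ?thesis unfolding e by (simp add: lex_first_def Let_def a b)
qed

lemma select_covered:
  assumes "covered Lc Lp T u x"
  shows "fst (select Lc Lp T u x) \<in> Lc" "snd (select Lc Lp T u x) \<in> Lp"
    "T (u (fst (select Lc Lp T u x))) (x (snd (select Lc Lp T u x)))"
proof -
  let ?S = "{(a, b). a \<in> Lc \<and> b \<in> Lp \<and> T (u a) (x b)}"
  have ne: "?S \<noteq> {}" using assms by (auto simp: covered_def)
  have "select Lc Lp T u x \<in> ?S"
    using lex_first_mem[OF ne] ne unfolding select_def Let_def by (simp only: if_False)
  then show "fst (select Lc Lp T u x) \<in> Lc" "snd (select Lc Lp T u x) \<in> Lp"
    "T (u (fst (select Lc Lp T u x))) (x (snd (select Lc Lp T u x)))" by auto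
qed

lemma select_cong:
  assumes "\<And>a. a \<in> Lc \<Longrightarrow> u a = u' a" "\<And>b. b \<in> Lp \<Longrightarrow> x b = x' b"
  shows "select Lc Lp T u x = select Lc Lp T u' x'"
proof -
  have "{(a, b). a \<in> Lc \<and> b \<in> Lp \<and> T (u a) (x b)} = {(a, b). a \<in> Lc \<and> b \<in> Lp \<and> T (u' a) (x' b)}"
    using assms by auto
  then show ?thesis by (simp add: select_def)
qed

text \<open>If the search succeeds, the winner survives the removal and stays first; if it fails, it
  fails on the smaller set too, with the same default.\<close>

lemma select_remove_unselected:
  assumes "l \<noteq> fst (select Lc Lp T u x)"
  shows "select (Lc - {l}) Lp T u x = select Lc Lp T u x"
proof -
  let ?S = "{(a, b). a \<in> Lc \<and> b \<in> Lp \<and> T (u a) (x b)}"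
  let ?S' = "{(a, b). a \<in> Lc - {l} \<and> b \<in> Lp \<and> T (u a) (x b)}"
  show ?thesis
  proof (cases "?S = {}")
    case True
    then have "?S' = {}" by auto
    then show ?thesis unfolding select_def Let_def True by simp
  next
    case False
    then have sel: "select Lc Lp T u x = lex_first ?S" unfolding select_def Let_def by (simp only: if_False)
    have "lex_first ?S \<in> ?S" by (rule lex_first_mem[OF False])
    moreover have "fst (lex_first ?S) \<noteq> l" using assms sel by simp
    ultimately have mem: "lex_first ?S \<in> ?S'" by auto
    then have "?S' \<noteq> {}" by blast
    then have "select (Lc - {l}) Lp T u x = lex_first ?S'" unfolding select_def Let_def by (simp only: if_False)
    also have "\<dots> = lex_first ?S" by (rule lex_first_subset[OF _ mem]) auto
    finally show ?thesis by (simp add: sel)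
  qed
qed

definition coord :: "nat set \<Rightarrow> nat set \<Rightarrow> ('a \<Rightarrow> 'b \<Rightarrow> bool) \<Rightarrow> nat \<Rightarrow> (nat \<Rightarrow> 'a) \<Rightarrow> (nat \<times> nat \<Rightarrow> 'b) \<Rightarrow> nat" where
  "coord Lc Lp T m U X = fst (select Lc Lp T U (\<lambda>b. X (m, b)))"

definition send :: "nat set \<Rightarrow> nat set \<Rightarrow> ('a \<Rightarrow> 'b \<Rightarrow> bool) \<Rightarrow> nat \<Rightarrow> (nat \<Rightarrow> 'a) \<Rightarrow> (nat \<times> nat \<Rightarrow> 'b) \<Rightarrow> 'b" where
  "send Lc Lp T m U X = X (m, snd (select Lc Lp T U (\<lambda>b. X (m, b))))"

lemma nn_integral_Pi_pmf_remove:
  assumes "finite L" "l \<in> L"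
  shows "(\<integral>\<^sup>+U. F U \<partial>measure_pmf (Pi_pmf L d p)) =
    (\<integral>\<^sup>+v. \<integral>\<^sup>+U. F (U(l := v)) \<partial>measure_pmf (Pi_pmf (L - {l}) d p) \<partial>measure_pmf (p l))"
proof -
  have "Pi_pmf (insert l (L - {l})) d p =
             do {y \<leftarrow> p l; f \<leftarrow> Pi_pmf (L - {l}) d p; return_pmf (f(l := y))}"
    by (rule Pi_pmf_insert') (use assms in auto)
  moreover have "insert l (L - {l}) = L" using assms by auto
  ultimately show ?thesis by simp
qed

lemma nn_integral_Pi_pmf_component:
  assumes "finite L" "l \<in> L"
  shows "(\<integral>\<^sup>+U. F (U l) \<partial>measure_pmf (Pi_pmf L d p)) = (\<integral>\<^sup>+v. F v \<partial>measure_pmf (p l))"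
  using nn_integral_map_pmf[of "\<lambda>U. U l" "Pi_pmf L d p" F] assms by (simp add: Pi_pmf_component)

lemma nn_integral_pmf_le_const:
  assumes "\<And>x. x \<in> set_pmf M \<Longrightarrow> f x \<le> c"
  shows "(\<integral>\<^sup>+x. f x \<partial>measure_pmf M) \<le> (c::ennreal)"
proof -
  have "(\<integral>\<^sup>+x. f x \<partial>measure_pmf M) \<le> (\<integral>\<^sup>+x. c \<partial>measure_pmf M)"
    by (intro nn_integral_mono_AE AE_pmfI assms)
  then show ?thesis by simp
qed

text \<open>The law \<open>E\<close> is that of the transmitted codeword when \<open>l\<close> is missing from the codebook.\<close>

lemma unselected_coord_fresh:
  fixes P :: "'a pmf" and XX :: "(nat \<times> nat \<Rightarrow> 'b) pmf"
  assumes "finite Lc" "l \<in> Lc"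
  shows "\<exists>E. \<forall>F. (\<integral>\<^sup>+U. \<integral>\<^sup>+X. (if l \<noteq> coord Lc Lp T m U X then F (U l) (send Lc Lp T m U X) else 0)
        \<partial>measure_pmf XX \<partial>measure_pmf (Pi_pmf Lc d (\<lambda>_. P)))
      \<le> (\<integral>\<^sup>+v. \<integral>\<^sup>+s. F v s \<partial>measure_pmf E \<partial>measure_pmf P)"
proof -
  define E where "E = bind_pmf (Pi_pmf (Lc - {l}) d (\<lambda>_. P)) (\<lambda>U. map_pmf (send (Lc - {l}) Lp T m U) XX)"
  have "(\<integral>\<^sup>+U. \<integral>\<^sup>+X. (if l \<noteq> coord Lc Lp T m U X then F (U l) (send Lc Lp T m U X) else 0)
        \<partial>measure_pmf XX \<partial>measure_pmf (Pi_pmf Lc d (\<lambda>_. P)))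
      \<le> (\<integral>\<^sup>+v. \<integral>\<^sup>+s. F v s \<partial>measure_pmf E \<partial>measure_pmf P)" for F
  proof -
    \<comment> \<open>When \<open>l\<close> is not selected, what is sent does not depend on the
      word at \<open>l\<close>, so \<open>v\<close> separates from the rest. Dropping the condition
      afterwards only enlarges the integral.\<close>
    have le: "(if l \<noteq> coord Lc Lp T m (U(l := v)) X then F ((U(l := v)) l) (send Lc Lp T m (U(l := v)) X) else 0)
      \<le> F v (send (Lc - {l}) Lp T m U X)" for U v X
    proof (cases "l = coord Lc Lp T m (U(l := v)) X")
      case False
      let ?x = "\<lambda>b. X (m, b)"
      have "select Lc Lp T (U(l := v)) ?x = select (Lc - {l}) Lp T (U(l := v)) ?x"
        using False select_remove_unselected[of l Lc Lp T "U(l := v)" ?x] by (simp add: coord_def)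
      also have "\<dots> = select (Lc - {l}) Lp T U ?x" by (rule select_cong) auto
      finally have "send Lc Lp T m (U(l := v)) X = send (Lc - {l}) Lp T m U X" by (simp add: send_def)
      then show ?thesis by simp
    qed simp
    show ?thesis
      unfolding nn_integral_Pi_pmf_remove[OF assms] E_def
      by (simp del: fun_upd_apply) (intro nn_integral_mono le)
  qed
  then show ?thesis by blast
qed

text \<open>The encoder reads only the row of its own message, so a word in another row can be drawn
  independently of what was selected and sent.\<close>

lemma other_message_fresh:
  fixes P' :: "'b pmf"
  assumes "finite D" "(m', lp) \<in> D" "m' \<noteq> m"
  shows "(\<integral>\<^sup>+X. F (X (m', lp)) (coord Lc Lp T m U X) (send Lc Lp T m U X) \<partial>measure_pmf (Pi_pmf D d (\<lambda>_. P'))) =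
    (\<integral>\<^sup>+w. \<integral>\<^sup>+X. F w (coord Lc Lp T m U X) (send Lc Lp T m U X) \<partial>measure_pmf (Pi_pmf (D - {(m', lp)}) d (\<lambda>_. P')) \<partial>measure_pmf P')"
proof -
  have "(\<lambda>b. (X((m', lp) := w)) (m, b)) = (\<lambda>b. X (m, b))" for X :: "nat \<times> nat \<Rightarrow> 'b" and w
    using assms by auto
  then have "coord Lc Lp T m U (X((m', lp) := w)) = coord Lc Lp T m U X"
    "send Lc Lp T m U (X((m', lp) := w)) = send Lc Lp T m U X" for X w
    using assms by (simp_all add: coord_def send_def)
  then show ?thesis unfolding nn_integral_Pi_pmf_remove[OF assms(1,2)] by simp
qed

text \<open>\<open>E\<close> is the joint law of the selected coordination word and the transmitted
  word. It is fixed before \<open>F\<close>, so the channel and the other sender can be put into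
  \<open>F\<close> later.\<close>

lemma wrong_message_right_coord:
  fixes P :: "'a pmf" and P' :: "'b pmf"
  assumes "finite D" "(m', lp) \<in> D" "m' \<noteq> m"
  shows "\<exists>E. \<forall>F. (\<integral>\<^sup>+U. \<integral>\<^sup>+X. F (U (coord Lc Lp T m U X)) (X (m', lp)) (send Lc Lp T m U X)
        \<partial>measure_pmf (Pi_pmf D d' (\<lambda>_. P')) \<partial>measure_pmf (Pi_pmf Lc d (\<lambda>_. P)))
      \<le> (\<integral>\<^sup>+w. \<integral>\<^sup>+e. F (fst e) w (snd e) \<partial>measure_pmf E \<partial>measure_pmf P')"
proof -
  define E where "E = bind_pmf (Pi_pmf Lc d (\<lambda>_. P)) (\<lambda>U. map_pmf (\<lambda>X. (U (coord Lc Lp T m U X), send Lc Lp T m U X))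
     (Pi_pmf (D - {(m', lp)}) d' (\<lambda>_. P')))"
  have "(\<integral>\<^sup>+U. \<integral>\<^sup>+X. F (U (coord Lc Lp T m U X)) (X (m', lp)) (send Lc Lp T m U X)
        \<partial>measure_pmf (Pi_pmf D d' (\<lambda>_. P')) \<partial>measure_pmf (Pi_pmf Lc d (\<lambda>_. P)))
      \<le> (\<integral>\<^sup>+w. \<integral>\<^sup>+e. F (fst e) w (snd e) \<partial>measure_pmf E \<partial>measure_pmf P')" for F
  proof -
    have "(\<integral>\<^sup>+U. \<integral>\<^sup>+X. F (U (coord Lc Lp T m U X)) (X (m', lp)) (send Lc Lp T m U X)
        \<partial>measure_pmf (Pi_pmf D d' (\<lambda>_. P')) \<partial>measure_pmf (Pi_pmf Lc d (\<lambda>_. P)))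
      = (\<integral>\<^sup>+U. \<integral>\<^sup>+w. \<integral>\<^sup>+X. F (U (coord Lc Lp T m U X)) w (send Lc Lp T m U X)
        \<partial>measure_pmf (Pi_pmf (D - {(m', lp)}) d' (\<lambda>_. P')) \<partial>measure_pmf P' \<partial>measure_pmf (Pi_pmf Lc d (\<lambda>_. P)))"
      by (intro nn_integral_cong other_message_fresh[OF assms, where F="\<lambda>x c s. F (U c) x s" for U])
    also have "\<dots> = (\<integral>\<^sup>+w. \<integral>\<^sup>+U. \<integral>\<^sup>+X. F (U (coord Lc Lp T m U X)) w (send Lc Lp T m U X)
        \<partial>measure_pmf (Pi_pmf (D - {(m', lp)}) d' (\<lambda>_. P')) \<partial>measure_pmf (Pi_pmf Lc d (\<lambda>_. P)) \<partial>measure_pmf P')"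
      by (rule nn_integral_pmf_swap)
    also have "\<dots> = (\<integral>\<^sup>+w. \<integral>\<^sup>+e. F (fst e) w (snd e) \<partial>measure_pmf E \<partial>measure_pmf P')"
      by (simp add: E_def)
    finally show ?thesis by simp
  qed
  then show ?thesis by blast
qed

text \<open>Two removals in a row: first the word of the wrong message leaves the transmission
  codebook, then the unselected word leaves the coordination codebook.\<close>

lemma wrong_message_wrong_coord:
  fixes P :: "'a pmf" and P' :: "'b pmf"
  assumes "finite D" "(m', lp) \<in> D" "m' \<noteq> m" "finite Lc" "l \<in> Lc"
  shows "\<exists>E. \<forall>F. (\<integral>\<^sup>+U. \<integral>\<^sup>+X. (if l \<noteq> coord Lc Lp T m U X then F (U l) (X (m', lp)) (send Lc Lp T m U X) else 0)
        \<partial>measure_pmf (Pi_pmf D d' (\<lambda>_. P')) \<partial>measure_pmf (Pi_pmf Lc d (\<lambda>_. P)))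
      \<le> (\<integral>\<^sup>+w. \<integral>\<^sup>+v. \<integral>\<^sup>+s. F v w s \<partial>measure_pmf E \<partial>measure_pmf P \<partial>measure_pmf P')"
proof -
  obtain E where E: "\<And>F. (\<integral>\<^sup>+U. \<integral>\<^sup>+X. (if l \<noteq> coord Lc Lp T m U X then F (U l) (send Lc Lp T m U X) else 0)
        \<partial>measure_pmf (Pi_pmf (D - {(m', lp)}) d' (\<lambda>_. P')) \<partial>measure_pmf (Pi_pmf Lc d (\<lambda>_. P)))
      \<le> (\<integral>\<^sup>+v. \<integral>\<^sup>+s. F v s \<partial>measure_pmf E \<partial>measure_pmf P)"
    using unselected_coord_fresh[OF assms(4,5), where XX="Pi_pmf (D - {(m', lp)}) d' (\<lambda>_. P')" and P=P] by blast
  have "(\<integral>\<^sup>+U. \<integral>\<^sup>+X. (if l \<noteq> coord Lc Lp T m U X then F (U l) (X (m', lp)) (send Lc Lp T m U X) else 0)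
        \<partial>measure_pmf (Pi_pmf D d' (\<lambda>_. P')) \<partial>measure_pmf (Pi_pmf Lc d (\<lambda>_. P)))
      \<le> (\<integral>\<^sup>+w. \<integral>\<^sup>+v. \<integral>\<^sup>+s. F v w s \<partial>measure_pmf E \<partial>measure_pmf P \<partial>measure_pmf P')" for F
  proof -
    have "(\<integral>\<^sup>+U. \<integral>\<^sup>+X. (if l \<noteq> coord Lc Lp T m U X then F (U l) (X (m', lp)) (send Lc Lp T m U X) else 0)
        \<partial>measure_pmf (Pi_pmf D d' (\<lambda>_. P')) \<partial>measure_pmf (Pi_pmf Lc d (\<lambda>_. P)))
      = (\<integral>\<^sup>+U. \<integral>\<^sup>+w. \<integral>\<^sup>+X. (if l \<noteq> coord Lc Lp T m U X then F (U l) w (send Lc Lp T m U X) else 0)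
        \<partial>measure_pmf (Pi_pmf (D - {(m', lp)}) d' (\<lambda>_. P')) \<partial>measure_pmf P' \<partial>measure_pmf (Pi_pmf Lc d (\<lambda>_. P)))"
      by (intro nn_integral_cong other_message_fresh[OF assms(1-3), where F="\<lambda>x c s. if l \<noteq> c then F (U l) x s else 0" for U])
    also have "\<dots> = (\<integral>\<^sup>+w. \<integral>\<^sup>+U. \<integral>\<^sup>+X. (if l \<noteq> coord Lc Lp T m U X then F (U l) w (send Lc Lp T m U X) else 0)
        \<partial>measure_pmf (Pi_pmf (D - {(m', lp)}) d' (\<lambda>_. P')) \<partial>measure_pmf (Pi_pmf Lc d (\<lambda>_. P)) \<partial>measure_pmf P')"
      by (rule nn_integral_pmf_swap)
    also have "\<dots> \<le> (\<integral>\<^sup>+w. \<integral>\<^sup>+v. \<integral>\<^sup>+s. F v w s \<partial>measure_pmf E \<partial>measure_pmf P \<partial>measure_pmf P')"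
      by (intro nn_integral_mono E)
    finally show ?thesis .
  qed
  then show ?thesis by blast
qed

text \<open>The selected pair is one of the pairs that satisfy \<open>T\<close>, so its contribution
  is at most the sum over all of them, and each of these is an independently drawn pair. The number
  of candidates is the density factor.\<close>

lemma selected_pair_le:
  fixes P :: "'a pmf" and P' :: "'b pmf"
  assumes "finite D" "{m} \<times> Lp \<subseteq> D" "finite Lc" "finite Lp"
  shows "(\<integral>\<^sup>+U. \<integral>\<^sup>+X. (if covered Lc Lp T U (\<lambda>b. X (m, b)) then F (U (coord Lc Lp T m U X)) (send Lc Lp T m U X) else 0)
        \<partial>measure_pmf (Pi_pmf D d' (\<lambda>_. P')) \<partial>measure_pmf (Pi_pmf Lc d (\<lambda>_. P)))
      \<le> of_nat (card Lc * card Lp) * (\<integral>\<^sup>+u. \<integral>\<^sup>+x. (if T u x then F u x else 0) \<partial>measure_pmf P' \<partial>measure_pmf P)"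
proof -
  have le: "(if covered Lc Lp T U (\<lambda>b. X (m, b)) then F (U (coord Lc Lp T m U X)) (send Lc Lp T m U X) else 0)
    \<le> (\<Sum>(a,b)\<in>Lc \<times> Lp. if T (U a) (X (m, b)) then F (U a) (X (m, b)) else 0)" for U X
  proof (cases "covered Lc Lp T U (\<lambda>b. X (m, b))")
    case True
    note s = select_covered[OF True]
    show ?thesis using True s assms
      by (auto simp: coord_def send_def intro!: order.trans[OF _ member_le_sum[of "select Lc Lp T U (\<lambda>b. X (m, b))"]] simp: case_prod_unfold mem_Times_iff)
  qed simp
  have "(\<integral>\<^sup>+U. \<integral>\<^sup>+X. (if covered Lc Lp T U (\<lambda>b. X (m, b)) then F (U (coord Lc Lp T m U X)) (send Lc Lp T m U X) else 0)
        \<partial>measure_pmf (Pi_pmf D d' (\<lambda>_. P')) \<partial>measure_pmf (Pi_pmf Lc d (\<lambda>_. P)))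
     \<le> (\<integral>\<^sup>+U. \<integral>\<^sup>+X. (\<Sum>(a,b)\<in>Lc \<times> Lp. if T (U a) (X (m, b)) then F (U a) (X (m, b)) else 0)
        \<partial>measure_pmf (Pi_pmf D d' (\<lambda>_. P')) \<partial>measure_pmf (Pi_pmf Lc d (\<lambda>_. P)))"
    by (intro nn_integral_mono le)
  also have "\<dots> = (\<Sum>z\<in>Lc \<times> Lp. \<integral>\<^sup>+U. \<integral>\<^sup>+X. (if T (U (fst z)) (X (m, snd z)) then F (U (fst z)) (X (m, snd z)) else 0)
        \<partial>measure_pmf (Pi_pmf D d' (\<lambda>_. P')) \<partial>measure_pmf (Pi_pmf Lc d (\<lambda>_. P)))"
    by (simp add: nn_integral_sum case_prod_unfold)
  also have "\<dots> = (\<Sum>z\<in>Lc \<times> Lp. \<integral>\<^sup>+u. \<integral>\<^sup>+x. (if T u x then F u x else 0) \<partial>measure_pmf P' \<partial>measure_pmf P)"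
  proof (rule sum.cong[OF refl])
    fix z assume z: "z \<in> Lc \<times> Lp"
    have mz: "(m, snd z) \<in> D" "fst z \<in> Lc" using z assms by auto
    show "(\<integral>\<^sup>+U. \<integral>\<^sup>+X. (if T (U (fst z)) (X (m, snd z)) then F (U (fst z)) (X (m, snd z)) else 0)
        \<partial>measure_pmf (Pi_pmf D d' (\<lambda>_. P')) \<partial>measure_pmf (Pi_pmf Lc d (\<lambda>_. P)))
      = (\<integral>\<^sup>+u. \<integral>\<^sup>+x. (if T u x then F u x else 0) \<partial>measure_pmf P' \<partial>measure_pmf P)"
      using nn_integral_Pi_pmf_component[OF assms(1) mz(1), where F="\<lambda>x. if T u x then F u x else 0" and d=d' and p="\<lambda>_. P'" for u]
        nn_integral_Pi_pmf_component[OF assms(3) mz(2), where F="\<lambda>u. \<integral>\<^sup>+x. (if T u x then F u x else 0) \<partial>measure_pmf P'" and d=d and p="\<lambda>_. P"]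
      by simp
  qed
  also have "\<dots> = of_nat (card Lc * card Lp) * (\<integral>\<^sup>+u. \<integral>\<^sup>+x. (if T u x then F u x else 0) \<partial>measure_pmf P' \<partial>measure_pmf P)"
    by (simp add: card_cartesian_product)
  finally show ?thesis .
qed

section \<open>A union bound over wrong messages for arbitrary word laws and channels\<close>

section \<open>One-shot packing\<close>

lemma nn_integral_fresh_le:
  assumes "\<And>z. (\<integral>\<^sup>+r. f r z \<partial>measure_pmf M) \<le> b"
  shows "(\<integral>\<^sup>+r. \<integral>\<^sup>+z. f r z \<partial>measure_pmf N \<partial>measure_pmf M) \<le> b"
  by (subst nn_integral_pmf_swap) (intro nn_integral_pmf_le_const assms)

lemma nn_integral_if_const:
  "(\<integral>\<^sup>+y. (if c then f y else 0) \<partial>M) = (if c then (\<integral>\<^sup>+y. f y \<partial>M) else 0)"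
  by simp

text \<open>The hypotheses bound, uniformly in all that is already fixed, the chance that fresh
  words pass the test. A wrong message makes \<open>x\<close> fresh, an index other than the
  selected one makes \<open>u\<close> or \<open>v\<close> fresh. Success of the encoders is not
  assumed.\<close>

lemma packing_bound:
  fixes P :: "'a pmf" and P' :: "'b pmf" and R :: "'c pmf" and ZZ :: "(nat \<times> nat \<Rightarrow> 'd) pmf"
    and Y :: "'b \<Rightarrow> 'd \<Rightarrow> 'y pmf" and \<tau> :: "'a \<Rightarrow> 'b \<Rightarrow> 'c \<Rightarrow> 'y \<Rightarrow> bool"
  assumes fin: "finite Lc" "finite Lp" "finite Mx" "finite Lc'" and ne: "Lc \<noteq> {}" "Lc' \<noteq> {}"
  defines "t \<equiv> \<lambda>u x v y. (if \<tau> u x v y then 1 else 0 :: ennreal)"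
  assumes bA: "\<And>u v y. (\<integral>\<^sup>+x. t u x v y \<partial>measure_pmf P') \<le> bA"
    and bB: "\<And>v y. (\<integral>\<^sup>+x. \<integral>\<^sup>+u. t u x v y \<partial>measure_pmf P \<partial>measure_pmf P') \<le> bB"
    and bC: "\<And>u y. (\<integral>\<^sup>+x. \<integral>\<^sup>+v. t u x v y \<partial>measure_pmf R \<partial>measure_pmf P') \<le> bC"
    and bD: "\<And>y. (\<integral>\<^sup>+x. \<integral>\<^sup>+u. \<integral>\<^sup>+v. t u x v y \<partial>measure_pmf R \<partial>measure_pmf P \<partial>measure_pmf P') \<le> bD"
  shows "(\<integral>\<^sup>+U. \<integral>\<^sup>+X. \<integral>\<^sup>+V. \<integral>\<^sup>+Z. \<integral>\<^sup>+y.
      (if \<exists>m'\<in>Mx - {m}. \<exists>lc\<in>Lc. \<exists>lp\<in>Lp. \<exists>lc'\<in>Lc'. \<tau> (U lc) (X (m', lp)) (V lc') y then 1 else 0)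
      \<partial>measure_pmf (Y (send Lc Lp T m U X) (send Lc' Lp' T' m2 V Z))
      \<partial>measure_pmf ZZ \<partial>measure_pmf (Pi_pmf Lc' d'' (\<lambda>_. R))
      \<partial>measure_pmf (Pi_pmf (Mx \<times> Lp) d' (\<lambda>_. P')) \<partial>measure_pmf (Pi_pmf Lc d (\<lambda>_. P)))
    \<le> of_nat (card Mx * card Lp) *
      (bA + of_nat (card Lc) * bB + of_nat (card Lc') * bC + of_nat (card Lc * card Lc') * bD)"
proof -
  define PU where "PU = Pi_pmf Lc d (\<lambda>_. P)"
  define PX where "PX = Pi_pmf (Mx \<times> Lp) d' (\<lambda>_. P')"
  define PV where "PV = Pi_pmf Lc' d'' (\<lambda>_. R)"
  define L where "L = coord Lc Lp T m"
  define L' where "L' = coord Lc' Lp' T' m2"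
  define s1 where "s1 = send Lc Lp T m"
  define s2 where "s2 = send Lc' Lp' T' m2"
  \<comment> \<open>The nested integral \<open>I\<close> is a single integral over this law, from
    which additivity follows at once.\<close>
  define \<Omega> where "\<Omega> = bind_pmf PU (\<lambda>U. bind_pmf PX (\<lambda>X. bind_pmf PV (\<lambda>V. bind_pmf ZZ (\<lambda>Z.
     map_pmf (\<lambda>y. (U, X, V, Z, y)) (Y (s1 U X) (s2 V Z))))))"
  define I where "I G = (\<integral>\<^sup>+U. \<integral>\<^sup>+X. \<integral>\<^sup>+V. \<integral>\<^sup>+Z. \<integral>\<^sup>+y. G U X V Z y
      \<partial>measure_pmf (Y (s1 U X) (s2 V Z)) \<partial>measure_pmf ZZ \<partial>measure_pmf PV \<partial>measure_pmf PX \<partial>measure_pmf PU)" for G :: "_ \<Rightarrow> _ \<Rightarrow> _ \<Rightarrow> _ \<Rightarrow> _ \<Rightarrow> ennreal"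
  have I\<Omega>: "I G = (\<integral>\<^sup>+w. (case w of (U, X, V, Z, y) \<Rightarrow> G U X V Z y) \<partial>measure_pmf \<Omega>)" for G
    by (simp add: I_def \<Omega>_def)
  have Iadd: "I (\<lambda>U X V Z y. G U X V Z y + G' U X V Z y) = I G + I G'" for G G'
    unfolding I\<Omega> by (subst nn_integral_add[symmetric]) (auto simp: case_prod_unfold)
  have Isum: "I (\<lambda>U X V Z y. \<Sum>z\<in>A. G z U X V Z y) = (\<Sum>z\<in>A. I (G z))" for A and G :: "'z \<Rightarrow> _"
    unfolding I\<Omega> by (subst nn_integral_sum[symmetric]) (auto simp: case_prod_unfold)
  have Imono: "I G \<le> I G'" if "\<And>U X V Z y. G U X V Z y \<le> G' U X V Z y" for G G'
    unfolding I_def by (intro nn_integral_mono that)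
  \<comment> \<open>A passing tuple falls under exactly one of four cases, according to which
    coordination indices are the selected ones. Where an index is the selected one, no sum over it
    remains.\<close>
  define tA where "tA z U X V Z y = t (U (L U X)) (X z) (V (L' V Z)) y" for z U X V Z y
  define tB where "tB z lc U X V Z y = (if lc \<noteq> L U X then t (U lc) (X z) (V (L' V Z)) y else 0)" for z lc U X V Z y
  define tC where "tC z lc' U X V Z y = (if lc' \<noteq> L' V Z then t (U (L U X)) (X z) (V lc') y else 0)" for z lc' U X V Z y
  define tD where "tD z lc lc' U X V Z y = (if lc \<noteq> L U X \<and> lc' \<noteq> L' V Z then t (U lc) (X z) (V lc') y else 0)" for z lc lc' U X V Z y
  let ?tot = "\<lambda>z U X V Z y. tA z U X V Z y + (\<Sum>lc\<in>Lc. tB z lc U X V Z y) + (\<Sum>lc'\<in>Lc'. tC z lc' U X V Z y)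
     + (\<Sum>lc\<in>Lc. \<Sum>lc'\<in>Lc'. tD z lc lc' U X V Z y)"
  let ?S = "(Mx - {m}) \<times> Lp"
  have point: "(if \<exists>m'\<in>Mx - {m}. \<exists>lc\<in>Lc. \<exists>lp\<in>Lp. \<exists>lc'\<in>Lc'. \<tau> (U lc) (X (m', lp)) (V lc') y then 1 else 0)
    \<le> (\<Sum>z\<in>?S. ?tot z U X V Z y)" for U X V Z y
  proof (cases "\<exists>m'\<in>Mx - {m}. \<exists>lc\<in>Lc. \<exists>lp\<in>Lp. \<exists>lc'\<in>Lc'. \<tau> (U lc) (X (m', lp)) (V lc') y")
    case True
    then obtain m' lc lp lc' where w: "m' \<in> Mx - {m}" "lc \<in> Lc" "lp \<in> Lp" "lc' \<in> Lc'"
      and tt: "\<tau> (U lc) (X (m', lp)) (V lc') y" by blast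
    define z where "z = (m', lp)"
    have zS: "z \<in> ?S" using w by (simp add: z_def)
    have t1: "t (U lc) (X z) (V lc') y = 1" using tt by (simp add: t_def z_def)
    have "1 \<le> ?tot z U X V Z y"
    proof -
      have B: "tB z lc U X V Z y \<le> (\<Sum>lc\<in>Lc. tB z lc U X V Z y)"
        by (rule member_le_sum) (use w fin in auto)
      have C: "tC z lc' U X V Z y \<le> (\<Sum>lc'\<in>Lc'. tC z lc' U X V Z y)"
        by (rule member_le_sum) (use w fin in auto)
      have "tD z lc lc' U X V Z y \<le> (\<Sum>lc'\<in>Lc'. tD z lc lc' U X V Z y)"
        by (rule member_le_sum) (use w fin in auto)
      also have "\<dots> \<le> (\<Sum>lc\<in>Lc. \<Sum>lc'\<in>Lc'. tD z lc lc' U X V Z y)"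
        by (rule member_le_sum[where f="\<lambda>lc. \<Sum>lc'\<in>Lc'. tD z lc lc' U X V Z y"]) (use w fin in auto)
      finally have D: "tD z lc lc' U X V Z y \<le> \<dots>" .
      have "1 \<le> tA z U X V Z y + tB z lc U X V Z y + tC z lc' U X V Z y + tD z lc lc' U X V Z y"
        using t1 by (auto simp: tA_def tB_def tC_def tD_def add_increasing add_increasing2)
      also have "\<dots> \<le> ?tot z U X V Z y"
        by (intro add_mono B C D order_refl)
      finally show ?thesis .
    qed
    also have "\<dots> \<le> (\<Sum>z\<in>?S. ?tot z U X V Z y)"
      by (rule member_le_sum[where f="\<lambda>z. ?tot z U X V Z y"]) (use zS fin in auto)
    finally show ?thesis using True by simp
  qed simp
  have bounds: "I (tA z) \<le> bA" "I (tB z lc) \<le> bB" "I (tC z lc') \<le> bC" "I (tD z lc lc') \<le> bD"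
    if z: "z \<in> ?S" and lc: "lc \<in> Lc" and lc': "lc' \<in> Lc'" for z lc lc'
  proof -
    obtain m' lp where z': "z = (m', lp)" by (cases z)
    have mz: "finite (Mx \<times> Lp)" "(m', lp) \<in> Mx \<times> Lp" "m' \<noteq> m" using z fin by (auto simp: z')
    obtain E where E: "\<And>F. (\<integral>\<^sup>+U. \<integral>\<^sup>+X. F (U (L U X)) (X z) (s1 U X) \<partial>measure_pmf PX \<partial>measure_pmf PU)
       \<le> (\<integral>\<^sup>+w. \<integral>\<^sup>+e. F (fst e) w (snd e) \<partial>measure_pmf E \<partial>measure_pmf P')"
      unfolding L_def s1_def PX_def PU_def z'
      using wrong_message_right_coord[OF mz, where d'=d' and P'=P' and P=P] by blast
    obtain E' where E': "\<And>F. (\<integral>\<^sup>+U. \<integral>\<^sup>+X. (if lc \<noteq> L U X then F (U lc) (X z) (s1 U X) else 0) \<partial>measure_pmf PX \<partial>measure_pmf PU)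
       \<le> (\<integral>\<^sup>+w. \<integral>\<^sup>+v. \<integral>\<^sup>+s. F v w s \<partial>measure_pmf E' \<partial>measure_pmf P \<partial>measure_pmf P')"
      unfolding L_def s1_def PX_def PU_def z'
      using wrong_message_wrong_coord[OF mz fin(1) lc, where d'=d' and P'=P' and P=P] by blast
    obtain E2 where E2: "\<And>F. (\<integral>\<^sup>+V. \<integral>\<^sup>+Z. (if lc' \<noteq> L' V Z then F (V lc') (s2 V Z) else 0) \<partial>measure_pmf ZZ \<partial>measure_pmf PV)
       \<le> (\<integral>\<^sup>+v. \<integral>\<^sup>+s. F v s \<partial>measure_pmf E2 \<partial>measure_pmf R)"
      unfolding L'_def s2_def PV_def
      using unselected_coord_fresh[OF fin(4) lc', where XX=ZZ and P=R] by blast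
    have inner: "(\<integral>\<^sup>+V. \<integral>\<^sup>+Z. \<integral>\<^sup>+y. (if lc' \<noteq> L' V Z then t u x (V lc') y else 0)
        \<partial>measure_pmf (Y s (s2 V Z)) \<partial>measure_pmf ZZ \<partial>measure_pmf PV)
      \<le> (\<integral>\<^sup>+v. \<integral>\<^sup>+s'. \<integral>\<^sup>+y. t u x v y \<partial>measure_pmf (Y s s') \<partial>measure_pmf E2 \<partial>measure_pmf R)" for u x s
      unfolding nn_integral_if_const by (rule E2[of "\<lambda>v s'. \<integral>\<^sup>+y. t u x v y \<partial>measure_pmf (Y s s')"])
    show "I (tA z) \<le> bA"
    proof -
      \<comment> \<open>The joint law of everything in the test that is independent of the fresh
        word; the three parts below use the same device.\<close>
      define old where "old = bind_pmf E (\<lambda>e. bind_pmf PV (\<lambda>V. bind_pmf ZZ (\<lambda>Z. map_pmf (\<lambda>y. (fst e, V (L' V Z), y)) (Y (snd e) (s2 V Z)))))"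
      have "I (tA z) \<le> (\<integral>\<^sup>+x. \<integral>\<^sup>+e. \<integral>\<^sup>+V. \<integral>\<^sup>+Z. \<integral>\<^sup>+y. t (fst e) x (V (L' V Z)) y
        \<partial>measure_pmf (Y (snd e) (s2 V Z)) \<partial>measure_pmf ZZ \<partial>measure_pmf PV \<partial>measure_pmf E \<partial>measure_pmf P')"
        unfolding I_def tA_def
        by (rule E[of "\<lambda>u x s. \<integral>\<^sup>+V. \<integral>\<^sup>+Z. \<integral>\<^sup>+y. t u x (V (L' V Z)) y \<partial>measure_pmf (Y s (s2 V Z)) \<partial>measure_pmf ZZ \<partial>measure_pmf PV"])
      also have "\<dots> = (\<integral>\<^sup>+x. \<integral>\<^sup>+z. t (fst z) x (fst (snd z)) (snd (snd z)) \<partial>measure_pmf old \<partial>measure_pmf P')"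
        by (simp add: old_def)
      also have "\<dots> \<le> bA" by (intro nn_integral_fresh_le bA)
      finally show ?thesis .
    qed
    show "I (tB z lc) \<le> bB"
    proof -
      define old where "old = bind_pmf E' (\<lambda>s. bind_pmf PV (\<lambda>V. bind_pmf ZZ (\<lambda>Z. map_pmf (\<lambda>y. (V (L' V Z), y)) (Y s (s2 V Z)))))"
      have "I (tB z lc) \<le> (\<integral>\<^sup>+x. \<integral>\<^sup>+u. \<integral>\<^sup>+s. \<integral>\<^sup>+V. \<integral>\<^sup>+Z. \<integral>\<^sup>+y. t u x (V (L' V Z)) y
        \<partial>measure_pmf (Y s (s2 V Z)) \<partial>measure_pmf ZZ \<partial>measure_pmf PV \<partial>measure_pmf E' \<partial>measure_pmf P \<partial>measure_pmf P')"
        unfolding I_def tB_def nn_integral_if_const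
        by (rule E'[of "\<lambda>u x s. \<integral>\<^sup>+V. \<integral>\<^sup>+Z. \<integral>\<^sup>+y. t u x (V (L' V Z)) y \<partial>measure_pmf (Y s (s2 V Z)) \<partial>measure_pmf ZZ \<partial>measure_pmf PV"])
      also have "\<dots> = (\<integral>\<^sup>+r. \<integral>\<^sup>+z. t (snd r) (fst r) (fst z) (snd z) \<partial>measure_pmf old \<partial>measure_pmf (pair_pmf P' P))"
        by (simp add: old_def nn_integral_pair_pmf')
      also have "\<dots> \<le> bB" by (intro nn_integral_fresh_le) (simp add: nn_integral_pair_pmf' bB)
      finally show ?thesis .
    qed
    show "I (tC z lc') \<le> bC"
    proof -
      define old where "old = bind_pmf E (\<lambda>e. bind_pmf E2 (\<lambda>s'. map_pmf (\<lambda>y. (fst e, y)) (Y (snd e) s')))"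
      have "I (tC z lc') \<le> (\<integral>\<^sup>+U. \<integral>\<^sup>+X. \<integral>\<^sup>+v. \<integral>\<^sup>+s'. \<integral>\<^sup>+y. t (U (L U X)) (X z) v y
         \<partial>measure_pmf (Y (s1 U X) s') \<partial>measure_pmf E2 \<partial>measure_pmf R \<partial>measure_pmf PX \<partial>measure_pmf PU)"
        unfolding I_def tC_def by (intro nn_integral_mono inner)
      also have "\<dots> \<le> (\<integral>\<^sup>+x. \<integral>\<^sup>+e. \<integral>\<^sup>+v. \<integral>\<^sup>+s'. \<integral>\<^sup>+y. t (fst e) x v y
         \<partial>measure_pmf (Y (snd e) s') \<partial>measure_pmf E2 \<partial>measure_pmf R \<partial>measure_pmf E \<partial>measure_pmf P')"
        by (rule E[of "\<lambda>u x s. \<integral>\<^sup>+v. \<integral>\<^sup>+s'. \<integral>\<^sup>+y. t u x v y \<partial>measure_pmf (Y s s') \<partial>measure_pmf E2 \<partial>measure_pmf R"])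
      \<comment> \<open>The fresh \<open>v\<close> is moved next to the fresh \<open>x\<close>,
        ahead of the own selected words, so that the two can be treated as one fresh draw.\<close>
      also have "\<dots> = (\<integral>\<^sup>+x. \<integral>\<^sup>+v. \<integral>\<^sup>+e. \<integral>\<^sup>+s'. \<integral>\<^sup>+y. t (fst e) x v y
         \<partial>measure_pmf (Y (snd e) s') \<partial>measure_pmf E2 \<partial>measure_pmf E \<partial>measure_pmf R \<partial>measure_pmf P')"
        by (intro nn_integral_cong nn_integral_pmf_swap)
      also have "\<dots> = (\<integral>\<^sup>+r. \<integral>\<^sup>+z. t (fst z) (fst r) (snd r) (snd z) \<partial>measure_pmf old \<partial>measure_pmf (pair_pmf P' R))"
        by (simp add: old_def nn_integral_pair_pmf')
      also have "\<dots> \<le> bC" by (intro nn_integral_fresh_le) (simp add: nn_integral_pair_pmf' bC)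
      finally show ?thesis .
    qed
    show "I (tD z lc lc') \<le> bD"
    proof -
      define old where "old = bind_pmf E' (\<lambda>s. bind_pmf E2 (\<lambda>s'. Y s s'))"
      have "I (tD z lc lc') \<le> (\<integral>\<^sup>+U. \<integral>\<^sup>+X. (if lc \<noteq> L U X then \<integral>\<^sup>+v. \<integral>\<^sup>+s'. \<integral>\<^sup>+y. t (U lc) (X z) v y
         \<partial>measure_pmf (Y (s1 U X) s') \<partial>measure_pmf E2 \<partial>measure_pmf R else 0) \<partial>measure_pmf PX \<partial>measure_pmf PU)"
        unfolding I_def
      proof (intro nn_integral_mono)
        fix U X
        show "(\<integral>\<^sup>+V. \<integral>\<^sup>+Z. \<integral>\<^sup>+y. tD z lc lc' U X V Z y
            \<partial>measure_pmf (Y (s1 U X) (s2 V Z)) \<partial>measure_pmf ZZ \<partial>measure_pmf PV)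
          \<le> (if lc \<noteq> L U X then \<integral>\<^sup>+v. \<integral>\<^sup>+s'. \<integral>\<^sup>+y. t (U lc) (X z) v y
         \<partial>measure_pmf (Y (s1 U X) s') \<partial>measure_pmf E2 \<partial>measure_pmf R else 0)"
        proof (cases "lc = L U X")
          case False
          then have "tD z lc lc' U X V Z y = (if lc' \<noteq> L' V Z then t (U lc) (X z) (V lc') y else 0)" for V Z y
            by (simp add: tD_def)
          then show ?thesis using False by (simp only: simp_thms if_True) (rule inner)
        qed (simp add: tD_def)
      qed
      also have "\<dots> \<le> (\<integral>\<^sup>+x. \<integral>\<^sup>+u. \<integral>\<^sup>+s. \<integral>\<^sup>+v. \<integral>\<^sup>+s'. \<integral>\<^sup>+y. t u x v y
         \<partial>measure_pmf (Y s s') \<partial>measure_pmf E2 \<partial>measure_pmf R \<partial>measure_pmf E' \<partial>measure_pmf P \<partial>measure_pmf P')"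
        by (rule E'[of "\<lambda>u x s. \<integral>\<^sup>+v. \<integral>\<^sup>+s'. \<integral>\<^sup>+y. t u x v y \<partial>measure_pmf (Y s s') \<partial>measure_pmf E2 \<partial>measure_pmf R"])
      also have "\<dots> = (\<integral>\<^sup>+x. \<integral>\<^sup>+u. \<integral>\<^sup>+v. \<integral>\<^sup>+s. \<integral>\<^sup>+s'. \<integral>\<^sup>+y. t u x v y
         \<partial>measure_pmf (Y s s') \<partial>measure_pmf E2 \<partial>measure_pmf E' \<partial>measure_pmf R \<partial>measure_pmf P \<partial>measure_pmf P')"
        by (intro nn_integral_cong nn_integral_pmf_swap)
      also have "\<dots> = (\<integral>\<^sup>+r. \<integral>\<^sup>+y. t (fst (snd r)) (fst r) (snd (snd r)) y \<partial>measure_pmf old \<partial>measure_pmf (pair_pmf P' (pair_pmf P R)))"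
        by (simp add: old_def nn_integral_pair_pmf')
      also have "\<dots> \<le> bD" by (intro nn_integral_fresh_le) (simp add: nn_integral_pair_pmf' bD)
      finally show ?thesis .
    qed
  qed
  let ?b = "bA + of_nat (card Lc) * bB + of_nat (card Lc') * bC + of_nat (card Lc * card Lc') * bD"
  have "I (\<lambda>U X V Z y. if \<exists>m'\<in>Mx - {m}. \<exists>lc\<in>Lc. \<exists>lp\<in>Lp. \<exists>lc'\<in>Lc'. \<tau> (U lc) (X (m', lp)) (V lc') y then 1 else 0)
    \<le> I (\<lambda>U X V Z y. \<Sum>z\<in>?S. ?tot z U X V Z y)" by (rule Imono) (rule point)
  also have "\<dots> = (\<Sum>z\<in>?S. I (tA z) + (\<Sum>lc\<in>Lc. I (tB z lc)) + (\<Sum>lc'\<in>Lc'. I (tC z lc')) + (\<Sum>lc\<in>Lc. \<Sum>lc'\<in>Lc'. I (tD z lc lc')))"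
    by (simp only: Isum Iadd)
  also have "\<dots> \<le> (\<Sum>z\<in>?S. ?b)"
  proof (rule sum_mono)
      fix z assume z: "z \<in> ?S"
      obtain l l' where l: "l \<in> Lc" "l' \<in> Lc'" using ne by auto
      have "(\<Sum>lc\<in>Lc. I (tB z lc)) \<le> (\<Sum>lc\<in>Lc. bB)" by (intro sum_mono bounds(2)[OF z _ l(2)])
      moreover have "(\<Sum>lc'\<in>Lc'. I (tC z lc')) \<le> (\<Sum>lc'\<in>Lc'. bC)" by (intro sum_mono bounds(3)[OF z l(1)])
      moreover have "(\<Sum>lc\<in>Lc. \<Sum>lc'\<in>Lc'. I (tD z lc lc')) \<le> (\<Sum>lc\<in>Lc. \<Sum>lc'\<in>Lc'. bD)" by (intro sum_mono bounds(4)[OF z])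
      moreover have "I (tA z) \<le> bA" by (rule bounds(1)[OF z l])
      ultimately show "I (tA z) + (\<Sum>lc\<in>Lc. I (tB z lc)) + (\<Sum>lc'\<in>Lc'. I (tC z lc')) + (\<Sum>lc\<in>Lc. \<Sum>lc'\<in>Lc'. I (tD z lc lc')) \<le> ?b"
        by (auto intro!: add_mono simp: mult.assoc)
  qed
  also have "\<dots> = of_nat (card ?S) * ?b" by simp
  also have "\<dots> \<le> of_nat (card Mx * card Lp) * ?b"
    using fin by (intro mult_right_mono of_nat_mono) (auto simp: card_cartesian_product intro!: card_mono)
  finally show ?thesis unfolding I_def PU_def PX_def PV_def s1_def s2_def .
qed

section \<open>Exponents for packing, covering and the selected pair, given q\<close>

section \<open>Block-length n estimates\<close>

lemma typical_trim_pair [simp]: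
  "(\<lambda>i. (t i, trim n s i)) \<in> typical \<epsilon> n p \<longleftrightarrow> (\<lambda>i. (t i, s i)) \<in> typical \<epsilon> n p"
  "(\<lambda>i. (t i, r i, trim n s i)) \<in> typical \<epsilon> n p' \<longleftrightarrow> (\<lambda>i. (t i, r i, s i)) \<in> typical \<epsilon> n p'"
  by (rule typical_cong, simp add: trim_def)+

lemma nn_integral_seq_pair:
  "(\<integral>\<^sup>+s. F s \<partial>measure_pmf (seq_pmf n (\<lambda>i. pair_pmf (k i) (k' i)))) =
   (\<integral>\<^sup>+u. \<integral>\<^sup>+x. F (trim n (\<lambda>i. (u i, x i))) \<partial>measure_pmf (seq_pmf n k') \<partial>measure_pmf (seq_pmf n k))"
  by (simp add: seq_pmf_pair)

text \<open>The joint typicality lemma, valid for every \<open>t\<close>, typical or not: the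
  density bound is pointwise on the typical set, and the true conditional law on the right has total
  mass one.\<close>

lemma typical_prob_le:
  fixes p :: "('t::finite \<times> 'a::finite) pmf"
  assumes ac: "\<And>t a. (t, a) \<in> set_pmf p \<Longrightarrow> a \<in> set_pmf (k t)"
    and S: "log_spread p k \<le> S" and \<epsilon>: "0 \<le> \<epsilon>"
  shows "(\<integral>\<^sup>+s. (if (\<lambda>i. (t i, s i)) \<in> typical \<epsilon> n p then 1 else 0) \<partial>measure_pmf (seq_pmf n (\<lambda>i. k (t i)))) \<le>
      ennreal (2 powr (- (real n * (divergence_rate p k - \<epsilon> * S))))"
proof -
  obtain k' where "disintegrates p k'" using ex_disintegrates by blast
  from nn_integral_typical_le(1)[OF this ac, where F="\<lambda>_. 1"]
  have "(\<integral>\<^sup>+s. indicator (typical \<epsilon> n p) (\<lambda>i. (t i, s i)) \<partial>measure_pmf (seq_pmf n (\<lambda>i. k (t i)))) \<le>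
      ennreal (2 powr (- (real n * (divergence_rate p k - \<epsilon> * log_spread p k))))" by simp
  also have "\<dots> \<le> ennreal (2 powr (- (real n * (divergence_rate p k - \<epsilon> * S))))"
    using S \<epsilon> by (intro ennreal_leI powr_mono) (auto intro!: mult_left_mono)
  finally show ?thesis by (simp add: indicator_def of_bool_def)
qed

lemma nn_integral_if_mono:
  assumes "\<And>x. A x \<Longrightarrow> B x"
  shows "(\<integral>\<^sup>+x. (if A x then 1 else 0 :: ennreal) \<partial>M) \<le> (\<integral>\<^sup>+x. (if B x then 1 else 0) \<partial>M)"
  using assms by (intro nn_integral_mono) auto

context receiver
begin

text \<open>A sum, so that one constant dominates all seven spreads and every exponent loses the
  same multiple of \<epsilon>.\<close>

definition spread :: real where
  "spread =
    log_spread (map_pmf (\<lambda>(q,u,x,v,y). ((q,u,v,y),x)) law) (\<lambda>(q,u,v,y). kx q) +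
    log_spread (map_pmf (\<lambda>(q,u,x,v,y). ((q,v,y),(u,x))) law) (\<lambda>(q,v,y). pair_pmf (ku q) (kx q)) +
    log_spread (map_pmf (\<lambda>(q,u,x,v,y). ((q,u,y),(x,v))) law) (\<lambda>(q,u,y). pair_pmf (kx q) (G q)) +
    log_spread (map_pmf (\<lambda>(q,u,x,v,y). ((q,y),(u,x,v))) law) (\<lambda>(q,y). pair_pmf (ku q) (pair_pmf (kx q) (G q))) +
    log_spread (map_pmf (\<lambda>(q,u,x,v,y). (q,(u,x))) law) (\<lambda>q. pair_pmf (ku q) (kx q)) +
    log_spread (map_pmf (\<lambda>(q,u,x,v,y). ((q,u),x)) law) (\<lambda>(q,u). kx q) +
    log_spread (map_pmf (\<lambda>(q,u,x,v,y). ((q,x),u)) law) (\<lambda>(q,x). ku q)"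

lemma log_spread_nonneg: "0 \<le> log_spread p k"
  unfolding log_spread_def by (intro sum_nonneg) auto

lemma seven_le_sum:
  fixes a b c d e f g :: real
  assumes "0 \<le> a" "0 \<le> b" "0 \<le> c" "0 \<le> d" "0 \<le> e" "0 \<le> f" "0 \<le> g"
  shows "a \<le> a + b + c + d + e + f + g" "b \<le> a + b + c + d + e + f + g" "c \<le> a + b + c + d + e + f + g"
    "d \<le> a + b + c + d + e + f + g" "e \<le> a + b + c + d + e + f + g" "f \<le> a + b + c + d + e + f + g"
    "g \<le> a + b + c + d + e + f + g" "0 \<le> a + b + c + d + e + f + g"
  using assms by auto

lemma spread_ge:
  "log_spread (map_pmf (\<lambda>(q,u,x,v,y). ((q,u,v,y),x)) law) (\<lambda>(q,u,v,y). kx q) \<le> spread"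
  "log_spread (map_pmf (\<lambda>(q,u,x,v,y). ((q,v,y),(u,x))) law) (\<lambda>(q,v,y). pair_pmf (ku q) (kx q)) \<le> spread"
  "log_spread (map_pmf (\<lambda>(q,u,x,v,y). ((q,u,y),(x,v))) law) (\<lambda>(q,u,y). pair_pmf (kx q) (G q)) \<le> spread"
  "log_spread (map_pmf (\<lambda>(q,u,x,v,y). ((q,y),(u,x,v))) law) (\<lambda>(q,y). pair_pmf (ku q) (pair_pmf (kx q) (G q))) \<le> spread"
  "log_spread (map_pmf (\<lambda>(q,u,x,v,y). (q,(u,x))) law) (\<lambda>q. pair_pmf (ku q) (kx q)) \<le> spread"
  "log_spread (map_pmf (\<lambda>(q,u,x,v,y). ((q,u),x)) law) (\<lambda>(q,u). kx q) \<le> spread"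
  "log_spread (map_pmf (\<lambda>(q,u,x,v,y). ((q,x),u)) law) (\<lambda>(q,x). ku q) \<le> spread"
  "0 \<le> spread"
  unfolding spread_def by (rule seven_le_sum; rule log_spread_nonneg)+

lemma law_mem:
  assumes "(q, u, x, v, y) \<in> set_pmf law"
  shows "u \<in> fst ` set_pmf (K q) \<and> x \<in> snd ` set_pmf (K q) \<and> v \<in> set_pmf (G q)"
  using law_in[OF assms] by simp

text \<open>These are the four hypotheses of \<open>packing_bound\<close>. Regrouping symbols as
  (kept, fresh) preserves typicality, after which the fresh words form one memoryless word.\<close>

lemma typical_law_le:
  fixes \<epsilon> :: real and n :: nat and q :: "nat \<Rightarrow> 'q"
  assumes \<epsilon>: "0 \<le> \<epsilon>"
  defines "t \<equiv> \<lambda>u x v y. (if (\<lambda>i. (q i, u i, x i, v i, y i)) \<in> typical \<epsilon> n law then 1 else 0 :: ennreal)"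
  defines "PU \<equiv> seq_pmf n (\<lambda>i. ku (q i))" and "PX \<equiv> seq_pmf n (\<lambda>i. kx (q i))" and "PV \<equiv> seq_pmf n (\<lambda>i. G (q i))"
  shows "(\<integral>\<^sup>+x. t u x v y \<partial>measure_pmf PX) \<le> ennreal (2 powr (- (real n * (rate_A - \<epsilon> * spread))))" (is ?A)
    and "(\<integral>\<^sup>+x. \<integral>\<^sup>+u. t u x v y \<partial>measure_pmf PU \<partial>measure_pmf PX) \<le> ennreal (2 powr (- (real n * (rate_B - \<epsilon> * spread))))" (is ?B)
    and "(\<integral>\<^sup>+x. \<integral>\<^sup>+v. t u x v y \<partial>measure_pmf PV \<partial>measure_pmf PX) \<le> ennreal (2 powr (- (real n * (rate_C - \<epsilon> * spread))))" (is ?C)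
    and "(\<integral>\<^sup>+x. \<integral>\<^sup>+u. \<integral>\<^sup>+v. t u x v y \<partial>measure_pmf PV \<partial>measure_pmf PU \<partial>measure_pmf PX) \<le> ennreal (2 powr (- (real n * (rate_D - \<epsilon> * spread))))" (is ?D)
proof -
  note tdefs = t_def PU_def PX_def PV_def
  have "(\<integral>\<^sup>+x. t u x v y \<partial>measure_pmf PX) \<le> (\<integral>\<^sup>+x. (if (\<lambda>i. ((q i, u i, v i, y i), x i)) \<in>
      typical \<epsilon> n (map_pmf (\<lambda>(q,u,x,v,y). ((q,u,v,y),x)) law) then 1 else 0)
      \<partial>measure_pmf (seq_pmf n (\<lambda>i. (\<lambda>(q,u,v,y). kx q) (q i, u i, v i, y i))))"
    unfolding tdefs by simp (rule nn_integral_if_mono, drule typical_map[where f="\<lambda>(q,u,x,v,y). ((q,u,v,y),x)"], simp)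
  also have "\<dots> \<le> ennreal (2 powr (- (real n * (rate_A - \<epsilon> * spread))))"
    unfolding rate_A_def by (rule typical_prob_le[OF _ spread_ge(1) \<epsilon>]) (auto dest!: law_mem; force)
  finally show ?A .
  have "(\<integral>\<^sup>+x. \<integral>\<^sup>+u. t u x v y \<partial>measure_pmf PU \<partial>measure_pmf PX) = (\<integral>\<^sup>+u. \<integral>\<^sup>+x. t u x v y \<partial>measure_pmf PX \<partial>measure_pmf PU)"
    by (rule nn_integral_pmf_swap)
  also have "\<dots> \<le> (\<integral>\<^sup>+u. \<integral>\<^sup>+x. (if (\<lambda>i. ((q i, v i, y i), (u i, x i))) \<in>
      typical \<epsilon> n (map_pmf (\<lambda>(q,u,x,v,y). ((q,v,y),(u,x))) law) then 1 else 0) \<partial>measure_pmf PX \<partial>measure_pmf PU)"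
    unfolding t_def by (rule nn_integral_mono) (rule nn_integral_if_mono, drule typical_map[where f="\<lambda>(q,u,x,v,y). ((q,v,y),(u,x))"], simp)
  also have "\<dots> = (\<integral>\<^sup>+s. (if (\<lambda>i. ((q i, v i, y i), s i)) \<in>
      typical \<epsilon> n (map_pmf (\<lambda>(q,u,x,v,y). ((q,v,y),(u,x))) law) then 1 else 0)
      \<partial>measure_pmf (seq_pmf n (\<lambda>i. (\<lambda>(q,v,y). pair_pmf (ku q) (kx q)) (q i, v i, y i))))"
    by (simp add: nn_integral_seq_pair tdefs)
  also have "\<dots> \<le> ennreal (2 powr (- (real n * (rate_B - \<epsilon> * spread))))"
    unfolding rate_B_def by (rule typical_prob_le[OF _ spread_ge(2) \<epsilon>]) (auto dest!: law_mem; force)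
  finally show ?B .
  have "(\<integral>\<^sup>+x. \<integral>\<^sup>+v. t u x v y \<partial>measure_pmf PV \<partial>measure_pmf PX) \<le> (\<integral>\<^sup>+x. \<integral>\<^sup>+v. (if (\<lambda>i. ((q i, u i, y i), (x i, v i))) \<in>
      typical \<epsilon> n (map_pmf (\<lambda>(q,u,x,v,y). ((q,u,y),(x,v))) law) then 1 else 0) \<partial>measure_pmf PV \<partial>measure_pmf PX)"
    unfolding t_def by (rule nn_integral_mono) (rule nn_integral_if_mono, drule typical_map[where f="\<lambda>(q,u,x,v,y). ((q,u,y),(x,v))"], simp)
  also have "\<dots> = (\<integral>\<^sup>+s. (if (\<lambda>i. ((q i, u i, y i), s i)) \<in>
      typical \<epsilon> n (map_pmf (\<lambda>(q,u,x,v,y). ((q,u,y),(x,v))) law) then 1 else 0)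
      \<partial>measure_pmf (seq_pmf n (\<lambda>i. (\<lambda>(q,u,y). pair_pmf (kx q) (G q)) (q i, u i, y i))))"
    by (simp add: nn_integral_seq_pair tdefs)
  also have "\<dots> \<le> ennreal (2 powr (- (real n * (rate_C - \<epsilon> * spread))))"
    unfolding rate_C_def by (rule typical_prob_le[OF _ spread_ge(3) \<epsilon>]) (auto dest!: law_mem; force)
  finally show ?C .
  have "(\<integral>\<^sup>+x. \<integral>\<^sup>+u. \<integral>\<^sup>+v. t u x v y \<partial>measure_pmf PV \<partial>measure_pmf PU \<partial>measure_pmf PX)
     = (\<integral>\<^sup>+u. \<integral>\<^sup>+x. \<integral>\<^sup>+v. t u x v y \<partial>measure_pmf PV \<partial>measure_pmf PX \<partial>measure_pmf PU)"
    by (rule nn_integral_pmf_swap)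
  also have "\<dots> \<le> (\<integral>\<^sup>+u. \<integral>\<^sup>+x. \<integral>\<^sup>+v. (if (\<lambda>i. ((q i, y i), (u i, x i, v i))) \<in>
      typical \<epsilon> n (map_pmf (\<lambda>(q,u,x,v,y). ((q,y),(u,x,v))) law) then 1 else 0) \<partial>measure_pmf PV \<partial>measure_pmf PX \<partial>measure_pmf PU)"
    unfolding t_def by (rule nn_integral_mono, rule nn_integral_mono) (rule nn_integral_if_mono, drule typical_map[where f="\<lambda>(q,u,x,v,y). ((q,y),(u,x,v))"], simp)
  also have "\<dots> = (\<integral>\<^sup>+s. (if (\<lambda>i. ((q i, y i), s i)) \<in>
      typical \<epsilon> n (map_pmf (\<lambda>(q,u,x,v,y). ((q,y),(u,x,v))) law) then 1 else 0)
      \<partial>measure_pmf (seq_pmf n (\<lambda>i. (\<lambda>(q,y). pair_pmf (ku q) (pair_pmf (kx q) (G q))) (q i, y i))))"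
    by (simp add: nn_integral_seq_pair tdefs)
  also have "\<dots> \<le> ennreal (2 powr (- (real n * (rate_D - \<epsilon> * spread))))"
    unfolding rate_D_def by (rule typical_prob_le[OF _ spread_ge(4) \<epsilon>]) (auto dest!: law_mem; force)
  finally show ?D .
qed

definition source :: "('q \<times> 'u \<times> 'x) pmf" where
  "source = map_pmf (\<lambda>(q,u,x,v,y). (q,u,x)) law"

lemma source_eq: "source = bind_pmf pQ (\<lambda>q. map_pmf (Pair q) (K q))"
  by (simp add: source_def law_def map_bind_pmf case_prod_unfold map_pmf_def bind_assoc_pmf bind_return_pmf)

lemma source_disintegrates: "disintegrates source K"
proof -
  have "map_pmf fst source = pQ" unfolding source_eq by (simp add: map_bind_pmf pmf.map_comp o_def bind_return_pmf')
  then show ?thesis by (simp add: disintegrates_def source_eq pmf_bind_Pair)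
qed

lemma source_in:
  assumes "(q, a) \<in> set_pmf source" shows "a \<in> set_pmf (pair_pmf (ku q) (kx q))"
  using assms by (cases a) (force simp: source_eq)

text \<open>Passing from independent words to the memoryless law of the pair costs the density
  2^(-n(I - \<epsilon> S)) on the typical set.\<close>

lemma codeword_pair_le:
  fixes F :: "(nat \<Rightarrow> 'u) \<Rightarrow> (nat \<Rightarrow> 'x) \<Rightarrow> ennreal"
  assumes \<epsilon>: "0 \<le> \<epsilon>"
    and F: "\<And>u u' x x'. (\<And>i. i < n \<Longrightarrow> u i = u' i \<and> x i = x' i) \<Longrightarrow> F u x = F u' x'"
  shows "(\<integral>\<^sup>+u. \<integral>\<^sup>+x. (if (\<lambda>i. (q i, u i, x i)) \<in> typical \<epsilon> n source then F u x else 0)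
      \<partial>measure_pmf (seq_pmf n (\<lambda>i. kx (q i))) \<partial>measure_pmf (seq_pmf n (\<lambda>i. ku (q i))))
    \<le> ennreal (2 powr (- (real n * (rate_I - \<epsilon> * spread)))) *
       (\<integral>\<^sup>+a. F (\<lambda>i. fst (a i)) (\<lambda>i. snd (a i)) \<partial>measure_pmf (seq_pmf n (\<lambda>i. K (q i))))"
proof -
  let ?F = "\<lambda>a. F (\<lambda>i. fst (a i)) (\<lambda>i. snd (a i))"
  \<comment> \<open>Beyond position \<open>n\<close> a sampled word of pairs is
    \<open>undefined\<close> as a pair, whose components need not be \<open>undefined\<close>; the
    locality of \<open>F\<close> bridges this.\<close>
  have F': "?F (trim n (\<lambda>i. (u i, x i))) = F u x" for u x by (rule F) (simp add: trim_def)
  have "(\<integral>\<^sup>+u. \<integral>\<^sup>+x. (if (\<lambda>i. (q i, u i, x i)) \<in> typical \<epsilon> n source then F u x else 0)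
      \<partial>measure_pmf (seq_pmf n (\<lambda>i. kx (q i))) \<partial>measure_pmf (seq_pmf n (\<lambda>i. ku (q i)))) =
    (\<integral>\<^sup>+a. indicator (typical \<epsilon> n source) (\<lambda>i. (q i, a i)) * ?F a \<partial>measure_pmf (seq_pmf n (\<lambda>i. pair_pmf (ku (q i)) (kx (q i)))))"
    unfolding nn_integral_seq_pair F' by (intro nn_integral_cong) (simp add: indicator_def of_bool_def)
  also have "\<dots> \<le> ennreal (2 powr (- (real n * (divergence_rate source (\<lambda>q. pair_pmf (ku q) (kx q)) - \<epsilon> * log_spread source (\<lambda>q. pair_pmf (ku q) (kx q)))))) *
       (\<integral>\<^sup>+a. ?F a \<partial>measure_pmf (seq_pmf n (\<lambda>i. K (q i))))"
    by (rule nn_integral_typical_le(1)[OF source_disintegrates source_in])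
  also have "\<dots> \<le> ennreal (2 powr (- (real n * (rate_I - \<epsilon> * spread)))) * (\<integral>\<^sup>+a. ?F a \<partial>measure_pmf (seq_pmf n (\<lambda>i. K (q i))))"
    using spread_ge(5) \<epsilon> unfolding rate_I_def source_def
    by (intro mult_right_mono ennreal_leI powr_mono) (auto intro!: mult_left_mono)
  finally show ?thesis .
qed

text \<open>Through the change of measure, \<open>good\<close> gives p at least 2^(-n(I + \<epsilon>
  S)) / 2 for an independent pair. In the ratio c / p the exponent I cancels, so the terms for a
  shared index only need Rc and Rp above 2 \<epsilon> S.\<close>

lemma covering_failure_le:
  fixes \<epsilon> :: real and n :: nat and q :: "nat \<Rightarrow> 'q"
  assumes \<epsilon>: "0 \<le> \<epsilon>" and fin: "finite Lc" "finite Lp" "finite Mx" and ne: "Lc \<noteq> {}" "Lp \<noteq> {}" and m: "m \<in> Mx"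
    and good: "1 / 2 \<le> measure_pmf.prob (seq_pmf n (\<lambda>i. K (q i))) {s. (\<lambda>i. (q i, s i)) \<in> typical \<epsilon> n source}"
  defines "T \<equiv> \<lambda>u x. (\<lambda>i. (q i, u i, x i)) \<in> typical \<epsilon> n source"
  shows "(\<integral>\<^sup>+U. \<integral>\<^sup>+X. (if covered Lc Lp T U (\<lambda>b. X (m, b)) then 0 else 1)
      \<partial>measure_pmf (Pi_pmf (Mx \<times> Lp) d' (\<lambda>_. seq_pmf n (\<lambda>i. kx (q i)))) \<partial>measure_pmf (Pi_pmf Lc d (\<lambda>_. seq_pmf n (\<lambda>i. ku (q i)))))
    \<le> ennreal (2 * 2 powr (real n * (rate_I + \<epsilon> * spread)) / (real (card Lc) * real (card Lp)) +
        2 * 2 powr (2 * real n * \<epsilon> * spread) / real (card Lc) + 2 * 2 powr (2 * real n * \<epsilon> * spread) / real (card Lp))"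
proof -
  define PU where "PU = seq_pmf n (\<lambda>i. ku (q i))"
  define PX where "PX = seq_pmf n (\<lambda>i. kx (q i))"
  define p where "p = measure_pmf.prob (pair_pmf PU PX) {(u, x). T u x}"
  define c where "c = 2 powr (- (real n * (rate_I - \<epsilon> * spread)))"
  define e where "e = 2 powr (real n * (rate_I + \<epsilon> * spread))"
  have pe: "ennreal p = (\<integral>\<^sup>+u. \<integral>\<^sup>+x. (if T u x then 1 else 0) \<partial>measure_pmf PX \<partial>measure_pmf PU)"
  proof -
    have "ennreal p = (\<integral>\<^sup>+w. indicator {(u, x). T u x} w \<partial>measure_pmf (pair_pmf PU PX))"
      by (simp add: p_def measure_pmf.emeasure_eq_measure)
    also have "\<dots> = (\<integral>\<^sup>+u. \<integral>\<^sup>+x. (if T u x then 1 else 0) \<partial>measure_pmf PX \<partial>measure_pmf PU)"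
      by (subst nn_integral_pair_pmf') (simp add: indicator_def of_bool_def)
    finally show ?thesis .
  qed
  have "ennreal (1 / 2) \<le> ennreal (measure_pmf.prob (seq_pmf n (\<lambda>i. K (q i))) {s. (\<lambda>i. (q i, s i)) \<in> typical \<epsilon> n source})"
    by (rule ennreal_leI[OF good])
  also have "\<dots> = (\<integral>\<^sup>+s. indicator {s. (\<lambda>i. (q i, s i)) \<in> typical \<epsilon> n source} s \<partial>measure_pmf (seq_pmf n (\<lambda>i. K (q i))))"
    by (simp add: measure_pmf.emeasure_eq_measure)
  also have "\<dots> = (\<integral>\<^sup>+s. indicator (typical \<epsilon> n source) (\<lambda>i. (q i, s i)) * 1 \<partial>measure_pmf (seq_pmf n (\<lambda>i. K (q i))))"
    by (intro nn_integral_cong) (simp add: indicator_def of_bool_def)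
  also have "\<dots> \<le> ennreal (2 powr (real n * (divergence_rate source (\<lambda>q. pair_pmf (ku q) (kx q)) + \<epsilon> * log_spread source (\<lambda>q. pair_pmf (ku q) (kx q))))) *
      (\<integral>\<^sup>+s. indicator (typical \<epsilon> n source) (\<lambda>i. (q i, s i)) * 1 \<partial>measure_pmf (seq_pmf n (\<lambda>i. pair_pmf (ku (q i)) (kx (q i)))))"
    by (rule nn_integral_typical_le(2)[OF source_disintegrates source_in])
  also have "(\<integral>\<^sup>+s. indicator (typical \<epsilon> n source) (\<lambda>i. (q i, s i)) * 1 \<partial>measure_pmf (seq_pmf n (\<lambda>i. pair_pmf (ku (q i)) (kx (q i))))) = ennreal p"
    unfolding nn_integral_seq_pair pe PU_def PX_def T_def by (simp add: indicator_def of_bool_def)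
  also have "ennreal (2 powr (real n * (divergence_rate source (\<lambda>q. pair_pmf (ku q) (kx q)) + \<epsilon> * log_spread source (\<lambda>q. pair_pmf (ku q) (kx q))))) * ennreal p
     \<le> ennreal e * ennreal p"
    using spread_ge(5) \<epsilon> unfolding rate_I_def source_def e_def
    by (intro mult_right_mono ennreal_leI powr_mono) (auto intro!: mult_left_mono)
  finally have "ennreal (1/2) \<le> ennreal (e * p)" by (simp add: e_def p_def ennreal_mult)
  then have ep: "1 / 2 \<le> e * p" by (subst (asm) ennreal_le_iff) (auto simp: e_def p_def)
  have epos: "e > 0" by (simp add: e_def)
  have ppos: "p > 0" using ep epos by (metis less_le_trans half_gt_zero zero_less_one zero_less_mult_pos)
  have ip: "1 / p \<le> 2 * e" using ep ppos by (simp add: field_simps)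
  have cb: "measure_pmf.prob PX {x. T u x} \<le> c" for u
  proof -
    have "ennreal (measure_pmf.prob PX {x. T u x}) = (\<integral>\<^sup>+x. indicator {x. T u x} x \<partial>measure_pmf PX)"
      by (simp add: measure_pmf.emeasure_eq_measure)
    also have "\<dots> \<le> (\<integral>\<^sup>+x. (if (\<lambda>i. ((q i, u i), x i)) \<in> typical \<epsilon> n (map_pmf (\<lambda>(q,u,x,v,y). ((q,u),x)) law) then 1 else 0)
        \<partial>measure_pmf (seq_pmf n (\<lambda>i. (\<lambda>(q,u). kx q) (q i, u i))))"
      unfolding T_def PX_def indicator_def of_bool_def
      by simp (rule nn_integral_if_mono, drule typical_map[where f="\<lambda>(q,u,x). ((q,u),x)"], simp add: source_def pmf.map_comp o_def case_prod_unfold)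
    also have "\<dots> \<le> ennreal c"
      unfolding c_def divergence_rate_source(1)[symmetric]
      by (rule typical_prob_le[OF _ spread_ge(6) \<epsilon>]) (auto dest!: law_mem; force)
    finally show ?thesis by (simp add: c_def)
  qed
  have cb': "measure_pmf.prob PU {u. T u x} \<le> c" for x
  proof -
    have "ennreal (measure_pmf.prob PU {u. T u x}) = (\<integral>\<^sup>+u. indicator {u. T u x} u \<partial>measure_pmf PU)"
      by (simp add: measure_pmf.emeasure_eq_measure)
    also have "\<dots> \<le> (\<integral>\<^sup>+u. (if (\<lambda>i. ((q i, x i), u i)) \<in> typical \<epsilon> n (map_pmf (\<lambda>(q,u,x,v,y). ((q,x),u)) law) then 1 else 0)
        \<partial>measure_pmf (seq_pmf n (\<lambda>i. (\<lambda>(q,x). ku q) (q i, x i))))"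
      unfolding T_def PU_def indicator_def of_bool_def
      by simp (rule nn_integral_if_mono, drule typical_map[where f="\<lambda>(q,u,x). ((q,x),u)"], simp add: source_def pmf.map_comp o_def case_prod_unfold)
    also have "\<dots> \<le> ennreal c"
      unfolding c_def divergence_rate_source(2)[symmetric]
      by (rule typical_prob_le[OF _ spread_ge(7) \<epsilon>]) (auto dest!: law_mem; force)
    finally show ?thesis by (simp add: c_def)
  qed
  have ce: "c * e = 2 powr (2 * real n * \<epsilon> * spread)"
    unfolding c_def e_def powr_add[symmetric] by (simp add: algebra_simps)
  have cp: "c / p \<le> 2 * 2 powr (2 * real n * \<epsilon> * spread)"
    using mult_left_mono[OF ip, of c] ce by (simp add: c_def mult.left_commute mult.assoc)
  define N where "N = real (card Lc)"
  define N' where "N' = real (card Lp)"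
  have N: "N > 0" "N' > 0" using fin ne by (auto simp: N_def N'_def card_gt_0_iff)
  let ?M = "pair_pmf (Pi_pmf Lc d (\<lambda>_. PU)) (Pi_pmf (Mx \<times> Lp) d' (\<lambda>_. PX))"
  have "measure_pmf.prob ?M {(U, X). \<forall>a\<in>Lc. \<forall>z\<in>{m} \<times> Lp. \<not> T (U a) (X z)}
    \<le> 1 / (real (card Lc) * real (card ({m} \<times> Lp)) * p) + c / (real (card Lc) * p) + c / (real (card ({m} \<times> Lp)) * p)"
    by (rule mutual_covering[OF _ _ _ _ _ _ p_def ppos cb cb']) (use fin ne m in auto)
  also have "\<dots> = (1 / p) / (N * N') + (c / p) / N + (c / p) / N'"
    by (simp add: card_cartesian_product N_def N'_def mult_ac)
  also have "\<dots> \<le> (2 * e) / (N * N') + (2 * 2 powr (2 * real n * \<epsilon> * spread)) / N + (2 * 2 powr (2 * real n * \<epsilon> * spread)) / N'"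
    using N by (intro add_mono divide_right_mono ip cp) auto
  finally have main: "measure_pmf.prob ?M {(U, X). \<forall>a\<in>Lc. \<forall>z\<in>{m} \<times> Lp. \<not> T (U a) (X z)} \<le> \<dots>" .
  have "(\<integral>\<^sup>+U. \<integral>\<^sup>+X. (if covered Lc Lp T U (\<lambda>b. X (m, b)) then 0 else 1)
      \<partial>measure_pmf (Pi_pmf (Mx \<times> Lp) d' (\<lambda>_. PX)) \<partial>measure_pmf (Pi_pmf Lc d (\<lambda>_. PU)))
    = (\<integral>\<^sup>+w. indicator {(U, X). \<forall>a\<in>Lc. \<forall>z\<in>{m} \<times> Lp. \<not> T (U a) (X z)} w \<partial>measure_pmf ?M)"
    by (subst nn_integral_pair_pmf') (auto intro!: nn_integral_cong simp: indicator_def of_bool_def covered_def)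
  also have "\<dots> = ennreal (measure_pmf.prob ?M {(U, X). \<forall>a\<in>Lc. \<forall>z\<in>{m} \<times> Lp. \<not> T (U a) (X z)})"
    by (simp add: measure_pmf.emeasure_eq_measure)
  also have "\<dots> \<le> ennreal ((2 * e) / (N * N') + (2 * 2 powr (2 * real n * \<epsilon> * spread)) / N + (2 * 2 powr (2 * real n * \<epsilon> * spread)) / N')"
    by (rule ennreal_leI[OF main])
  finally show ?thesis by (simp add: PU_def PX_def N_def N'_def e_def)
qed

text \<open>Combines the number of candidate pairs with the change of measure: the selected pair has
  density of order 2^(n(Rc + Rp - I + \<epsilon> S)) with respect to the memoryless law.\<close>

lemma selected_pair_law_le:
  fixes \<epsilon> :: real and n :: nat and q :: "nat \<Rightarrow> 'q" and F :: "(nat \<Rightarrow> 'u) \<Rightarrow> (nat \<Rightarrow> 'x) \<Rightarrow> ennreal"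
  assumes \<epsilon>: "0 \<le> \<epsilon>" and fin: "finite Lc" "finite Lp" "finite Mx" and m: "m \<in> Mx"
    and F: "\<And>u u' x x'. (\<And>i. i < n \<Longrightarrow> u i = u' i \<and> x i = x' i) \<Longrightarrow> F u x = F u' x'"
  defines "T \<equiv> \<lambda>u x. (\<lambda>i. (q i, u i, x i)) \<in> typical \<epsilon> n source"
  shows "(\<integral>\<^sup>+U. \<integral>\<^sup>+X. (if covered Lc Lp T U (\<lambda>b. X (m, b)) then F (U (coord Lc Lp T m U X)) (send Lc Lp T m U X) else 0)
      \<partial>measure_pmf (Pi_pmf (Mx \<times> Lp) d' (\<lambda>_. seq_pmf n (\<lambda>i. kx (q i)))) \<partial>measure_pmf (Pi_pmf Lc d (\<lambda>_. seq_pmf n (\<lambda>i. ku (q i)))))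
    \<le> of_nat (card Lc * card Lp) * (ennreal (2 powr (- (real n * (rate_I - \<epsilon> * spread)))) *
       (\<integral>\<^sup>+a. F (\<lambda>i. fst (a i)) (\<lambda>i. snd (a i)) \<partial>measure_pmf (seq_pmf n (\<lambda>i. K (q i)))))"
  by (rule order.trans[OF selected_pair_le])
    (use fin m in \<open>auto simp: T_def intro!: mult_left_mono codeword_pair_le[OF \<epsilon> F]\<close>)

end

section \<open>Both senders and receivers, given q and the messages\<close>

section \<open>The interference channel\<close>

lemma nn_integral_pmf_swap2:
  fixes f :: "'a \<Rightarrow> 'b \<Rightarrow> 'c \<Rightarrow> 'd \<Rightarrow> ennreal"
  shows "(\<integral>\<^sup>+a. \<integral>\<^sup>+b. \<integral>\<^sup>+c. \<integral>\<^sup>+d. f a b c d \<partial>measure_pmf D \<partial>measure_pmf C \<partial>measure_pmf B \<partial>measure_pmf A) =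
         (\<integral>\<^sup>+c. \<integral>\<^sup>+d. \<integral>\<^sup>+a. \<integral>\<^sup>+b. f a b c d \<partial>measure_pmf B \<partial>measure_pmf A \<partial>measure_pmf D \<partial>measure_pmf C)"
  using nn_integral_pmf_swap[where f="\<lambda>x y. f (fst x) (snd x) (fst y) (snd y)" and N="pair_pmf C D" and M="pair_pmf A B"]
  by (simp add: nn_integral_pair_pmf')

lemma encode_eq_send:
  "encode n \<epsilon> p Rc Rp q u x m =
    send (index_set n Rc) (index_set n Rp) (\<lambda>u x. (\<lambda>i. (q i, u i, x i)) \<in> typical \<epsilon> n p) m u x"
  unfolding encode_def send_def select_def Let_def if_distrib[of "\<lambda>p. x (m, snd p)"] by (simp only: snd_conv)

text \<open>The decoder does not have to identify the indices, so the right message with wrong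
  indices is no error and imposes no rate condition.\<close>

lemma decode_eq_Some:
  assumes "m \<in> index_set n R"
    and "\<exists>lc\<in>index_set n Rc. \<exists>lp\<in>index_set n Rp. \<exists>lc'\<in>index_set n Rc'.
      (\<lambda>i. (q i, u lc i, x (m, lp) i, v lc' i, y i)) \<in> typical \<epsilon> n p"
    and "\<not> (\<exists>m'\<in>index_set n R - {m}. \<exists>lc\<in>index_set n Rc. \<exists>lp\<in>index_set n Rp. \<exists>lc'\<in>index_set n Rc'.
      (\<lambda>i. (q i, u lc i, x (m', lp) i, v lc' i, y i)) \<in> typical \<epsilon> n p)"
  shows "decode n \<epsilon> p R Rc Rp Rc' q u x v y = Some m"
proof -
  define C where "C = {m \<in> index_set n R.
                 \<exists>lc\<in>index_set n Rc. \<exists>lp\<in>index_set n Rp. \<exists>lc'\<in>index_set n Rc'.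
                   (\<lambda>i. (q i, u lc i, x (m, lp) i, v lc' i, y i)) \<in> typical \<epsilon> n p}"
  have "C = {m}" using assms unfolding C_def by blast
  then show ?thesis unfolding decode_def C_def[symmetric] Let_def by simp
qed

lemma finite_index_set [simp]: "finite (index_set n R)"
  by (simp add: index_set_def)

lemma index_set_nonempty [simp]: "index_set n R \<noteq> {}"
proof -
  have "0 < \<lceil>2 powr (real n * R)\<rceil>" by (simp add: less_ceiling_iff)
  then have "1 \<le> nat \<lceil>2 powr (real n * R)\<rceil>" by linarith
  then show ?thesis by (simp add: index_set_def)
qed

abbreviation size_ix :: "nat \<Rightarrow> real \<Rightarrow> real" where
  "size_ix n R \<equiv> real (card (index_set n R))"

text \<open>For a nonnegative rate 2^(nR) is at least one, so rounding up at most doubles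
  it.\<close>

lemma card_index_set_le:
  assumes "0 \<le> R" shows "size_ix n R \<le> 2 * 2 powr (real n * R)"
proof -
  have "1 \<le> (2::real) powr (real n * R)" using assms by (simp add: ge_one_powr_ge_zero)
  moreover have "size_ix n R = of_int \<lceil>2 powr (real n * R)\<rceil>" by (simp add: index_set_def)
  moreover have "of_int \<lceil>2 powr (real n * R)\<rceil> \<le> 2 powr (real n * R) + 1" by linarith
  ultimately show ?thesis by linarith
qed

lemma card_index_set_ge: "2 powr (real n * R) \<le> size_ix n R"
  by (simp add: index_set_def)

locale interference_channel =
  fixes pQ :: "'q::finite pmf"
    and K1 :: "'q \<Rightarrow> ('u1::finite \<times> 'x1::finite) pmf"
    and K2 :: "'q \<Rightarrow> ('u2::finite \<times> 'x2::finite) pmf"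
    and W :: "'x1 \<Rightarrow> 'x2 \<Rightarrow> ('y1::finite \<times> 'y2::finite) pmf"
begin

text \<open>Averaging \<open>x2\<close> with the kernel of the second sender keeps the dependence
  between \<open>U2\<close> and the output. The obligation holds since the senders are independent
  given \<open>q\<close>.\<close>

sublocale r1: receiver pQ K1 "\<lambda>q. map_pmf fst (K2 q)"
  "\<lambda>q x1. bind_pmf (K2 q) (\<lambda>(u2, x2). map_pmf (\<lambda>y. (u2, fst y)) (W x1 x2))"
proof
  show "map_pmf fst (bind_pmf (K2 q) (\<lambda>(u2, x2). map_pmf (\<lambda>y. (u2, fst y)) (W x1 x2))) = map_pmf fst (K2 q)" for q x1
    by (simp add: map_bind_pmf case_prod_unfold pmf.map_comp o_def) (simp add: map_pmf_def)
qed

sublocale r2: receiver pQ K2 "\<lambda>q. map_pmf fst (K1 q)"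
  "\<lambda>q x2. bind_pmf (K1 q) (\<lambda>(u1, x1). map_pmf (\<lambda>y. (u1, snd y)) (W x1 x2))"
proof
  show "map_pmf fst (bind_pmf (K1 q) (\<lambda>(u1, x1). map_pmf (\<lambda>y. (u1, snd y)) (W x1 x2))) = map_pmf fst (K1 q)" for q x2
    by (simp add: map_bind_pmf case_prod_unfold pmf.map_comp o_def) (simp add: map_pmf_def)
qed

definition J where "J = joint_pmf pQ K1 K2 W"

lemma J_eq: "J = bind_pmf pQ (\<lambda>q. bind_pmf (K1 q) (\<lambda>a. bind_pmf (K2 q) (\<lambda>b.
    map_pmf (\<lambda>y. (q, fst a, snd a, fst b, snd b, fst y, snd y)) (W (snd a) (snd b)))))"
  by (simp add: J_def joint_pmf_def case_prod_unfold map_pmf_def)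

lemma law1: "r1.law = map_pmf (\<lambda>w. (rvQ w, rvU1 w, rvX1 w, rvU2 w, rvY1 w)) J"
  unfolding r1.law_def by (simp add: J_eq map_bind_pmf case_prod_unfold map_pmf_def bind_assoc_pmf bind_return_pmf del: prod.collapse)

lemma law2: "r2.law = map_pmf (\<lambda>w. (rvQ w, rvU2 w, rvX2 w, rvU1 w, rvY2 w)) J"
proof -
  have "r2.law = bind_pmf pQ (\<lambda>q. bind_pmf (K2 q) (\<lambda>b. bind_pmf (K1 q) (\<lambda>a.
      map_pmf (\<lambda>y. (q, fst b, snd b, fst a, snd y)) (W (snd a) (snd b)))))"
    unfolding r2.law_def by (simp add: map_bind_pmf case_prod_unfold map_pmf_def bind_assoc_pmf bind_return_pmf)
  also have "\<dots> = bind_pmf pQ (\<lambda>q. bind_pmf (K1 q) (\<lambda>a. bind_pmf (K2 q) (\<lambda>b.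
      map_pmf (\<lambda>y. (q, fst b, snd b, fst a, snd y)) (W (snd a) (snd b)))))"
    by (subst bind_commute_pmf) (rule refl)
  also have "\<dots> = map_pmf (\<lambda>w. (rvQ w, rvU2 w, rvX2 w, rvU1 w, rvY2 w)) J"
    by (simp add: J_eq map_bind_pmf pmf.map_comp o_def del: prod.collapse)
  finally show ?thesis .
qed

lemma source1: "r1.source = map_pmf (\<lambda>w. (rvQ w, rvU1 w, rvX1 w)) J"
  unfolding r1.source_def law1 by (simp add: pmf.map_comp o_def)

lemma source2: "r2.source = map_pmf (\<lambda>w. (rvQ w, rvU2 w, rvX2 w)) J"
  unfolding r2.source_def law2 by (simp add: pmf.map_comp o_def)

text \<open>The reference law, sampled in the layers of the scheme: time sharing, one pair per
  sender, then the channel. The densities of the selected pairs refer to the middle layers.\<close>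

lemma seq_J: "seq_pmf n (\<lambda>_. J) =
  bind_pmf (seq_pmf n (\<lambda>_. pQ)) (\<lambda>q. bind_pmf (seq_pmf n (\<lambda>i. K1 (q i))) (\<lambda>a. bind_pmf (seq_pmf n (\<lambda>i. K2 (q i))) (\<lambda>b.
    map_pmf (\<lambda>y. trim n (\<lambda>i. (q i, fst (a i), snd (a i), fst (b i), snd (b i), fst (y i), snd (y i))))
      (seq_pmf n (\<lambda>i. W (snd (a i)) (snd (b i)))))))"
  unfolding J_eq seq_pmf_bind seq_pmf_map ..

end

lemma (in receiver) seq_source: "seq_pmf n (\<lambda>_. source) =
  bind_pmf (seq_pmf n (\<lambda>_. pQ)) (\<lambda>q. map_pmf (\<lambda>a. trim n (\<lambda>i. (q i, a i))) (seq_pmf n (\<lambda>i. K (q i))))"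
  unfolding source_eq seq_pmf_bind seq_pmf_map ..

text \<open>Markov's inequality for the conditional probability given \<open>q\<close> that a memoryless pair is not typical.\<close>

lemma (in receiver) bad_time_sharing_le:
  "(\<integral>\<^sup>+q. (if 1 / 2 \<le> measure_pmf.prob (seq_pmf n (\<lambda>i. K (q i))) {s. (\<lambda>i. (q i, s i)) \<in> typical \<epsilon> n source} then 0 else 1)
     \<partial>measure_pmf (seq_pmf n (\<lambda>_. pQ)))
   \<le> ennreal (2 * measure_pmf.prob (seq_pmf n (\<lambda>_. source)) {s. s \<notin> typical \<epsilon> n source})"
proof -
  let ?bad = "\<lambda>q. {s. (\<lambda>i. (q i, s i)) \<notin> typical \<epsilon> n source}"
  have "(if 1 / 2 \<le> measure_pmf.prob (seq_pmf n (\<lambda>i. K (q i))) {s. (\<lambda>i. (q i, s i)) \<in> typical \<epsilon> n source} then 0 else 1)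
     \<le> 2 * emeasure (seq_pmf n (\<lambda>i. K (q i))) (?bad q)" for q
  proof (cases "1 / 2 \<le> measure_pmf.prob (seq_pmf n (\<lambda>i. K (q i))) {s. (\<lambda>i. (q i, s i)) \<in> typical \<epsilon> n source}")
    case False
    have "?bad q = space (seq_pmf n (\<lambda>i. K (q i))) - {s. (\<lambda>i. (q i, s i)) \<in> typical \<epsilon> n source}" by auto
    then have "measure_pmf.prob (seq_pmf n (\<lambda>i. K (q i))) (?bad q) =
        1 - measure_pmf.prob (seq_pmf n (\<lambda>i. K (q i))) {s. (\<lambda>i. (q i, s i)) \<in> typical \<epsilon> n source}"
      by (simp only:) (rule measure_pmf.prob_compl, simp)
    then have "1 \<le> 2 * measure_pmf.prob (seq_pmf n (\<lambda>i. K (q i))) (?bad q)" using False by simp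
    then have "ennreal 1 \<le> ennreal (2 * measure_pmf.prob (seq_pmf n (\<lambda>i. K (q i))) (?bad q))" by (rule ennreal_leI)
    then show ?thesis using False by (simp add: measure_pmf.emeasure_eq_measure ennreal_mult)
  qed simp
  then have "(\<integral>\<^sup>+q. (if 1 / 2 \<le> measure_pmf.prob (seq_pmf n (\<lambda>i. K (q i))) {s. (\<lambda>i. (q i, s i)) \<in> typical \<epsilon> n source} then 0 else 1)
     \<partial>measure_pmf (seq_pmf n (\<lambda>_. pQ)))
    \<le> (\<integral>\<^sup>+q. 2 * emeasure (seq_pmf n (\<lambda>i. K (q i))) (?bad q) \<partial>measure_pmf (seq_pmf n (\<lambda>_. pQ)))"
    by (rule nn_integral_mono)
  also have "\<dots> = 2 * emeasure (seq_pmf n (\<lambda>_. source)) {s. s \<notin> typical \<epsilon> n source}"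
  proof -
    have "emeasure (map_pmf (\<lambda>a. trim n (\<lambda>i. (q i, a i))) (seq_pmf n (\<lambda>i. K (q i)))) {s. s \<notin> typical \<epsilon> n source}
      = emeasure (seq_pmf n (\<lambda>i. K (q i))) (?bad q)" for q
    proof -
      have "trim n s \<in> typical \<epsilon> n source \<longleftrightarrow> s \<in> typical \<epsilon> n source" for s :: "nat \<Rightarrow> 'q \<times> 'u \<times> 'x"
        by (rule typical_cong) (simp add: trim_def)
      then show ?thesis by (simp add: vimage_def)
    qed
    then show ?thesis unfolding seq_source by (simp add: nn_integral_cmult)
  qed
  finally show ?thesis by (simp add: measure_pmf.emeasure_eq_measure ennreal_mult)
qed

definition cover_bound :: "real \<Rightarrow> real \<Rightarrow> real \<Rightarrow> nat \<Rightarrow> real \<Rightarrow> real \<Rightarrow> real" where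
  "cover_bound I S \<epsilon> n Rc Rp =
    2 * 2 powr (real n * (I + \<epsilon> * S)) / (size_ix n Rc * size_ix n Rp) +
    2 * 2 powr (2 * real n * \<epsilon> * S) / size_ix n Rc +
    2 * 2 powr (2 * real n * \<epsilon> * S) / size_ix n Rp"

definition pack_bound :: "real \<Rightarrow> real \<Rightarrow> real \<Rightarrow> real \<Rightarrow> real \<Rightarrow> real \<Rightarrow> nat \<Rightarrow> real \<Rightarrow> real \<Rightarrow> real \<Rightarrow> real \<Rightarrow> real" where
  "pack_bound A B C D S \<epsilon> n R Rp Rc Rc' =
    size_ix n R * size_ix n Rp *
    (2 powr (- (real n * (A - \<epsilon> * S))) +
     size_ix n Rc * 2 powr (- (real n * (B - \<epsilon> * S))) +
     size_ix n Rc' * 2 powr (- (real n * (C - \<epsilon> * S))) +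
     size_ix n Rc * size_ix n Rc' * 2 powr (- (real n * (D - \<epsilon> * S))))"

context receiver
begin

lemma wrong_message_le:
  fixes Y :: "(nat \<Rightarrow> 'x) \<Rightarrow> (nat \<Rightarrow> 'd) \<Rightarrow> (nat \<Rightarrow> 'y) pmf" and q :: "nat \<Rightarrow> 'q"
  assumes \<epsilon>: "0 \<le> \<epsilon>"
  shows "(\<integral>\<^sup>+U. \<integral>\<^sup>+X. \<integral>\<^sup>+V. \<integral>\<^sup>+Z. \<integral>\<^sup>+y.
      (if \<exists>m'\<in>index_set n R - {m}. \<exists>lc\<in>index_set n Rc. \<exists>lp\<in>index_set n Rp. \<exists>lc'\<in>index_set n Rc'.
          (\<lambda>i. (q i, U lc i, X (m', lp) i, V lc' i, y i)) \<in> typical \<epsilon> n law then 1 else 0)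
      \<partial>measure_pmf (Y (send (index_set n Rc) (index_set n Rp) T m U X) (send (index_set n Rc') Lp' T' m2 V Z))
      \<partial>measure_pmf ZZ
      \<partial>measure_pmf (Pi_pmf (index_set n Rc') undefined (\<lambda>_. seq_pmf n (\<lambda>i. G (q i))))
      \<partial>measure_pmf (Pi_pmf (index_set n R \<times> index_set n Rp) undefined (\<lambda>_. seq_pmf n (\<lambda>i. map_pmf snd (K (q i)))))
      \<partial>measure_pmf (Pi_pmf (index_set n Rc) undefined (\<lambda>_. seq_pmf n (\<lambda>i. map_pmf fst (K (q i))))))
    \<le> ennreal (pack_bound rate_A rate_B rate_C rate_D spread \<epsilon> n R Rp Rc Rc')"
proof -
  note b = typical_law_le[OF \<epsilon>, where n=n and q=q]
  have "ennreal (pack_bound rate_A rate_B rate_C rate_D spread \<epsilon> n R Rp Rc Rc') =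
    of_nat (card (index_set n R) * card (index_set n Rp)) *
      (ennreal (2 powr (- (real n * (rate_A - \<epsilon> * spread)))) +
       of_nat (card (index_set n Rc)) * ennreal (2 powr (- (real n * (rate_B - \<epsilon> * spread)))) +
       of_nat (card (index_set n Rc')) * ennreal (2 powr (- (real n * (rate_C - \<epsilon> * spread)))) +
       of_nat (card (index_set n Rc) * card (index_set n Rc')) * ennreal (2 powr (- (real n * (rate_D - \<epsilon> * spread)))))"
    unfolding pack_bound_def ennreal_of_nat_eq_real_of_nat
    by (simp add: ennreal_mult[symmetric] ennreal_plus[symmetric] del: ennreal_plus)
  then show ?thesis
    by (simp only:) (rule packing_bound; (rule finite_index_set index_set_nonempty b)?)
qed

end

context interference_channel
begin

text \<open>Integrating out the channel leaves a function of the words alone, which can serve as the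
  weight \<open>F\<close> in \<open>selected_pair_law_le\<close>, once for each sender.\<close>

definition joint_failure :: "real \<Rightarrow> nat \<Rightarrow> (nat \<Rightarrow> 'q) \<Rightarrow> (nat \<Rightarrow> 'u1) \<Rightarrow> (nat \<Rightarrow> 'x1) \<Rightarrow> (nat \<Rightarrow> 'u2) \<Rightarrow> (nat \<Rightarrow> 'x2) \<Rightarrow> ennreal" where
  "joint_failure \<epsilon> n q u x v z = (\<integral>\<^sup>+y. (if (\<lambda>i. (q i, u i, x i, v i, z i, fst (y i), snd (y i))) \<in> typical \<epsilon> n J then 0 else 1)
     \<partial>measure_pmf (seq_pmf n (\<lambda>i. W (x i) (z i))))"

lemma joint_failure_cong:
  assumes "\<And>i. i < n \<Longrightarrow> u i = u' i \<and> x i = x' i" "\<And>i. i < n \<Longrightarrow> v i = v' i \<and> z i = z' i"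
  shows "joint_failure \<epsilon> n q u x v z = joint_failure \<epsilon> n q u' x' v' z'"
proof -
  have "seq_pmf n (\<lambda>i. W (x i) (z i)) = seq_pmf n (\<lambda>i. W (x' i) (z' i))"
    by (rule seq_pmf_cong) (simp add: assms)
  moreover have "(\<lambda>i. (q i, u i, x i, v i, z i, fst (y i), snd (y i))) \<in> typical \<epsilon> n J \<longleftrightarrow>
    (\<lambda>i. (q i, u' i, x' i, v' i, z' i, fst (y i), snd (y i))) \<in> typical \<epsilon> n J" for y
    by (rule typical_cong) (simp add: assms)
  ultimately show ?thesis by (simp add: joint_failure_def)
qed

lemma joint_failure_seq_J:
  "(\<integral>\<^sup>+q. \<integral>\<^sup>+a. \<integral>\<^sup>+b. joint_failure \<epsilon> n q (\<lambda>i. fst (a i)) (\<lambda>i. snd (a i)) (\<lambda>i. fst (b i)) (\<lambda>i. snd (b i))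
     \<partial>measure_pmf (seq_pmf n (\<lambda>i. K2 (q i))) \<partial>measure_pmf (seq_pmf n (\<lambda>i. K1 (q i))) \<partial>measure_pmf (seq_pmf n (\<lambda>_. pQ)))
   = ennreal (measure_pmf.prob (seq_pmf n (\<lambda>_. J)) {s. s \<notin> typical \<epsilon> n J})"
proof -
  have t: "trim n s \<in> typical \<epsilon> n J \<longleftrightarrow> s \<in> typical \<epsilon> n J" for s
    by (rule typical_cong) (simp add: trim_def)
  have "ennreal (measure_pmf.prob (seq_pmf n (\<lambda>_. J)) {s. s \<notin> typical \<epsilon> n J}) =
    (\<integral>\<^sup>+s. (if s \<in> typical \<epsilon> n J then 0 else 1) \<partial>measure_pmf (seq_pmf n (\<lambda>_. J)))"
  proof -
    have "(\<lambda>s. if s \<in> typical \<epsilon> n J then 0 else 1 :: ennreal) = indicator {s. s \<notin> typical \<epsilon> n J}"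
      by (auto simp: fun_eq_iff)
    then show ?thesis by (simp add: measure_pmf.emeasure_eq_measure)
  qed
  then show ?thesis unfolding seq_J by (simp add: t joint_failure_def)
qed

text \<open>An error needs a failed covering, an atypical outcome although both encoders succeeded,
  or a wrong message that passes a test. A \<open>q\<close> under which covering cannot be estimated
  is charged the trivial bound 1.\<close>

lemma error_given_le:
  fixes q :: "nat \<Rightarrow> 'q" and n m1 m2 :: nat and R1 R2 R1c R1p R2c R2p \<epsilon>' \<epsilon> :: real
  assumes \<epsilon>: "0 \<le> \<epsilon>'" "0 \<le> \<epsilon>" and m: "m1 \<in> index_set n R1" "m2 \<in> index_set n R2"
  defines "s1 \<equiv> encode n \<epsilon>' r1.source R1c R1p q" and "s2 \<equiv> encode n \<epsilon>' r2.source R2c R2p q"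
  defines "good1 \<equiv> 1 / 2 \<le> measure_pmf.prob (seq_pmf n (\<lambda>i. K1 (q i))) {s. (\<lambda>i. (q i, s i)) \<in> typical \<epsilon>' n r1.source}"
    and "good2 \<equiv> 1 / 2 \<le> measure_pmf.prob (seq_pmf n (\<lambda>i. K2 (q i))) {s. (\<lambda>i. (q i, s i)) \<in> typical \<epsilon>' n r2.source}"
  shows "(\<integral>\<^sup>+U1. \<integral>\<^sup>+X1. \<integral>\<^sup>+U2. \<integral>\<^sup>+X2. \<integral>\<^sup>+y.
      (if decode n \<epsilon> r1.law R1 R1c R1p R2c q U1 X1 U2 (\<lambda>i. fst (y i)) \<noteq> Some m1 \<or>
          decode n \<epsilon> r2.law R2 R2c R2p R1c q U2 X2 U1 (\<lambda>i. snd (y i)) \<noteq> Some m2 then 1 else 0)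
      \<partial>measure_pmf (seq_pmf n (\<lambda>i. W (s1 U1 X1 m1 i) (s2 U2 X2 m2 i)))
      \<partial>measure_pmf (codebook_pmf (index_set n R2 \<times> index_set n R2p) n (\<lambda>i. map_pmf snd (K2 (q i))))
      \<partial>measure_pmf (codebook_pmf (index_set n R2c) n (\<lambda>i. map_pmf fst (K2 (q i))))
      \<partial>measure_pmf (codebook_pmf (index_set n R1 \<times> index_set n R1p) n (\<lambda>i. map_pmf snd (K1 (q i))))
      \<partial>measure_pmf (codebook_pmf (index_set n R1c) n (\<lambda>i. map_pmf fst (K1 (q i)))))
    \<le> ((if good1 then 0 else 1) + ennreal (cover_bound r1.rate_I r1.spread \<epsilon>' n R1c R1p)) +
       ((if good2 then 0 else 1) + ennreal (cover_bound r2.rate_I r2.spread \<epsilon>' n R2c R2p)) +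
       of_nat (card (index_set n R1c) * card (index_set n R1p)) * (ennreal (2 powr (- (real n * (r1.rate_I - \<epsilon>' * r1.spread)))) *
         (of_nat (card (index_set n R2c) * card (index_set n R2p)) * (ennreal (2 powr (- (real n * (r2.rate_I - \<epsilon>' * r2.spread)))) *
         (\<integral>\<^sup>+a. \<integral>\<^sup>+b. joint_failure \<epsilon> n q (\<lambda>i. fst (a i)) (\<lambda>i. snd (a i)) (\<lambda>i. fst (b i)) (\<lambda>i. snd (b i))
          \<partial>measure_pmf (seq_pmf n (\<lambda>i. K2 (q i))) \<partial>measure_pmf (seq_pmf n (\<lambda>i. K1 (q i))))))) +
       ennreal (pack_bound r1.rate_A r1.rate_B r1.rate_C r1.rate_D r1.spread \<epsilon> n R1 R1p R1c R2c) +
       ennreal (pack_bound r2.rate_A r2.rate_B r2.rate_C r2.rate_D r2.spread \<epsilon> n R2 R2p R2c R1c)"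
    (is "_ \<le> ?bound")
proof -
  define L1 where "L1 = index_set n R1c"
  define L2 where "L2 = index_set n R2c"
  define P1 where "P1 = index_set n R1p"
  define P2 where "P2 = index_set n R2p"
  define M1 where "M1 = index_set n R1"
  define M2 where "M2 = index_set n R2"
  note sets = L1_def L2_def P1_def P2_def M1_def M2_def
  define T1 where "T1 u x \<longleftrightarrow> (\<lambda>i. (q i, u i, x i)) \<in> typical \<epsilon>' n r1.source" for u x
  define T2 where "T2 u x \<longleftrightarrow> (\<lambda>i. (q i, u i, x i)) \<in> typical \<epsilon>' n r2.source" for u x
  define CU1 where "CU1 = Pi_pmf L1 undefined (\<lambda>_. seq_pmf n (\<lambda>i. map_pmf fst (K1 (q i))))"
  define CX1 where "CX1 = Pi_pmf (M1 \<times> P1) undefined (\<lambda>_. seq_pmf n (\<lambda>i. map_pmf snd (K1 (q i))))"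
  define CU2 where "CU2 = Pi_pmf L2 undefined (\<lambda>_. seq_pmf n (\<lambda>i. map_pmf fst (K2 (q i))))"
  define CX2 where "CX2 = Pi_pmf (M2 \<times> P2) undefined (\<lambda>_. seq_pmf n (\<lambda>i. map_pmf snd (K2 (q i))))"
  note C_defs = CU1_def CX1_def CU2_def CX2_def
  have s1: "s1 U X m1 = send L1 P1 T1 m1 U X" for U X
    unfolding s1_def encode_eq_send L1_def P1_def T1_def ..
  have s2: "s2 U X m2 = send L2 P2 T2 m2 U X" for U X
    unfolding s2_def encode_eq_send L2_def P2_def T2_def ..
  define YY where "YY a b = seq_pmf n (\<lambda>i. W (a i) (b i))" for a b
  define c1 where "c1 U X \<longleftrightarrow> covered L1 P1 T1 U (\<lambda>b. X (m1, b))" for U and X :: "nat \<times> nat \<Rightarrow> nat \<Rightarrow> 'x1"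
  define c2 where "c2 U X \<longleftrightarrow> covered L2 P2 T2 U (\<lambda>b. X (m2, b))" for U and X :: "nat \<times> nat \<Rightarrow> nat \<Rightarrow> 'x2"
  define k1 where "k1 = coord L1 P1 T1 m1"
  define k2 where "k2 = coord L2 P2 T2 m2"
  define w1 where "w1 = send L1 P1 T1 m1"
  define w2 where "w2 = send L2 P2 T2 m2"
  define tJ where "tJ U1 X1 U2 X2 y \<longleftrightarrow>
    (\<lambda>i. (q i, U1 (k1 U1 X1) i, w1 U1 X1 i, U2 (k2 U2 X2) i, w2 U2 X2 i, fst (y i), snd (y i))) \<in> typical \<epsilon> n J" for U1 X1 U2 X2 y
  define p1 where "p1 U1 X1 U2 y \<longleftrightarrow> (\<exists>m'\<in>M1 - {m1}. \<exists>lc\<in>L1. \<exists>lp\<in>P1. \<exists>lc'\<in>L2.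
     (\<lambda>i. (q i, U1 lc i, X1 (m', lp) i, U2 lc' i, y i)) \<in> typical \<epsilon> n r1.law)" for U1 U2 :: "nat \<Rightarrow> nat \<Rightarrow> _" and X1 y
  define p2 where "p2 U2 X2 U1 y \<longleftrightarrow> (\<exists>m'\<in>M2 - {m2}. \<exists>lc\<in>L2. \<exists>lp\<in>P2. \<exists>lc'\<in>L1.
     (\<lambda>i. (q i, U2 lc i, X2 (m', lp) i, U1 lc' i, y i)) \<in> typical \<epsilon> n r2.law)" for U1 U2 :: "nat \<Rightarrow> nat \<Rightarrow> _" and X2 y
  define bad where "bad U1 X1 U2 X2 y \<longleftrightarrow>
      decode n \<epsilon> r1.law R1 R1c R1p R2c q U1 X1 U2 (\<lambda>i. fst (y i)) \<noteq> Some m1 \<or>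
      decode n \<epsilon> r2.law R2 R2c R2p R1c q U2 X2 U1 (\<lambda>i. snd (y i)) \<noteq> Some m2" for U1 X1 U2 X2 and y :: "nat \<Rightarrow> 'y1 \<times> 'y2"
  \<comment> \<open>Joint typicality of all seven selected, sent and received words passes to both
    marginals, so the right messages pass both tests at once.\<close>
  have imp: "\<not> c1 U1 X1 \<or> \<not> c2 U2 X2 \<or> (c1 U1 X1 \<and> c2 U2 X2 \<and> \<not> tJ U1 X1 U2 X2 y) \<or> p1 U1 X1 U2 (\<lambda>i. fst (y i)) \<or> p2 U2 X2 U1 (\<lambda>i. snd (y i))"
    if b: "bad U1 X1 U2 X2 y" for U1 X1 U2 X2 y
  proof (rule ccontr)
    assume "\<not> ?thesis"
    then have c: "c1 U1 X1" "c2 U2 X2" and t: "tJ U1 X1 U2 X2 y" and np: "\<not> p1 U1 X1 U2 (\<lambda>i. fst (y i))" "\<not> p2 U2 X2 U1 (\<lambda>i. snd (y i))" by blast+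
    note sc1 = select_covered[OF c(1)[unfolded c1_def]] and sc2 = select_covered[OF c(2)[unfolded c2_def]]
    have k: "k1 U1 X1 \<in> L1" "k2 U2 X2 \<in> L2" using sc1(1) sc2(1) by (simp_all add: k1_def k2_def coord_def)
    obtain b1 where b1: "b1 \<in> P1" "w1 U1 X1 = X1 (m1, b1)" using sc1(2) by (simp add: w1_def send_def)
    obtain b2 where b2: "b2 \<in> P2" "w2 U2 X2 = X2 (m2, b2)" using sc2(2) by (simp add: w2_def send_def)
    have "(\<lambda>i. (q i, U1 (k1 U1 X1) i, X1 (m1, b1) i, U2 (k2 U2 X2) i, fst (y i))) \<in> typical \<epsilon> n r1.law"
      using typical_map[OF t[unfolded tJ_def], of "\<lambda>w. (rvQ w, rvU1 w, rvX1 w, rvU2 w, rvY1 w)"]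
      by (simp add: law1 b1 del: prod.collapse)
    then have d1: "decode n \<epsilon> r1.law R1 R1c R1p R2c q U1 X1 U2 (\<lambda>i. fst (y i)) = Some m1"
      using np(1) k b1 m unfolding p1_def sets by (intro decode_eq_Some) auto
    have "(\<lambda>i. (q i, U2 (k2 U2 X2) i, X2 (m2, b2) i, U1 (k1 U1 X1) i, snd (y i))) \<in> typical \<epsilon> n r2.law"
      using typical_map[OF t[unfolded tJ_def], of "\<lambda>w. (rvQ w, rvU2 w, rvX2 w, rvU1 w, rvY2 w)"]
      by (simp add: law2 b2 del: prod.collapse)
    then have d2: "decode n \<epsilon> r2.law R2 R2c R2p R1c q U2 X2 U1 (\<lambda>i. snd (y i)) = Some m2"
      using np(2) k b2 m unfolding p2_def sets by (intro decode_eq_Some) auto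
    show False using b d1 d2 by (simp add: bad_def)
  qed
  define \<Omega> where "\<Omega> = bind_pmf CU1 (\<lambda>U1. bind_pmf CX1 (\<lambda>X1. bind_pmf CU2 (\<lambda>U2. bind_pmf CX2 (\<lambda>X2.
     map_pmf (\<lambda>y. (U1, X1, U2, X2, y)) (YY (w1 U1 X1) (w2 U2 X2))))))"
  define I where "I G = (\<integral>\<^sup>+U1. \<integral>\<^sup>+X1. \<integral>\<^sup>+U2. \<integral>\<^sup>+X2. \<integral>\<^sup>+y. G U1 X1 U2 X2 y
      \<partial>measure_pmf (YY (w1 U1 X1) (w2 U2 X2)) \<partial>measure_pmf CX2 \<partial>measure_pmf CU2 \<partial>measure_pmf CX1 \<partial>measure_pmf CU1)" for G :: "_ \<Rightarrow> _ \<Rightarrow> _ \<Rightarrow> _ \<Rightarrow> _ \<Rightarrow> ennreal"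
  have I\<Omega>: "I G = (\<integral>\<^sup>+w. (case w of (U1, X1, U2, X2, y) \<Rightarrow> G U1 X1 U2 X2 y) \<partial>measure_pmf \<Omega>)" for G
    by (simp add: I_def \<Omega>_def)
  have Iadd: "I (\<lambda>U1 X1 U2 X2 y. G U1 X1 U2 X2 y + G' U1 X1 U2 X2 y) = I G + I G'" for G G'
    unfolding I\<Omega> by (subst nn_integral_add[symmetric]) (auto simp: case_prod_unfold)
  have Imono: "I G \<le> I G'" if "\<And>U1 X1 U2 X2 y. G U1 X1 U2 X2 y \<le> G' U1 X1 U2 X2 y" for G G'
    unfolding I_def by (intro nn_integral_mono that)
  have "I (\<lambda>U1 X1 U2 X2 y. if bad U1 X1 U2 X2 y then 1 else 0) \<le>
    I (\<lambda>U1 X1 U2 X2 y. (if c1 U1 X1 then 0 else 1) + (if c2 U2 X2 then 0 else 1) +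
      (if c1 U1 X1 then if c2 U2 X2 then if tJ U1 X1 U2 X2 y then 0 else 1 else 0 else 0) +
      (if p1 U1 X1 U2 (\<lambda>i. fst (y i)) then 1 else 0) + (if p2 U2 X2 U1 (\<lambda>i. snd (y i)) then 1 else 0))"
  proof (rule Imono)
    fix U1 X1 U2 X2 y
    show "(if bad U1 X1 U2 X2 y then 1 else 0 :: ennreal) \<le> (if c1 U1 X1 then 0 else 1) + (if c2 U2 X2 then 0 else 1) +
      (if c1 U1 X1 then if c2 U2 X2 then if tJ U1 X1 U2 X2 y then 0 else 1 else 0 else 0) +
      (if p1 U1 X1 U2 (\<lambda>i. fst (y i)) then 1 else 0) + (if p2 U2 X2 U1 (\<lambda>i. snd (y i)) then 1 else 0)"
      using imp[of U1 X1 U2 X2 y] by (auto simp: add_increasing add_increasing2)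
  qed
  also have "\<dots> = I (\<lambda>U1 X1 U2 X2 y. if c1 U1 X1 then 0 else 1) + I (\<lambda>U1 X1 U2 X2 y. if c2 U2 X2 then 0 else 1) +
      I (\<lambda>U1 X1 U2 X2 y. if c1 U1 X1 then if c2 U2 X2 then if tJ U1 X1 U2 X2 y then 0 else 1 else 0 else 0) +
      I (\<lambda>U1 X1 U2 X2 y. if p1 U1 X1 U2 (\<lambda>i. fst (y i)) then 1 else 0) + I (\<lambda>U1 X1 U2 X2 y. if p2 U2 X2 U1 (\<lambda>i. snd (y i)) then 1 else 0)"
    by (simp only: Iadd)
  also have "\<dots> \<le> ?bound"
  proof (intro add_mono)
    have I_le: "I (\<lambda>U1 X1 U2 X2 y. if c U1 X1 U2 X2 then 0 else 1) \<le> (if H then 0 else 1) + ennreal b"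
      if "H \<Longrightarrow> I (\<lambda>U1 X1 U2 X2 y. if c U1 X1 U2 X2 then 0 else 1) \<le> ennreal b" for c H b
    proof (cases H)
      case False
      have "I (\<lambda>U1 X1 U2 X2 y. if c U1 X1 U2 X2 then 0 else 1) \<le> 1"
        unfolding I_def by (intro nn_integral_pmf_le_const) simp
      then show ?thesis using False by (simp add: add_increasing2)
    qed (use that in simp)
    show "I (\<lambda>U1 X1 U2 X2 y. if c1 U1 X1 then 0 else 1) \<le> (if good1 then 0 else 1) + ennreal (cover_bound r1.rate_I r1.spread \<epsilon>' n R1c R1p)"
    proof (rule I_le)
      assume good: good1
      have "I (\<lambda>U1 X1 U2 X2 y. if c1 U1 X1 then 0 else 1) =
          (\<integral>\<^sup>+U. \<integral>\<^sup>+X. (if c1 U X then 0 else 1) \<partial>measure_pmf CX1 \<partial>measure_pmf CU1)"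
        by (simp add: I_def)
      also have "\<dots> \<le> ennreal (cover_bound r1.rate_I r1.spread \<epsilon>' n R1c R1p)"
        unfolding c1_def T1_def CU1_def CX1_def cover_bound_def sets
        by (rule r1.covering_failure_le[OF \<epsilon>(1) finite_index_set finite_index_set finite_index_set
            index_set_nonempty index_set_nonempty m(1) good[unfolded good1_def]])
      finally show "I (\<lambda>U1 X1 U2 X2 y. if c1 U1 X1 then 0 else 1) \<le> \<dots>" .
    qed
    show "I (\<lambda>U1 X1 U2 X2 y. if c2 U2 X2 then 0 else 1) \<le> (if good2 then 0 else 1) + ennreal (cover_bound r2.rate_I r2.spread \<epsilon>' n R2c R2p)"
    proof (rule I_le)
      assume good: good2
      have "I (\<lambda>U1 X1 U2 X2 y. if c2 U2 X2 then 0 else 1) =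
          (\<integral>\<^sup>+U. \<integral>\<^sup>+X. (if c2 U X then 0 else 1) \<partial>measure_pmf CX2 \<partial>measure_pmf CU2)"
        by (simp add: I_def)
      also have "\<dots> \<le> ennreal (cover_bound r2.rate_I r2.spread \<epsilon>' n R2c R2p)"
        unfolding c2_def T2_def CU2_def CX2_def cover_bound_def sets
        by (rule r2.covering_failure_le[OF \<epsilon>(1) finite_index_set finite_index_set finite_index_set
            index_set_nonempty index_set_nonempty m(2) good[unfolded good2_def]])
      finally show "I (\<lambda>U1 X1 U2 X2 y. if c2 U2 X2 then 0 else 1) \<le> \<dots>" .
    qed
    show "I (\<lambda>U1 X1 U2 X2 y. if p1 U1 X1 U2 (\<lambda>i. fst (y i)) then 1 else 0) \<le>
        ennreal (pack_bound r1.rate_A r1.rate_B r1.rate_C r1.rate_D r1.spread \<epsilon> n R1 R1p R1c R2c)"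
      using r1.wrong_message_le[OF \<epsilon>(2), where n=n and q=q and R=R1 and Rc=R1c and Rp=R1p and Rc'=R2c and m=m1 and T=T1
          and Y="\<lambda>a b. map_pmf (\<lambda>y i. fst (y i)) (YY a b)" and ZZ=CX2 and Lp'=P2 and T'=T2 and ?m2.0=m2]
      unfolding I_def p1_def w1_def w2_def CU1_def CX1_def CU2_def sets by simp
    \<comment> \<open>Receiver 2 sees the senders in exchanged roles, so its own codebooks have to
      be integrated outermost.\<close>
    have "I (\<lambda>U1 X1 U2 X2 y. if p2 U2 X2 U1 (\<lambda>i. snd (y i)) then 1 else 0) =
      (\<integral>\<^sup>+U2. \<integral>\<^sup>+X2. \<integral>\<^sup>+U1. \<integral>\<^sup>+X1. \<integral>\<^sup>+y. (if p2 U2 X2 U1 (\<lambda>i. snd (y i)) then 1 else 0)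
      \<partial>measure_pmf (YY (w1 U1 X1) (w2 U2 X2)) \<partial>measure_pmf CX1 \<partial>measure_pmf CU1 \<partial>measure_pmf CX2 \<partial>measure_pmf CU2)"
      unfolding I_def by (rule nn_integral_pmf_swap2)
    also have "\<dots> \<le> ennreal (pack_bound r2.rate_A r2.rate_B r2.rate_C r2.rate_D r2.spread \<epsilon> n R2 R2p R2c R1c)"
      using r2.wrong_message_le[OF \<epsilon>(2), where n=n and q=q and R=R2 and Rc=R2c and Rp=R2p and Rc'=R1c and m=m2 and T=T2
          and Y="\<lambda>b a. map_pmf (\<lambda>y i. snd (y i)) (YY a b)" and ZZ=CX1 and Lp'=P1 and T'=T1 and ?m2.0=m1]
      unfolding p2_def w1_def w2_def CU1_def CX2_def CU2_def sets by simp
    finally show "I (\<lambda>U1 X1 U2 X2 y. if p2 U2 X2 U1 (\<lambda>i. snd (y i)) then 1 else 0) \<le> \<dots>" .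
    let ?B1 = "ennreal (2 powr (- (real n * (r1.rate_I - \<epsilon>' * r1.spread))))"
    let ?B2 = "ennreal (2 powr (- (real n * (r2.rate_I - \<epsilon>' * r2.spread))))"
    \<comment> \<open>The density bound is applied twice: for sender 2 with the words of sender 1
      held fixed, and then for sender 1 with the resulting bound as weight.\<close>
    define F1 where "F1 u x = of_nat (card L2 * card P2) * (?B2 * (\<integral>\<^sup>+b. joint_failure \<epsilon> n q u x (\<lambda>i. fst (b i)) (\<lambda>i. snd (b i))
          \<partial>measure_pmf (seq_pmf n (\<lambda>i. K2 (q i)))))" for u x
    have "I (\<lambda>U1 X1 U2 X2 y. if c1 U1 X1 then if c2 U2 X2 then if tJ U1 X1 U2 X2 y then 0 else 1 else 0 else 0)
      = (\<integral>\<^sup>+U1. \<integral>\<^sup>+X1. (if c1 U1 X1 then \<integral>\<^sup>+U2. \<integral>\<^sup>+X2. (if c2 U2 X2 then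
          joint_failure \<epsilon> n q (U1 (k1 U1 X1)) (w1 U1 X1) (U2 (k2 U2 X2)) (w2 U2 X2) else 0)
          \<partial>measure_pmf CX2 \<partial>measure_pmf CU2 else 0) \<partial>measure_pmf CX1 \<partial>measure_pmf CU1)"
      unfolding I_def by (simp add: nn_integral_if_const tJ_def joint_failure_def YY_def cong: if_cong)
    also have "\<dots> \<le> (\<integral>\<^sup>+U1. \<integral>\<^sup>+X1. (if c1 U1 X1 then F1 (U1 (k1 U1 X1)) (w1 U1 X1) else 0) \<partial>measure_pmf CX1 \<partial>measure_pmf CU1)"
    proof (intro nn_integral_mono)
      fix U1 X1
      have "(\<integral>\<^sup>+U2. \<integral>\<^sup>+X2. (if c2 U2 X2 then joint_failure \<epsilon> n q u x (U2 (k2 U2 X2)) (w2 U2 X2) else 0)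
          \<partial>measure_pmf CX2 \<partial>measure_pmf CU2) \<le> F1 u x" for u x
        unfolding F1_def c2_def k2_def w2_def CX2_def CU2_def sets T2_def
        by (rule r2.selected_pair_law_le[OF \<epsilon>(1) finite_index_set finite_index_set finite_index_set m(2)])
          (rule joint_failure_cong, simp_all)
      then show "(if c1 U1 X1 then \<integral>\<^sup>+U2. \<integral>\<^sup>+X2. (if c2 U2 X2 then
          joint_failure \<epsilon> n q (U1 (k1 U1 X1)) (w1 U1 X1) (U2 (k2 U2 X2)) (w2 U2 X2) else 0)
          \<partial>measure_pmf CX2 \<partial>measure_pmf CU2 else 0) \<le> (if c1 U1 X1 then F1 (U1 (k1 U1 X1)) (w1 U1 X1) else 0)" by simp
    qed
    also have "\<dots> \<le> of_nat (card L1 * card P1) * (?B1 * (\<integral>\<^sup>+a. F1 (\<lambda>i. fst (a i)) (\<lambda>i. snd (a i)) \<partial>measure_pmf (seq_pmf n (\<lambda>i. K1 (q i)))))"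
      unfolding c1_def k1_def w1_def CX1_def CU1_def sets T1_def
    proof (rule r1.selected_pair_law_le[OF \<epsilon>(1) finite_index_set finite_index_set finite_index_set m(1)])
      fix u u' :: "nat \<Rightarrow> 'u1" and x x' :: "nat \<Rightarrow> 'x1" assume "\<And>i. i < n \<Longrightarrow> u i = u' i \<and> x i = x' i"
      then have "joint_failure \<epsilon> n q u x v z = joint_failure \<epsilon> n q u' x' v z" for v z
        by (intro joint_failure_cong) auto
      then show "F1 u x = F1 u' x'" by (simp add: F1_def)
    qed
    also have "\<dots> = of_nat (card (index_set n R1c) * card (index_set n R1p)) * (?B1 *
         (of_nat (card (index_set n R2c) * card (index_set n R2p)) * (?B2 *
         (\<integral>\<^sup>+a. \<integral>\<^sup>+b. joint_failure \<epsilon> n q (\<lambda>i. fst (a i)) (\<lambda>i. snd (a i)) (\<lambda>i. fst (b i)) (\<lambda>i. snd (b i))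
          \<partial>measure_pmf (seq_pmf n (\<lambda>i. K2 (q i))) \<partial>measure_pmf (seq_pmf n (\<lambda>i. K1 (q i)))))))"
      unfolding F1_def sets by (simp add: nn_integral_cmult)
    finally show "I (\<lambda>U1 X1 U2 X2 y. if c1 U1 X1 then if c2 U2 X2 then if tJ U1 X1 U2 X2 y then 0 else 1 else 0 else 0) \<le> \<dots>" .
  qed
  finally show ?thesis
    unfolding I_def bad_def C_defs sets YY_def w1_def w2_def codebook_pmf_def s1 s2 .
qed

end

section \<open>Averaging over q, asymptotics and choice of the rates\<close>

section \<open>Error probability and rate region\<close>

lemma nn_integral_pmf_swap4:
  fixes f :: "'a \<Rightarrow> 'b \<Rightarrow> 'c \<Rightarrow> 'd \<Rightarrow> 'e \<Rightarrow> 'f \<Rightarrow> ennreal"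
  shows "(\<integral>\<^sup>+a. \<integral>\<^sup>+b. \<integral>\<^sup>+c. \<integral>\<^sup>+d. \<integral>\<^sup>+e. \<integral>\<^sup>+g. f a b c d e g \<partial>measure_pmf G \<partial>measure_pmf E \<partial>measure_pmf D \<partial>measure_pmf C \<partial>measure_pmf B \<partial>measure_pmf A) =
         (\<integral>\<^sup>+e. \<integral>\<^sup>+g. \<integral>\<^sup>+a. \<integral>\<^sup>+b. \<integral>\<^sup>+c. \<integral>\<^sup>+d. f a b c d e g \<partial>measure_pmf D \<partial>measure_pmf C \<partial>measure_pmf B \<partial>measure_pmf A \<partial>measure_pmf G \<partial>measure_pmf E)"
  using nn_integral_pmf_swap[where f="\<lambda>x y. f (fst x) (fst (snd x)) (fst (snd (snd x))) (snd (snd (snd x))) (fst y) (snd y)"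
      and N="pair_pmf E G" and M="pair_pmf A (pair_pmf B (pair_pmf C D))"]
  by (simp add: nn_integral_pair_pmf')

lemma pack_bound_nonneg: "0 \<le> pack_bound A B C D S \<epsilon> n R Rp Rc Rc'"
  unfolding pack_bound_def by (intro mult_nonneg_nonneg add_nonneg_nonneg) auto

lemma cover_bound_nonneg: "0 \<le> cover_bound I S \<epsilon> n Rc Rp"
  unfolding cover_bound_def by (intro add_nonneg_nonneg divide_nonneg_nonneg) auto

context interference_channel
begin

lemma multicoding_error_le:
  assumes \<epsilon>: "0 \<le> \<epsilon>'" "0 \<le> \<epsilon>"
  shows "multicoding_error pQ K1 K2 W R1 R2 R1c R1p R2c R2p \<epsilon>' \<epsilon> n \<le>
    (2 * measure_pmf.prob (seq_pmf n (\<lambda>_. r1.source)) {s. s \<notin> typical \<epsilon>' n r1.source} + cover_bound r1.rate_I r1.spread \<epsilon>' n R1c R1p) +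
    (2 * measure_pmf.prob (seq_pmf n (\<lambda>_. r2.source)) {s. s \<notin> typical \<epsilon>' n r2.source} + cover_bound r2.rate_I r2.spread \<epsilon>' n R2c R2p) +
    (size_ix n R1c * size_ix n R1p) * (2 powr (- (real n * (r1.rate_I - \<epsilon>' * r1.spread))) *
      ((size_ix n R2c * size_ix n R2p) * (2 powr (- (real n * (r2.rate_I - \<epsilon>' * r2.spread))) *
       measure_pmf.prob (seq_pmf n (\<lambda>_. J)) {s. s \<notin> typical \<epsilon> n J}))) +
    pack_bound r1.rate_A r1.rate_B r1.rate_C r1.rate_D r1.spread \<epsilon> n R1 R1p R1c R2c +
    pack_bound r2.rate_A r2.rate_B r2.rate_C r2.rate_D r2.spread \<epsilon> n R2 R2p R2c R1c"
    (is "_ \<le> (2 * ?p1 + ?c1) + (2 * ?p2 + ?c2) + ?j + ?k1 + ?k2")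
proof -
  define JF where "JF q = (\<integral>\<^sup>+a. \<integral>\<^sup>+b. joint_failure \<epsilon> n q (\<lambda>i. fst (a i)) (\<lambda>i. snd (a i)) (\<lambda>i. fst (b i)) (\<lambda>i. snd (b i))
          \<partial>measure_pmf (seq_pmf n (\<lambda>i. K2 (q i))) \<partial>measure_pmf (seq_pmf n (\<lambda>i. K1 (q i))))" for q
  define err where "err q U1 X1 U2 X2 m1 m2 = (\<integral>\<^sup>+y.
      (if decode n \<epsilon> r1.law R1 R1c R1p R2c q U1 X1 U2 (\<lambda>i. fst (y i)) \<noteq> Some m1 \<or>
          decode n \<epsilon> r2.law R2 R2c R2p R1c q U2 X2 U1 (\<lambda>i. snd (y i)) \<noteq> Some m2 then 1 else 0)
      \<partial>measure_pmf (seq_pmf n (\<lambda>i. W (encode n \<epsilon>' r1.source R1c R1p q U1 X1 m1 i) (encode n \<epsilon>' r2.source R2c R2p q U2 X2 m2 i))))" for q U1 X1 U2 X2 m1 m2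
  define g1 where "g1 q = (if 1 / 2 \<le> measure_pmf.prob (seq_pmf n (\<lambda>i. K1 (q i))) {s. (\<lambda>i. (q i, s i)) \<in> typical \<epsilon>' n r1.source} then 0 else 1 :: ennreal)" for q
  define g2 where "g2 q = (if 1 / 2 \<le> measure_pmf.prob (seq_pmf n (\<lambda>i. K2 (q i))) {s. (\<lambda>i. (q i, s i)) \<in> typical \<epsilon>' n r2.source} then 0 else 1 :: ennreal)" for q
  let ?n1 = "of_nat (card (index_set n R1c) * card (index_set n R1p)) :: ennreal"
  let ?n2 = "of_nat (card (index_set n R2c) * card (index_set n R2p)) :: ennreal"
  let ?b1 = "2 powr (- (real n * (r1.rate_I - \<epsilon>' * r1.spread)))"
  let ?b2 = "2 powr (- (real n * (r2.rate_I - \<epsilon>' * r2.spread)))"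
  define B where "B q = (g1 q + ennreal ?c1) + (g2 q + ennreal ?c2) + ?n1 * (ennreal ?b1 * (?n2 * (ennreal ?b2 * JF q))) + ennreal ?k1 + ennreal ?k2" for q
  let ?E = "{(m1, m2, d1, d2). d1 \<noteq> Some m1 \<or> d2 \<noteq> Some m2} :: (nat \<times> nat \<times> nat option \<times> nat option) set"
  have "ennreal (multicoding_error pQ K1 K2 W R1 R2 R1c R1p R2c R2p \<epsilon>' \<epsilon> n) =
    emeasure (multicoding_pmf pQ K1 K2 W R1 R2 R1c R1p R2c R2p \<epsilon>' \<epsilon> n) ?E"
    by (simp add: multicoding_error_def measure_pmf.emeasure_eq_measure)
  also have "\<dots> = (\<integral>\<^sup>+q. \<integral>\<^sup>+U1. \<integral>\<^sup>+X1. \<integral>\<^sup>+U2. \<integral>\<^sup>+X2. \<integral>\<^sup>+m1. \<integral>\<^sup>+m2. err q U1 X1 U2 X2 m1 m2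
      \<partial>measure_pmf (pmf_of_set (index_set n R2)) \<partial>measure_pmf (pmf_of_set (index_set n R1))
      \<partial>measure_pmf (codebook_pmf (index_set n R2 \<times> index_set n R2p) n (\<lambda>i. map_pmf snd (K2 (q i))))
      \<partial>measure_pmf (codebook_pmf (index_set n R2c) n (\<lambda>i. map_pmf fst (K2 (q i))))
      \<partial>measure_pmf (codebook_pmf (index_set n R1 \<times> index_set n R1p) n (\<lambda>i. map_pmf snd (K1 (q i))))
      \<partial>measure_pmf (codebook_pmf (index_set n R1c) n (\<lambda>i. map_pmf fst (K1 (q i))))
      \<partial>measure_pmf (seq_pmf n (\<lambda>_. pQ)))"
    unfolding multicoding_pmf_def Let_def J_def[symmetric] law1[symmetric] law2[symmetric] source1[symmetric] source2[symmetric]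
    by (simp add: err_def indicator_def of_bool_def)
  also have "\<dots> = (\<integral>\<^sup>+q. \<integral>\<^sup>+m1. \<integral>\<^sup>+m2. \<integral>\<^sup>+U1. \<integral>\<^sup>+X1. \<integral>\<^sup>+U2. \<integral>\<^sup>+X2. err q U1 X1 U2 X2 m1 m2
      \<partial>measure_pmf (codebook_pmf (index_set n R2 \<times> index_set n R2p) n (\<lambda>i. map_pmf snd (K2 (q i))))
      \<partial>measure_pmf (codebook_pmf (index_set n R2c) n (\<lambda>i. map_pmf fst (K2 (q i))))
      \<partial>measure_pmf (codebook_pmf (index_set n R1 \<times> index_set n R1p) n (\<lambda>i. map_pmf snd (K1 (q i))))
      \<partial>measure_pmf (codebook_pmf (index_set n R1c) n (\<lambda>i. map_pmf fst (K1 (q i))))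
      \<partial>measure_pmf (pmf_of_set (index_set n R2)) \<partial>measure_pmf (pmf_of_set (index_set n R1))
      \<partial>measure_pmf (seq_pmf n (\<lambda>_. pQ)))"
    \<comment> \<open>With the messages drawn before the codebooks, the conditional bound applies;
      it is the same for all messages, so their law no longer matters.\<close>
    by (intro nn_integral_cong nn_integral_pmf_swap4)
  also have "\<dots> \<le> (\<integral>\<^sup>+q. B q \<partial>measure_pmf (seq_pmf n (\<lambda>_. pQ)))"
    unfolding B_def g1_def g2_def JF_def err_def
    by (rule nn_integral_mono, rule nn_integral_pmf_le_const, rule nn_integral_pmf_le_const)
      (rule error_given_le[OF \<epsilon>], simp_all add: set_pmf_of_set)
  also have "\<dots> = ((\<integral>\<^sup>+q. g1 q \<partial>measure_pmf (seq_pmf n (\<lambda>_. pQ))) + ennreal ?c1) + ((\<integral>\<^sup>+q. g2 q \<partial>measure_pmf (seq_pmf n (\<lambda>_. pQ))) + ennreal ?c2) +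
     ?n1 * (ennreal ?b1 * (?n2 * (ennreal ?b2 * (\<integral>\<^sup>+q. JF q \<partial>measure_pmf (seq_pmf n (\<lambda>_. pQ)))))) + ennreal ?k1 + ennreal ?k2"
    unfolding B_def by (simp add: nn_integral_add nn_integral_cmult)
  also have "\<dots> \<le> (ennreal (2 * ?p1) + ennreal ?c1) + (ennreal (2 * ?p2) + ennreal ?c2) +
     ?n1 * (ennreal ?b1 * (?n2 * (ennreal ?b2 * ennreal (measure_pmf.prob (seq_pmf n (\<lambda>_. J)) {s. s \<notin> typical \<epsilon> n J})))) + ennreal ?k1 + ennreal ?k2"
    unfolding JF_def joint_failure_seq_J g1_def g2_def
    by (intro add_mono order_refl r1.bad_time_sharing_le r2.bad_time_sharing_le)
  also have "\<dots> = ennreal ((2 * ?p1 + ?c1) + (2 * ?p2 + ?c2) + ?j + ?k1 + ?k2)"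
    unfolding ennreal_of_nat_eq_real_of_nat
    by (simp add: ennreal_mult[symmetric] ennreal_plus[symmetric] pack_bound_nonneg cover_bound_nonneg del: ennreal_plus)
  finally show ?thesis
    by (subst (asm) ennreal_le_iff) (auto intro!: add_nonneg_nonneg pack_bound_nonneg cover_bound_nonneg)
qed

end

section \<open>Exponential decay of the covering and packing bounds\<close>

lemma exp_decay_tendsto_0:
  assumes "0 < \<delta>" "\<And>n. 0 \<le> f n" "\<And>n. f n \<le> K * 2 powr (- (real n * \<delta>))"
  shows "f \<longlonglongrightarrow> (0::real)"
proof (rule tendsto_sandwich)
  show "\<forall>\<^sub>F n in sequentially. 0 \<le> f n" "\<forall>\<^sub>F n in sequentially. f n \<le> K * (2 powr (- \<delta>)) ^ n"
    using assms by (auto simp: powr_realpow[symmetric] powr_powr mult.commute)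
  have "2 powr (- \<delta>) < 2 powr (0::real)" using assms by (intro powr_less_mono) auto
  then have "(\<lambda>n. (2 powr (- \<delta>)) ^ n) \<longlonglongrightarrow> (0::real)" by (intro LIMSEQ_power_zero) simp
  then show "(\<lambda>n. K * (2 powr (- \<delta>)) ^ n) \<longlonglongrightarrow> 0" by (rule tendsto_mult_right_zero)
qed simp

lemma cover_bound_tendsto_0:
  assumes "I + \<epsilon> * S < Rc + Rp" "2 * \<epsilon> * S < Rc" "2 * \<epsilon> * S < Rp"
  shows "(\<lambda>n. cover_bound I S \<epsilon> n Rc Rp) \<longlonglongrightarrow> 0"
proof -
  have div: "a / b \<le> a / b'" if "0 \<le> a" "0 < b'" "b' \<le> b" for a b b' :: real
    using that by (simp add: frac_le)
  have quot: "2 * 2 powr a / 2 powr b = 2 * 2 powr (a - b)" for a b :: real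
    by (simp add: powr_diff)
  note ge = card_index_set_ge
  have A: "(\<lambda>n. 2 * 2 powr (real n * (I + \<epsilon> * S)) / (size_ix n Rc * size_ix n Rp)) \<longlonglongrightarrow> 0"
  proof (rule exp_decay_tendsto_0[where K=2 and \<delta>="Rc + Rp - (I + \<epsilon> * S)"])
    fix n
    have "2 * 2 powr (real n * (I + \<epsilon> * S)) / (size_ix n Rc * size_ix n Rp) \<le>
      2 * 2 powr (real n * (I + \<epsilon> * S)) / (2 powr (real n * Rc) * 2 powr (real n * Rp))"
      by (intro div mult_mono ge) auto
    also have "\<dots> = 2 * 2 powr (- (real n * (Rc + Rp - (I + \<epsilon> * S))))"
      unfolding powr_add[symmetric] quot by (simp add: algebra_simps)
    finally show "2 * 2 powr (real n * (I + \<epsilon> * S)) / (size_ix n Rc * size_ix n Rp) \<le> \<dots>" .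
  qed (use assms in auto)
  have B: "(\<lambda>n. 2 * 2 powr (2 * real n * \<epsilon> * S) / size_ix n R) \<longlonglongrightarrow> 0" if "2 * \<epsilon> * S < R" for R
  proof (rule exp_decay_tendsto_0[where K=2 and \<delta>="R - 2 * \<epsilon> * S"])
    fix n
    have "2 * 2 powr (2 * real n * \<epsilon> * S) / size_ix n R \<le> 2 * 2 powr (2 * real n * \<epsilon> * S) / 2 powr (real n * R)"
      by (intro div ge) auto
    also have "\<dots> = 2 * 2 powr (- (real n * (R - 2 * \<epsilon> * S)))"
      unfolding quot by (simp add: algebra_simps)
    finally show "2 * 2 powr (2 * real n * \<epsilon> * S) / size_ix n R \<le> \<dots>" .
  qed (use that in auto)
  show ?thesis unfolding cover_bound_def
    using tendsto_add[OF tendsto_add[OF A B[OF assms(2)]] B[OF assms(3)]] by simp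
qed

lemma pack_bound_tendsto_0:
  assumes nn: "0 \<le> R" "0 \<le> Rp" "0 \<le> Rc" "0 \<le> Rc'"
    and lt: "R + Rp < A - \<epsilon> * S" "R + Rp + Rc < B - \<epsilon> * S" "R + Rp + Rc' < C - \<epsilon> * S" "R + Rp + Rc + Rc' < D - \<epsilon> * S"
  shows "(\<lambda>n. pack_bound A B C D S \<epsilon> n R Rp Rc Rc') \<longlonglongrightarrow> 0"
proof -
  let ?c = "\<lambda>n R. size_ix n R"
  note le = card_index_set_le
  have pw: "2 powr (real n * s) * 2 powr (- (real n * t)) = 2 powr (- (real n * (t - s)))" for n s t
    by (simp add: powr_add[symmetric] algebra_simps)
  have pa: "2 powr (real n * s) * 2 powr (real n * t) = 2 powr (real n * (s + t))" for n s t
    by (simp add: powr_add[symmetric] algebra_simps)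
  have step: "X * 2 powr (- (real n * t)) \<le> k * 2 powr (- (real n * (t - s)))"
    if "X \<le> k * 2 powr (real n * s)" for X k n s t
    using mult_right_mono[OF that, of "2 powr (- (real n * t))"] by (simp only: mult.assoc pw powr_ge_zero simp_thms)
  \<comment> \<open>Each index set has at most 2 * 2^(nR) elements, so products of two, three and
    four sizes give the constants 4, 8 and 16.\<close>
  have c2: "?c n R * ?c n Rp \<le> 4 * 2 powr (real n * (R + Rp))" for n
    using mult_mono[OF le[OF nn(1), of n] le[OF nn(2), of n]] by (simp add: pa)
  have t0: "(\<lambda>n. ?c n R * ?c n Rp * 2 powr (- (real n * (A - \<epsilon> * S)))) \<longlonglongrightarrow> 0"
  proof (rule exp_decay_tendsto_0[where K=4 and \<delta>="A - \<epsilon> * S - (R + Rp)"])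
    fix n
    show "?c n R * ?c n Rp * 2 powr (- (real n * (A - \<epsilon> * S))) \<le> 4 * 2 powr (- (real n * (A - \<epsilon> * S - (R + Rp))))"
      by (rule step[OF c2])
  qed (use lt in auto)
  have t1: "(\<lambda>n. ?c n R * ?c n Rp * (?c n r * 2 powr (- (real n * (B - \<epsilon> * S))))) \<longlonglongrightarrow> 0"
    if r: "0 \<le> r" "R + Rp + r < B - \<epsilon> * S" for r B
  proof (rule exp_decay_tendsto_0[where K=8 and \<delta>="B - \<epsilon> * S - (R + Rp + r)"])
    fix n
    have "?c n R * ?c n Rp * ?c n r \<le> 8 * 2 powr (real n * (R + Rp + r))"
      using mult_mono[OF c2[of n] le[OF r(1), of n]] by (simp add: pa)
    from step[OF this, of "B - \<epsilon> * S"]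
    show "?c n R * ?c n Rp * (?c n r * 2 powr (- (real n * (B - \<epsilon> * S)))) \<le> 8 * 2 powr (- (real n * (B - \<epsilon> * S - (R + Rp + r))))"
      by (simp only: mult.assoc)
  qed (use r in auto)
  have t2: "(\<lambda>n. ?c n R * ?c n Rp * (?c n Rc * ?c n Rc' * 2 powr (- (real n * (D - \<epsilon> * S))))) \<longlonglongrightarrow> 0"
  proof (rule exp_decay_tendsto_0[where K=16 and \<delta>="D - \<epsilon> * S - (R + Rp + (Rc + Rc'))"])
    fix n
    have "?c n Rc * ?c n Rc' \<le> 4 * 2 powr (real n * (Rc + Rc'))"
      using mult_mono[OF le[OF nn(3), of n] le[OF nn(4), of n]] by (simp add: pa)
    from mult_mono[OF c2[of n] this]
    have "?c n R * ?c n Rp * (?c n Rc * ?c n Rc') \<le> 16 * 2 powr (real n * (R + Rp + (Rc + Rc')))"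
      by (simp add: pa)
    from step[OF this, of "D - \<epsilon> * S"]
    show "?c n R * ?c n Rp * (?c n Rc * ?c n Rc' * 2 powr (- (real n * (D - \<epsilon> * S)))) \<le> 16 * 2 powr (- (real n * (D - \<epsilon> * S - (R + Rp + (Rc + Rc')))))"
      by (simp only: mult.assoc)
  qed (use lt in auto)
  show ?thesis unfolding pack_bound_def distrib_left
    using tendsto_add[OF tendsto_add[OF tendsto_add[OF t0 t1[OF nn(3) lt(2)]] t1[OF nn(4) lt(3)]] t2] by simp
qed

section \<open>Fourier-Motzkin elimination of the rate split\<close>

lemma ex_between_box:
  fixes L U I :: real
  assumes "L < U" "L < I" "0 < U" "0 \<le> I"
  shows "\<exists>r. 0 \<le> r \<and> r \<le> I \<and> L < r \<and> r < U"
proof -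
  \<comment> \<open>The midpoint works also for \<open>I = 0\<close>, where the closed interval
    shrinks to zero; this is the case of no dependence between \<open>U\<close> and
    \<open>X\<close>.\<close>
  define r where "r = (max 0 L + min I U) / 2"
  have "0 \<le> r \<and> r \<le> I \<and> L < r \<and> r < U"
    using assms by (auto simp: r_def max_def min_def field_simps)
  then show ?thesis ..
qed

text \<open>Solving for \<open>r1\<close> first pairs its lower bounds 0, R1 - a1, R1 + r2 - c1 with
  its upper bounds I1, c2 - R2 + r2, d2 - R2. The pairs free of \<open>r2\<close> are given or
  implied by data processing; the others are bounds on \<open>r2\<close>, and pairing these again
  gives the remaining rate conditions or consequences of them.\<close>

lemma rate_split_exists:
  fixes R1 R2 I1 I2 a1 b1 c1 d1 a2 b2 c2 d2 :: real
  assumes I: "0 \<le> I1" "0 \<le> I2" and R: "0 \<le> R1" "0 \<le> R2"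
    and rel1: "a1 \<le> c1" "b1 \<le> d1" "b1 \<le> a1 + I1" "d1 \<le> c1 + I1"
    and rel2: "a2 \<le> c2" "b2 \<le> d2" "b2 \<le> a2 + I2" "d2 \<le> c2 + I2"
    and rates: "R1 < b1" "R2 < b2" "R1 + R2 < a1 + d2" "R1 + R2 < c1 + c2" "R1 + R2 < d1 + a2"
      "2 * R1 + R2 < a1 + c2 + d1" "R1 + 2 * R2 < a2 + c1 + d2"
  shows "\<exists>r1 r2. 0 \<le> r1 \<and> r1 \<le> I1 \<and> 0 \<le> r2 \<and> r2 \<le> I2 \<and>
    R1 - r1 < a1 \<and> R1 - r1 + r2 < c1 \<and> R1 + r2 < d1 \<and> R2 - r2 < a2 \<and> R2 - r2 + r1 < c2 \<and> R2 + r1 < d2"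
proof -
  \<comment> \<open>R2 - a2 and d1 - R1 are direct conditions. R1 + R2 - a1 - c2 and c1 + d2 - R1 -
    R2 come from two opposite bounds on \<open>r1\<close>, while R2 - c2 and I1 + c1 - R1 express
    that \<open>r1\<close> must fit between 0 and \<open>I1\<close>.\<close>
  obtain r2 where r2: "0 \<le> r2" "r2 \<le> I2"
    "max (R2 - a2) (max (R1 + R2 - a1 - c2) (R2 - c2)) < r2"
    "r2 < min (d1 - R1) (min (c1 + d2 - R1 - R2) (I1 + c1 - R1))"
    using ex_between_box[of "max (R2 - a2) (max (R1 + R2 - a1 - c2) (R2 - c2))"
        "min (d1 - R1) (min (c1 + d2 - R1 - R2) (I1 + c1 - R1))" I2] assms
    by (auto simp: less_max_iff_disj)
  obtain r1 where r1: "0 \<le> r1" "r1 \<le> I1" "max (R1 - a1) (R1 + r2 - c1) < r1" "r1 < min (c2 - R2 + r2) (d2 - R2)"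
    using ex_between_box[of "max (R1 - a1) (R1 + r2 - c1)" "min (c2 - R2 + r2) (d2 - R2)" I1] assms r2
    by auto
  show ?thesis using r1 r2 by (intro exI[of _ r1] exI[of _ r2]) auto
qed

lemma prob_not_typical_tendsto_0:
  fixes p :: "'a::finite pmf"
  assumes "0 < \<epsilon>"
  shows "(\<lambda>n. measure_pmf.prob (seq_pmf n (\<lambda>_. p)) {s. s \<notin> typical \<epsilon> n p}) \<longlonglongrightarrow> 0"
proof -
  obtain c where "c > 0" "\<And>n. measure_pmf.prob (seq_pmf n (\<lambda>_. p)) {s. s \<notin> typical \<epsilon> n p} \<le> 2 * CARD('a) * 2 powr (- (c * real n))"
    using prob_not_typical_exponential[OF assms, of p] by blast
  then show ?thesis
    by (intro exp_decay_tendsto_0[where \<delta>=c and K="2 * CARD('a)"]) (auto simp: mult.commute)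
qed

text \<open>For t = I - \<open>\<epsilon>'\<close> S the last hypothesis says that the densities of
  the two selected pairs together grow more slowly than atypicality decays.\<close>

lemma joint_term_tendsto_0:
  fixes p :: "nat \<Rightarrow> real"
  assumes nn: "0 \<le> R1c" "0 \<le> R1p" "0 \<le> R2c" "0 \<le> R2p"
    and p: "\<And>n. 0 \<le> p n" "\<And>n. p n \<le> K * 2 powr (- (c * real n))"
    and lt: "R1c + R1p + R2c + R2p < t1 + t2 + c"
  shows "(\<lambda>n. (size_ix n R1c * size_ix n R1p) * (2 powr (- (real n * t1)) *
      ((size_ix n R2c * size_ix n R2p) * (2 powr (- (real n * t2)) * p n)))) \<longlonglongrightarrow> 0"
proof (rule exp_decay_tendsto_0[where K="16 * K" and \<delta>="t1 + t2 + c - (R1c + R1p + R2c + R2p)"])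
  fix n
  let ?c = "\<lambda>R. size_ix n R"
  have pair: "?c R * ?c R' \<le> 4 * 2 powr (real n * (R + R'))" if "0 \<le> R" "0 \<le> R'" for R R'
    using mult_mono[OF card_index_set_le[OF that(1), of n] card_index_set_le[OF that(2), of n]]
    by (simp add: powr_add distrib_left mult.assoc mult.left_commute)
  have "?c R1c * ?c R1p * (2 powr (- (real n * t1)) * (?c R2c * ?c R2p * (2 powr (- (real n * t2)) * p n))) \<le>
    4 * 2 powr (real n * (R1c + R1p)) * (2 powr (- (real n * t1)) * (4 * 2 powr (real n * (R2c + R2p)) *
      (2 powr (- (real n * t2)) * (K * 2 powr (- (c * real n))))))"
    using p by (intro mult_mono pair nn order_refl) (auto intro!: mult_nonneg_nonneg order.trans[OF p(1) p(2)])
  also have "\<dots> = 16 * K * (2 powr (real n * (R1c + R1p)) * 2 powr (- (real n * t1)) * 2 powr (real n * (R2c + R2p)) * 2 powr (- (real n * t2)) * 2 powr (- (c * real n)))"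
    by simp
  also have "\<dots> = 16 * K * 2 powr (- (real n * (t1 + t2 + c - (R1c + R1p + R2c + R2p))))"
    unfolding powr_add[symmetric] by (simp add: algebra_simps)
  finally show "?c R1c * ?c R1p * (2 powr (- (real n * t1)) * (?c R2c * ?c R2p * (2 powr (- (real n * t2)) * p n))) \<le> \<dots>" .
qed (use lt p in auto)

theorem mainTheorem1:
  fixes pQ :: "'q::finite pmf"
    and K1 :: "'q \<Rightarrow> ('u1::finite \<times> 'x1::finite) pmf"
    and K2 :: "'q \<Rightarrow> ('u2::finite \<times> 'x2::finite) pmf"
    and W :: "'x1 \<Rightarrow> 'x2 \<Rightarrow> ('y1::finite \<times> 'y2::finite) pmf"
    and J :: "('q, 'u1, 'x1, 'u2, 'x2, 'y1, 'y2) vals pmf"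
    and R1 R2 :: real
  assumes J: "J = joint_pmf pQ K1 K2 W"
    and R1_nonneg: "0 \<le> R1"
    and R2_nonneg: "0 \<le> R2"
    and rate1: "R1 < cond_mutual_info J rvX1 rvY1 (\<lambda>w. (rvU2 w, rvQ w))"
    and rate2: "R2 < cond_mutual_info J rvX2 rvY2 (\<lambda>w. (rvU1 w, rvQ w))"
    and rate3: "R1 + R2 <
        cond_mutual_info J rvX1 rvY1 (\<lambda>w. (rvU1 w, rvU2 w, rvQ w)) +
        cond_mutual_info J (\<lambda>w. (rvX2 w, rvU1 w)) rvY2 rvQ"
    and rate4: "R1 + R2 <
        cond_mutual_info J (\<lambda>w. (rvX1 w, rvU2 w)) rvY1 (\<lambda>w. (rvU1 w, rvQ w)) +
        cond_mutual_info J (\<lambda>w. (rvX2 w, rvU1 w)) rvY2 (\<lambda>w. (rvU2 w, rvQ w))"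
    and rate5: "R1 + R2 <
        cond_mutual_info J (\<lambda>w. (rvX1 w, rvU2 w)) rvY1 rvQ +
        cond_mutual_info J rvX2 rvY2 (\<lambda>w. (rvU1 w, rvU2 w, rvQ w))"
    and rate6: "2 * R1 + R2 <
        cond_mutual_info J rvX1 rvY1 (\<lambda>w. (rvU1 w, rvU2 w, rvQ w)) +
        cond_mutual_info J (\<lambda>w. (rvX2 w, rvU1 w)) rvY2 (\<lambda>w. (rvU2 w, rvQ w)) +
        cond_mutual_info J (\<lambda>w. (rvX1 w, rvU2 w)) rvY1 rvQ"
    and rate7: "R1 + 2 * R2 <
        cond_mutual_info J rvX2 rvY2 (\<lambda>w. (rvU1 w, rvU2 w, rvQ w)) +
        cond_mutual_info J (\<lambda>w. (rvX1 w, rvU2 w)) rvY1 (\<lambda>w. (rvU1 w, rvQ w)) +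
        cond_mutual_info J (\<lambda>w. (rvX2 w, rvU1 w)) rvY2 rvQ"
  shows "\<exists>R1c R1p R2c R2p \<epsilon>' \<epsilon> :: real.
           0 \<le> R1c \<and> 0 \<le> R1p \<and> 0 \<le> R2c \<and> 0 \<le> R2p \<and> 0 < \<epsilon>' \<and> \<epsilon>' < \<epsilon> \<and>
           (\<lambda>n. multicoding_error pQ K1 K2 W R1 R2 R1c R1p R2c R2p \<epsilon>' \<epsilon> n) \<longlonglongrightarrow> 0"
proof -
  interpret ch: interference_channel pQ K1 K2 W .
  have JJ: "ch.J = J" by (simp add: J ch.J_def)
  define I1 where "I1 = ch.r1.rate_I"
  define I2 where "I2 = ch.r2.rate_I"
  define A1 where "A1 = ch.r1.rate_A" define B1 where "B1 = ch.r1.rate_B"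
  define C1 where "C1 = ch.r1.rate_C" define D1 where "D1 = ch.r1.rate_D"
  define A2 where "A2 = ch.r2.rate_A" define B2 where "B2 = ch.r2.rate_B"
  define C2 where "C2 = ch.r2.rate_C" define D2 where "D2 = ch.r2.rate_D"
  define S1 where "S1 = ch.r1.spread" define S2 where "S2 = ch.r2.spread"
  note defs = I1_def I2_def A1_def B1_def C1_def D1_def A2_def B2_def C2_def D2_def S1_def S2_def
  note eq1 = ch.r1.rates_eq_cond_mutual_info[OF ch.law1, folded defs, unfolded JJ]
  note eq2 = ch.r2.rates_eq_cond_mutual_info[OF ch.law2, folded defs, unfolded JJ]
  have swap: "cond_mutual_info J rvX2 rvY2 (\<lambda>w. (rvU1 w, rvU2 w, rvQ w)) =
      cond_mutual_info J rvX2 rvY2 (\<lambda>w. (rvU2 w, rvU1 w, rvQ w))"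
    unfolding cond_mutual_info_plogp
    by (intro arg_cong2[of _ _ _ _ minus] arg_cong2[of _ _ _ _ plus] plogp_cong) auto
  have rel: "0 \<le> I1" "A1 \<le> C1" "B1 \<le> D1" "B1 \<le> A1 + I1" "D1 \<le> C1 + I1"
    "0 \<le> I2" "A2 \<le> C2" "B2 \<le> D2" "B2 \<le> A2 + I2" "D2 \<le> C2 + I2"
    using ch.r1.rate_relations ch.r2.rate_relations unfolding defs by auto
  have S: "0 \<le> S1" "0 \<le> S2" unfolding defs by (rule ch.r1.spread_ge(8) ch.r2.spread_ge(8))+
  obtain \<rho>1 \<rho>2 where \<rho>: "0 \<le> \<rho>1" "\<rho>1 \<le> I1" "0 \<le> \<rho>2" "\<rho>2 \<le> I2"
    "R1 - \<rho>1 < A1 - I1" "R1 - \<rho>1 + \<rho>2 < C1 - I1" "R1 + \<rho>2 < D1 - I1"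
    "R2 - \<rho>2 < A2 - I2" "R2 - \<rho>2 + \<rho>1 < C2 - I2" "R2 + \<rho>1 < D2 - I2"
    using rate_split_exists[of I1 I2 R1 R2 "A1 - I1" "C1 - I1" "B1 - I1" "D1 - I1" "A2 - I2" "C2 - I2" "B2 - I2" "D2 - I2"]
      rel R1_nonneg R2_nonneg rate1 rate2 rate3 rate4 rate5 rate6 rate7 eq1 eq2 swap by auto
  \<comment> \<open>A wrong own index next to a right foreign one involves Rc + Rp only, where the
    split cancels, so these conditions are the individual rate bounds themselves.\<close>
  have B: "R1 < B1 - I1" "R2 < B2 - I2" using rate1 rate2 eq1 eq2 by auto
  \<comment> \<open>The smallest slack among the eight packing conditions, four for each
    receiver.\<close>
  define \<eta> where "\<eta> = Min {A1 - I1 - (R1 - \<rho>1), B1 - I1 - R1, C1 - I1 - (R1 - \<rho>1 + \<rho>2), D1 - I1 - (R1 + \<rho>2),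
    A2 - I2 - (R2 - \<rho>2), B2 - I2 - R2, C2 - I2 - (R2 - \<rho>2 + \<rho>1), D2 - I2 - (R2 + \<rho>1)}"
  have \<eta>: "0 < \<eta>" unfolding \<eta>_def using \<rho> B by (subst Min_gr_iff) auto
  have \<eta>_le: "\<eta> \<le> A1 - I1 - (R1 - \<rho>1)" "\<eta> \<le> B1 - I1 - R1" "\<eta> \<le> C1 - I1 - (R1 - \<rho>1 + \<rho>2)" "\<eta> \<le> D1 - I1 - (R1 + \<rho>2)"
    "\<eta> \<le> A2 - I2 - (R2 - \<rho>2)" "\<eta> \<le> B2 - I2 - R2" "\<eta> \<le> C2 - I2 - (R2 - \<rho>2 + \<rho>1)" "\<eta> \<le> D2 - I2 - (R2 + \<rho>1)"
    unfolding \<eta>_def by (rule Min_le; simp)+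
  \<comment> \<open>The summand 1 keeps \<open>s\<close> positive, so that it can be divided
    by.\<close>
  define s where "s = S1 + S2 + 1"
  have s: "0 < s" "S1 \<le> s" "S2 \<le> s" "S1 + S2 \<le> s" using S by (auto simp: s_def)
  \<comment> \<open>Typicality may use up half of the slack \<open>\<eta>\<close>.\<close>
  define \<epsilon> where "\<epsilon> = \<eta> / (2 * s)"
  have \<epsilon>: "0 < \<epsilon>" using \<eta> s by (simp add: \<epsilon>_def)
  have "\<epsilon> * s = \<eta> / 2" using s by (simp add: \<epsilon>_def)
  then have \<epsilon>S: "\<epsilon> * S1 \<le> \<eta> / 2" "\<epsilon> * S2 \<le> \<eta> / 2"
    using mult_left_mono[OF s(2), of \<epsilon>] mult_left_mono[OF s(3), of \<epsilon>] \<epsilon> by auto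
  \<comment> \<open>\<open>c\<close> depends on \<epsilon> alone, which is why \<epsilon> had to be
    fixed before \<open>g\<close> and \<open>\<epsilon>'\<close>.\<close>
  obtain c where c: "0 < c" and pJ: "\<And>n. measure_pmf.prob (seq_pmf n (\<lambda>_. J)) {s. s \<notin> typical \<epsilon> n J} \<le>
      2 * CARD('q \<times> 'u1 \<times> 'x1 \<times> 'u2 \<times> 'x2 \<times> 'y1 \<times> 'y2) * 2 powr (- (c * real n))"
    using prob_not_typical_exponential[OF \<epsilon>, of J] by blast
  \<comment> \<open>Packing carries at most 3g, which fits into the other half of
    \<open>\<eta>\<close> since g is at most \<open>\<eta>\<close> / 8. The two selected pairs have
    excess 4g plus at most g / 4, which is below c since g is at most c / 8.\<close>
  define g where "g = min (\<eta> / 8) (c / 8)"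
  have g: "0 < g" "g \<le> \<eta> / 8" "g \<le> c / 8" using \<eta> c by (auto simp: g_def)
  \<comment> \<open>The first bound keeps \<open>\<epsilon>'\<close> below \<epsilon>; the second
    keeps the losses in covering small against \<open>g\<close>.\<close>
  define \<epsilon>' where "\<epsilon>' = min (\<epsilon> / 2) (g / (4 * s))"
  have \<epsilon>': "0 < \<epsilon>'" "\<epsilon>' < \<epsilon>" using \<epsilon> g s by (auto simp: \<epsilon>'_def)
  have "\<epsilon>' * s \<le> g / (4 * s) * s" using s by (intro mult_right_mono) (auto simp: \<epsilon>'_def)
  also have "\<dots> = g / 4" using s by simp
  finally have e's: "\<epsilon>' * s \<le> g / 4" .
  have \<epsilon>'S: "\<epsilon>' * S1 \<le> g / 4" "\<epsilon>' * S2 \<le> g / 4" "\<epsilon>' * S1 + \<epsilon>' * S2 \<le> g / 4"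
  proof -
    have "\<epsilon>' * S1 \<le> \<epsilon>' * s" "\<epsilon>' * S2 \<le> \<epsilon>' * s" "\<epsilon>' * (S1 + S2) \<le> \<epsilon>' * s"
      using s \<epsilon>' by (intro mult_left_mono; simp)+
    then show "\<epsilon>' * S1 \<le> g / 4" "\<epsilon>' * S2 \<le> g / 4" "\<epsilon>' * S1 + \<epsilon>' * S2 \<le> g / 4"
      using e's by (simp_all only: distrib_left)
  qed
  \<comment> \<open>Adding \<open>g\<close> to both rates makes their sum exceed I by 2g and keeps
    each positive even when the split lies at an end of its interval.\<close>
  define R1c where "R1c = \<rho>1 + g" define R1p where "R1p = I1 - \<rho>1 + g"
  define R2c where "R2c = \<rho>2 + g" define R2p where "R2p = I2 - \<rho>2 + g"
  note R_defs = R1c_def R1p_def R2c_def R2p_def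
  have R: "0 \<le> R1c" "0 \<le> R1p" "0 \<le> R2c" "0 \<le> R2p" using \<rho> g by (auto simp: R_defs)
  have cov: "(\<lambda>n. cover_bound I1 S1 \<epsilon>' n R1c R1p) \<longlonglongrightarrow> 0" "(\<lambda>n. cover_bound I2 S2 \<epsilon>' n R2c R2p) \<longlonglongrightarrow> 0"
    using \<rho> g \<epsilon>'S by (auto intro!: cover_bound_tendsto_0 simp: R_defs)
  have pack: "(\<lambda>n. pack_bound A1 B1 C1 D1 S1 \<epsilon> n R1 R1p R1c R2c) \<longlonglongrightarrow> 0"
    "(\<lambda>n. pack_bound A2 B2 C2 D2 S2 \<epsilon> n R2 R2p R2c R1c) \<longlonglongrightarrow> 0"
    using R R1_nonneg R2_nonneg \<eta>_le \<epsilon>S g \<eta> by (auto intro!: pack_bound_tendsto_0 simp: R_defs)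
  have joint: "(\<lambda>n. (size_ix n R1c * size_ix n R1p) * (2 powr (- (real n * (I1 - \<epsilon>' * S1))) *
      ((size_ix n R2c * size_ix n R2p) * (2 powr (- (real n * (I2 - \<epsilon>' * S2))) *
       measure_pmf.prob (seq_pmf n (\<lambda>_. J)) {s. s \<notin> typical \<epsilon> n J})))) \<longlonglongrightarrow> 0"
    by (rule joint_term_tendsto_0[OF R _ pJ]) (use g c \<epsilon>'S in \<open>auto simp: R_defs\<close>)
  note error_le = ch.multicoding_error_le[OF less_imp_le[OF \<epsilon>'(1)] less_imp_le[OF \<epsilon>], folded defs, unfolded JJ]
  have "(\<lambda>n. multicoding_error pQ K1 K2 W R1 R2 R1c R1p R2c R2p \<epsilon>' \<epsilon> n) \<longlonglongrightarrow> 0"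
    by (rule tendsto_sandwich[OF _ always_eventually[OF allI[OF error_le]] tendsto_const])
      (simp add: multicoding_error_def,
        intro tendsto_add_zero tendsto_mult_right_zero prob_not_typical_tendsto_0[OF \<epsilon>'(1)] cov joint pack)
  then show ?thesis using R \<epsilon>' by blast
qed

end
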